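(* Let $\alpha\in(1,2]$ and let $f:[0,\infty)\to[0,\infty)$ be continuous and non-decreasing. Consider $u_t=\Delta^{\alpha/2}u+f(u)$ on $\mathbb{R}^d$, $u(0)=u_0\ge0$. Then: (i) for $q\in(1,\infty)$, the problem has the local existence property in $L^q(\mathbb{R}^d)$ if and only if $$\limsup_{s\to0}\frac{f(s)}{s}<\infty\quad\text{and}\quad\limsup_{s\to\infty}s^{-(1+\alpha q/d)}f(s)<\infty;$$ (ii) the problem has the local existence property in $L^1(\mathbb{R}^d)$ if and only if $$\limsup_{s\to0}\frac{f(s)}{s}<\infty\quad\text{and}\quad\int_1^\infty s^{-(1+\alpha/d)}F(s)\,ds<\infty,\qquad F(s)=\sup_{1\le t\le s}\frac{f(t)}{t}.$$
   Context: $\Delta^{\alpha/2}=-(-\Delta)^{\alpha/2}$ is the fractional Laplacian on $\mathbb{R}^d$, with heat kernel $p(t,x,y)$, and $S_\alpha(t)u(x)=\int_{\mathbb{R}^d}p(t,x,y)u(y)dy$ is the fractional heat semigroup on $\mathbb{R}^d$. A local integral solution on $[0,T)$ is a measurable, a.e. finite $u:\mathbb{R}^d\times[0,T)\to[0,\infty)$ with $u(t)=S_\alpha(t)u_0+\int_0^tS_\alpha(t-s)f(u(s))ds$ a.e. A local $L^q$ solution is a local integral solution on $[0,T)$ for some $T>0$ with $u\in L^\infty((0,T);L^q(\mathbb{R}^d))$. The problem has the local existence property in $L^q(\mathbb{R}^d)$ if for every non-negative $u_0\in L^q(\mathbb{R}^d)$ there is a local $L^q$ solution. *)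

theory Defs
  imports "HOL-Analysis.Analysis"
begin

text \<open>Heat kernel of the fractional Laplacian on R^d (d = CARD('n)), defined through its
Fourier representation: p(t,x,y) = (2 pi)^(-d) * integral of cos(xi.(x-y)) * exp(-t |xi|^alpha) dxi.\<close>
definition frac_heat_kernel :: "real \<Rightarrow> real \<Rightarrow> real^'n \<Rightarrow> real^'n \<Rightarrow> real" where
  "frac_heat_kernel \<alpha> t x y =
     (1 / (2 * pi) ^ CARD('n)) *
     (\<integral> \<xi>. cos (\<xi> \<bullet> (x - y)) * exp (- t * norm \<xi> powr \<alpha>) \<partial>lborel)"

definition frac_semigroup :: "real \<Rightarrow> real \<Rightarrow> (real^'n \<Rightarrow> real) \<Rightarrow> real^'n \<Rightarrow> ennreal" where
  "frac_semigroup \<alpha> t g x = (\<integral>\<^sup>+ y. ennreal (frac_heat_kernel \<alpha> t x y * g y) \<partial>lborel)"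

definition in_Lq :: "real \<Rightarrow> (real^'n \<Rightarrow> real) \<Rightarrow> bool" where
  "in_Lq q g \<longleftrightarrow> g \<in> borel_measurable lborel \<and> (\<integral>\<^sup>+ x. ennreal (\<bar>g x\<bar> powr q) \<partial>lborel) < \<infinity>"

text \<open>Local integral solution on [0,T) of u_t = Delta^(alpha/2) u + f(u), u(0) = u0.
  u x t is the value at (x,t); the Duhamel formula holds for a.e. (x,t) in R^d x (0,T).\<close>
definition local_integral_solution ::
  "real \<Rightarrow> (real \<Rightarrow> real) \<Rightarrow> (real^'n \<Rightarrow> real) \<Rightarrow> real \<Rightarrow> (real^'n \<Rightarrow> real \<Rightarrow> real) \<Rightarrow> bool" where
  "local_integral_solution \<alpha> f u0 T u \<longleftrightarrow>
     (\<lambda>z. u (fst z) (snd z)) \<in> borel_measurable (lborel \<Otimes>\<^sub>M lborel) \<and>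
     (\<forall>x t. 0 \<le> u x t) \<and>
     (AE z in lborel \<Otimes>\<^sub>M lborel. snd z \<in> {0<..<T} \<longrightarrow>
        ennreal (u (fst z) (snd z)) =
          frac_semigroup \<alpha> (snd z) u0 (fst z) +
          (\<integral>\<^sup>+ s\<in>{0<..<snd z}. frac_semigroup \<alpha> (snd z - s) (\<lambda>y. f (u y s)) (fst z) \<partial>lborel))"

definition local_Lq_solution ::
  "real \<Rightarrow> (real \<Rightarrow> real) \<Rightarrow> real \<Rightarrow> (real^'n \<Rightarrow> real) \<Rightarrow> real \<Rightarrow> (real^'n \<Rightarrow> real \<Rightarrow> real) \<Rightarrow> bool" where
  "local_Lq_solution \<alpha> f q u0 T u \<longleftrightarrow>
     0 < T \<and> local_integral_solution \<alpha> f u0 T u \<and>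
     (\<exists>C::real. AE t in lborel. t \<in> {0<..<T} \<longrightarrow>
        (\<integral>\<^sup>+ x. ennreal (\<bar>u x t\<bar> powr q) \<partial>lborel) \<le> ennreal C)"

definition local_existence_property ::
  "'n::finite itself \<Rightarrow> real \<Rightarrow> (real \<Rightarrow> real) \<Rightarrow> real \<Rightarrow> bool" where
  "local_existence_property _ \<alpha> f q \<longleftrightarrow>
     (\<forall>u0 :: real^'n \<Rightarrow> real. in_Lq q u0 \<and> (\<forall>x. 0 \<le> u0 x) \<longrightarrow>
        (\<exists>T u. local_Lq_solution \<alpha> f q u0 T u))"

definition sup_ratio :: "(real \<Rightarrow> real) \<Rightarrow> real \<Rightarrow> real" where
  "sup_ratio f s = Sup ((\<lambda>t. f t / t) ` {1..s})"

end

theory Submission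
  imports Defs "HOL-Probability.Characteristic_Functions" "HOL-Probability.Sinc_Integral"
begin

text \<open>
The heat kernel is nonnegative because \<open>exp (- t \<bar>\<xi>\<bar>\<^sup>\<alpha>)\<close> is a limit of mixtures of cosines; Gaussian
regularisation of the Fourier integral then yields total mass one and the semigroup law.

Existence follows by monotone iteration below a supersolution. In \<open>L\<^sup>1\<close> twice the free evolution
\<open>S(t) u0\<close> is a supersolution; in \<open>L\<^sup>q\<close> with \<open>q > 1\<close> and critical exponent \<open>m = 1 + \<alpha> q / d\<close> one takes
\<open>2 (S(t) u0\<^sup>r)\<^bsup>1/r\<^esup>\<close> with \<open>r = min m q\<close>, which Jensen's inequality keeps in \<open>L\<^sup>q\<close>.

For non-existence, initial data of height \<open>b\<close> on a ball of radius \<open>R\<close> keep height comparable to \<open>b\<close> there up to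
time \<open>R\<^sup>\<alpha>\<close>, so the Duhamel term forces height comparable to \<open>t f(c b)\<close>. Superposing infinitely many such plateaus
(large balls for the behaviour of \<open>f\<close> at 0, small balls for the behaviour at infinity) makes the \<open>L\<^sup>q\<close> norm
unbounded. In \<open>L\<^sup>1\<close> the plateaus approximate point masses, whose evolution has height comparable to \<open>t\<^bsup>-d/\<alpha>\<^esup>\<close>
on balls of radius comparable to \<open>t\<^bsup>1/\<alpha>\<^esup>\<close>, and the mass produced by the nonlinearity diverges.
\<close>

section \<open>Functions with nonnegative cosine transform\<close>

text \<open>The exponent \<open>m = 1 + \<alpha> q / d\<close> is the scaling-critical one, so
  shortening the time interval gains nothing in the superlinear term. For \<open>q > 1\<close> the
  gain comes from \<open>H t h = o(t powr (- (d / \<alpha>)))\<close> for integrable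
  \<open>h\<close>, applied to the \<open>q\<close>-th power of \<open>u0\<close>. The choice of
  \<open>r\<close> meets three demands: \<open>r \<le> q\<close> for Jensen,
  \<open>r \<le> m\<close> so that the power of the evolution left over in the nonlinear term is
  nonnegative and can be bounded, and \<open>r > 1\<close> so that the time integral converges at 0.

  For \<open>q = 1\<close> the demands \<open>r \<le> q\<close> and \<open>r > 1\<close> collide: at
  \<open>r = 1\<close> the critical power would give a logarithmically divergent time integral, and
  an integral condition on \<open>f\<close> takes the place of a pointwise one. A supersolution must
  control \<open>f s / s\<close> at every height up to that of the free evolution, hence the running
  supremum \<open>F\<close>; the lower bound for solutions sees \<open>f\<close> at one height per
  time only. The two meet because \<open>f\<close> is monotone, which makes the integrals of
  \<open>F\<close> and of \<open>f s / s\<close> against the same weight converge together.\<close>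

lemma LIMSEQ_one_over_Suc: "(\<lambda>n. 1 / real (Suc n)) \<longlonglongrightarrow> 0"
  using LIMSEQ_inverse_real_of_nat by (simp add: divide_inverse)

section \<open>Gaussian integrals on a Euclidean space\<close>

lemma
  fixes f :: "'a::euclidean_space \<Rightarrow> real \<Rightarrow> 'b::{real_normed_field,banach,second_countable_topology}"
  assumes "\<And>b. b \<in> Basis \<Longrightarrow> integrable lborel (f b)"
  shows integrable_lborel_prod_Basis: "integrable lborel (\<lambda>x. \<Prod>b\<in>Basis. f b (x \<bullet> b))"
    and integral_lborel_prod_Basis:
      "(LBINT x. (\<Prod>b\<in>Basis. f b (x \<bullet> b))) = (\<Prod>b\<in>Basis. LBINT x. f b x)"
proof -
  interpret product_sigma_finite "\<lambda>b::'a. lborel :: real measure" ..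
  have [measurable]: "f b \<in> borel_measurable borel" if "b \<in> Basis" for b
    using assms[OF that] by auto
  have [measurable]: "(\<lambda>g. \<Sum>b\<in>Basis. g b *\<^sub>R b) \<in> (\<Pi>\<^sub>M b\<in>Basis. lborel) \<rightarrow>\<^sub>M (borel :: 'a measure)"
    by measurable
  have [measurable]: "(\<lambda>x. \<Prod>b\<in>Basis. f b (x \<bullet> b)) \<in> borel_measurable borel"
    by measurable
  have eq: "(\<Prod>b\<in>Basis. f b ((\<Sum>b\<in>Basis. g b *\<^sub>R b) \<bullet> b)) = (\<Prod>b\<in>Basis. f b (g b))" for g
    by simp
  \<comment> \<open>\<open>lborel_eq\<close> presents Lebesgue measure as the image of a product of
    one-dimensional ones under the coordinate map, so Fubini for finite products applies.\<close>
  show "integrable lborel (\<lambda>x. \<Prod>b\<in>Basis. f b (x \<bullet> b))"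
    by (subst lborel_eq, subst integrable_distr_eq) (auto simp: eq intro!: product_integrable_prod assms)
  show "(LBINT x. (\<Prod>b\<in>Basis. f b (x \<bullet> b))) = (\<Prod>b\<in>Basis. LBINT x. f b x)"
    by (subst lborel_eq, subst integral_distr) (auto simp: eq intro!: product_integral_prod assms)
qed

lemma
 fixes f :: "'a::euclidean_space \<Rightarrow> real"
  assumes c: "c \<noteq> 0" and f [measurable]: "f \<in> borel_measurable borel"
  shows lborel_integrable_affine_iff: "integrable lborel (\<lambda>x. f (t + c *\<^sub>R x)) \<longleftrightarrow> integrable lborel f"
    and lborel_integral_affine:
      "(LBINT x. f x) = \<bar>c\<bar> ^ DIM('a) * (LBINT x. f (t + c *\<^sub>R x))"
proof -
  note A = lborel_affine[OF c, of t]
  have "integrable lborel f \<longleftrightarrow> integrable (density (distr lborel borel (\<lambda>x. t + c *\<^sub>R x)) (\<lambda>_. \<bar>c\<bar> ^ DIM('a))) f"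
    using A by simp
  also have "\<dots> \<longleftrightarrow> integrable (distr lborel borel (\<lambda>x. t + c *\<^sub>R x)) (\<lambda>x. \<bar>c\<bar> ^ DIM('a) * f x)"
    by (subst integrable_density) auto
  also have "\<dots> \<longleftrightarrow> integrable lborel (\<lambda>x. \<bar>c\<bar> ^ DIM('a) * f (t + c *\<^sub>R x))"
    by (subst integrable_distr_eq) auto
  also have "\<dots> \<longleftrightarrow> integrable lborel (\<lambda>x. f (t + c *\<^sub>R x))"
    using c by simp
  finally show "integrable lborel (\<lambda>x. f (t + c *\<^sub>R x)) \<longleftrightarrow> integrable lborel f" ..
  have "(LBINT x. f x) = (\<integral>x. f x \<partial>density (distr lborel borel (\<lambda>x. t + c *\<^sub>R x)) (\<lambda>_. \<bar>c\<bar> ^ DIM('a)))"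
    using A by simp
  also have "\<dots> = (\<integral>x. \<bar>c\<bar> ^ DIM('a) * f x \<partial>distr lborel borel (\<lambda>x. t + c *\<^sub>R x))"
    by (subst integral_density) auto
  also have "\<dots> = (LBINT x. \<bar>c\<bar> ^ DIM('a) * f (t + c *\<^sub>R x))"
    by (subst integral_distr) auto
  finally show "(LBINT x. f x) = \<bar>c\<bar> ^ DIM('a) * (LBINT x. f (t + c *\<^sub>R x))"
    by simp
qed

lemma nn_integral_lborel_affine:
  fixes f :: "'a::euclidean_space \<Rightarrow> ennreal"
  assumes c: "c \<noteq> 0" and f [measurable]: "f \<in> borel_measurable borel"
  shows "(\<integral>\<^sup>+x. f x \<partial>lborel) = ennreal (\<bar>c\<bar> ^ DIM('a)) * (\<integral>\<^sup>+x. f (t + c *\<^sub>R x) \<partial>lborel)"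
  by (subst lborel_affine[OF c, of t])
    (simp add: nn_integral_density nn_integral_distr nn_integral_cmult ennreal_power)

text \<open>This is the characteristic function of the standard normal distribution without its
  normalisation. The complex form is kept because exponentials factor over the coordinates and
  cosines do not.\<close>

lemma
  fixes t :: real
  shows integrable_iexp_gaussian: "integrable lborel (\<lambda>x. iexp (t * x) * complex_of_real (exp (- (x\<^sup>2 / 2))))"
    and integral_iexp_gaussian:
      "(LBINT x. iexp (t * x) * complex_of_real (exp (- (x\<^sup>2 / 2))))
        = complex_of_real (sqrt (2 * pi) * exp (- (t\<^sup>2 / 2)))"
proof -
  have eq: "iexp (t * x) * complex_of_real (exp (- (x\<^sup>2 / 2)))
      = complex_of_real (sqrt (2 * pi)) * (std_normal_density x *\<^sub>R iexp (t * x))" for x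
    by (simp add: std_normal_density_def scaleR_conv_of_real)
  have i: "integrable lborel (\<lambda>x. std_normal_density x *\<^sub>R iexp (t * x))"
    by (rule Bochner_Integration.integrable_bound[OF integrable_normal_density[of 1 0]])
       (auto simp: norm_mult)
  show "integrable lborel (\<lambda>x. iexp (t * x) * complex_of_real (exp (- (x\<^sup>2 / 2))))"
    unfolding eq by (intro integrable_mult_right i)
  have "(LBINT x. std_normal_density x *\<^sub>R iexp (t * x)) = char std_normal_distribution t"
    unfolding char_def by (subst integral_density) auto
  also have "\<dots> = complex_of_real (exp (- (t\<^sup>2 / 2)))"
    by (simp add: char_std_normal_distribution)
  finally show "(LBINT x. iexp (t * x) * complex_of_real (exp (- (x\<^sup>2 / 2))))
        = complex_of_real (sqrt (2 * pi) * exp (- (t\<^sup>2 / 2)))"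
    unfolding eq integral_mult_right_zero by simp
qed

lemma norm_power2_eq_sum_Basis: "(norm x)\<^sup>2 = (\<Sum>b\<in>Basis. (x \<bullet> b)\<^sup>2)" for x :: "'a::euclidean_space"
  by (subst power2_norm_eq_inner, subst euclidean_inner) (simp add: power2_eq_square)

text \<open>The real part is taken only after the complex integral has been split into coordinates;
  \<open>s\<close> is then inserted by scaling the variable.\<close>

lemma
  fixes \<xi> :: "'a::euclidean_space"
  assumes s: "0 < s"
  shows integrable_gaussian: "integrable lborel (\<lambda>x::'a. exp (- ((s * norm x)\<^sup>2 / 2)))"
    and integral_cos_gaussian: "(LBINT x. cos (\<xi> \<bullet> x) * exp (- ((s * norm x)\<^sup>2 / 2)))
      = (sqrt (2 * pi) / s) ^ DIM('a) * exp (- ((norm \<xi> / s)\<^sup>2 / 2))"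
proof -
  have prod_eq: "(\<Prod>b\<in>Basis. iexp ((\<zeta> \<bullet> b) * (x \<bullet> b)) * complex_of_real (exp (- ((x \<bullet> b)\<^sup>2 / 2))))
      = iexp (\<zeta> \<bullet> x) * complex_of_real (exp (- ((norm x)\<^sup>2 / 2)))" for \<zeta> x :: 'a
    unfolding prod.distrib norm_power2_eq_sum_Basis
    by (subst (3) euclidean_inner)
       (simp add: exp_sum sum_distrib_left sum_negf[symmetric] sum_divide_distrib flip: of_real_prod)
  have I: "integrable lborel (\<lambda>x. iexp (\<zeta> \<bullet> x) * complex_of_real (exp (- ((norm x)\<^sup>2 / 2))))" for \<zeta> :: 'a
    unfolding prod_eq[symmetric] by (intro integrable_lborel_prod_Basis integrable_iexp_gaussian)
  have E: "(LBINT x. iexp (\<zeta> \<bullet> x) * complex_of_real (exp (- ((norm x)\<^sup>2 / 2))))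
      = complex_of_real (sqrt (2 * pi) ^ DIM('a) * exp (- ((norm \<zeta>)\<^sup>2 / 2)))" for \<zeta> :: 'a
  proof -
    have "(LBINT x. iexp (\<zeta> \<bullet> x) * complex_of_real (exp (- ((norm x)\<^sup>2 / 2))))
        = (\<Prod>b\<in>Basis. complex_of_real (sqrt (2 * pi) * exp (- ((\<zeta> \<bullet> b)\<^sup>2 / 2))))"
      unfolding prod_eq[symmetric] integral_lborel_prod_Basis[OF integrable_iexp_gaussian] integral_iexp_gaussian ..
    also have "\<dots> = complex_of_real (\<Prod>b\<in>Basis. sqrt (2 * pi) * exp (- ((\<zeta> \<bullet> b)\<^sup>2 / 2)))"
      by (rule of_real_prod[symmetric])
    also have "(\<Prod>b\<in>Basis. sqrt (2 * pi) * exp (- ((\<zeta> \<bullet> b)\<^sup>2 / 2)))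
        = sqrt (2 * pi) ^ DIM('a) * exp (- ((norm \<zeta>)\<^sup>2 / 2))"
      by (simp add: prod.distrib norm_power2_eq_sum_Basis sum_divide_distrib exp_sum flip: sum_negf)
    finally show ?thesis .
  qed
  have Re: "Re (iexp (\<zeta> \<bullet> x) * complex_of_real (exp (- ((norm x)\<^sup>2 / 2)))) = cos (\<zeta> \<bullet> x) * exp (- ((norm x)\<^sup>2 / 2))"
    for \<zeta> x :: 'a
    by (simp add: cis_conv_exp[symmetric])
  have E1: "(LBINT x. cos (\<zeta> \<bullet> x) * exp (- ((norm x)\<^sup>2 / 2))) = sqrt (2 * pi) ^ DIM('a) * exp (- ((norm \<zeta>)\<^sup>2 / 2))"
    for \<zeta> :: 'a
    using arg_cong[OF E, of Re \<zeta>] unfolding integral_Re[OF I, symmetric] Re by simp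
  have I1: "integrable lborel (\<lambda>x::'a. exp (- ((norm x)\<^sup>2 / 2)))"
    using integrable_Re[OF I[of 0]] by simp
  show "integrable lborel (\<lambda>x::'a. exp (- ((s * norm x)\<^sup>2 / 2)))"
    using lborel_integrable_affine_iff[of s "\<lambda>x::'a. exp (- ((norm x)\<^sup>2 / 2))" 0] s I1
    by (simp add: power_mult_distrib)
  have "sqrt (2 * pi) ^ DIM('a) * exp (- ((norm (\<xi> /\<^sub>R s))\<^sup>2 / 2))
     = s ^ DIM('a) * (LBINT x. cos (\<xi> \<bullet> x) * exp (- ((s * norm x)\<^sup>2 / 2)))"
    using lborel_integral_affine[of s "\<lambda>x::'a. cos ((\<xi> /\<^sub>R s) \<bullet> x) * exp (- ((norm x)\<^sup>2 / 2))" 0] s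
    unfolding E1 by (simp add: power_mult_distrib mult.assoc[symmetric] del: mult.assoc)
  then show "(LBINT x. cos (\<xi> \<bullet> x) * exp (- ((s * norm x)\<^sup>2 / 2)))
      = (sqrt (2 * pi) / s) ^ DIM('a) * exp (- ((norm \<xi> / s)\<^sup>2 / 2))"
    using s by (simp add: field_simps power_divide)
qed

section \<open>Cosine-positive functions and their multipliers\<close>

text \<open>For even \<open>g\<close> this is nonnegativity of the Fourier transform. Integrability
  is demanded as well, because the integral of a non-integrable function defaults to 0 and would
  satisfy the inequality vacuously.\<close>

definition cos_positive :: "('a::euclidean_space \<Rightarrow> real) \<Rightarrow> bool" where
  "cos_positive g \<longleftrightarrow> integrable lborel g \<and> (\<forall>x. 0 \<le> (LBINT \<xi>. cos (\<xi> \<bullet> x) * g \<xi>))"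

text \<open>The multipliers contain the cosines, since \<open>2 cos a cos b = cos (a - b) + cos (a + b)\<close>, and are closed
under products by definition; no appeal to Bochner's theorem is needed.\<close>

definition cos_multiplier :: "('a::euclidean_space \<Rightarrow> real) \<Rightarrow> bool" where
  "cos_multiplier m \<longleftrightarrow> m \<in> borel_measurable borel \<and> (\<exists>B. \<forall>\<xi>. \<bar>m \<xi>\<bar> \<le> B) \<and>
     (\<forall>g. cos_positive g \<longrightarrow> cos_positive (\<lambda>\<xi>. m \<xi> * g \<xi>))"

lemma cos_multiplierD:
  assumes "cos_multiplier m"
  shows "m \<in> borel_measurable borel" and "cos_positive g \<Longrightarrow> cos_positive (\<lambda>\<xi>. m \<xi> * g \<xi>)"
  using assms by (auto simp: cos_multiplier_def)

lemma integrable_bounded_mult: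
  fixes g :: "'a \<Rightarrow> real"
  assumes g: "integrable M g" and [measurable]: "k \<in> borel_measurable M" and k: "\<And>x. \<bar>k x\<bar> \<le> B"
  shows "integrable M (\<lambda>x. k x * g x)"
proof (rule Bochner_Integration.integrable_bound)
  show "integrable M (\<lambda>x. B * g x)"
    using g by simp
  show "(\<lambda>x. k x * g x) \<in> borel_measurable M"
    using g by measurable
  show "AE x in M. norm (k x * g x) \<le> norm (B * g x)"
    using order.trans[OF k abs_ge_self] by (auto simp: abs_mult intro!: mult_right_mono)
qed

lemma cos_positive_gaussian: "0 < s \<Longrightarrow> cos_positive (\<lambda>x::'a::euclidean_space. exp (- ((s * norm x)\<^sup>2 / 2)))"
  unfolding cos_positive_def
  using integrable_gaussian[of s, where 'a = 'a] integral_cos_gaussian[of s, where 'a = 'a]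
  by (auto simp: inner_commute intro!: mult_nonneg_nonneg)

lemma cos_multiplier_cos: "cos_multiplier (\<lambda>\<xi>. cos (\<xi> \<bullet> y))"
  unfolding cos_multiplier_def
proof (safe intro!: exI[of _ 1])
  fix g :: "'a \<Rightarrow> real" assume g: "cos_positive g"
  then have ig: "integrable lborel g" by (simp add: cos_positive_def)
  have [measurable]: "g \<in> borel_measurable borel"
    using ig by auto
  have i: "integrable lborel (\<lambda>\<xi>. cos (\<xi> \<bullet> x) * g \<xi>)" for x
    by (rule integrable_bounded_mult[OF ig, where B = 1]) auto
  show "cos_positive (\<lambda>\<xi>. cos (\<xi> \<bullet> y) * g \<xi>)"
    unfolding cos_positive_def
  proof safe
    show "integrable lborel (\<lambda>\<xi>. cos (\<xi> \<bullet> y) * g \<xi>)" by fact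
    fix x
    have "(LBINT \<xi>. cos (\<xi> \<bullet> x) * (cos (\<xi> \<bullet> y) * g \<xi>))
      = (LBINT \<xi>. (cos (\<xi> \<bullet> (x - y)) * g \<xi> + cos (\<xi> \<bullet> (x + y)) * g \<xi>) / 2)"
      by (intro Bochner_Integration.integral_cong)
         (auto simp: inner_diff_right inner_add_right cos_add cos_diff algebra_simps)
    also have "\<dots> = ((LBINT \<xi>. cos (\<xi> \<bullet> (x - y)) * g \<xi>) + (LBINT \<xi>. cos (\<xi> \<bullet> (x + y)) * g \<xi>)) / 2"
      using i by simp
    also have "\<dots> \<ge> 0"
      using g by (auto simp: cos_positive_def)
    finally show "0 \<le> (LBINT \<xi>. cos (\<xi> \<bullet> x) * (cos (\<xi> \<bullet> y) * g \<xi>))" .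
  qed
qed auto

lemma cos_multiplier_const: "0 \<le> c \<Longrightarrow> cos_multiplier (\<lambda>_. c)"
  by (auto simp: cos_multiplier_def cos_positive_def mult.left_commute)

lemma cos_multiplier_mult:
  assumes "cos_multiplier m" "cos_multiplier m'"
  shows "cos_multiplier (\<lambda>\<xi>. m \<xi> * m' \<xi>)"
proof -
  obtain B B' where "\<And>\<xi>. \<bar>m \<xi>\<bar> \<le> B" "\<And>\<xi>. \<bar>m' \<xi>\<bar> \<le> B'"
    using assms by (auto simp: cos_multiplier_def)
  then have "\<bar>m \<xi> * m' \<xi>\<bar> \<le> B * B'" for \<xi>
    unfolding abs_mult by (intro mult_mono) (auto intro: order.trans[OF abs_ge_zero])
  with assms show ?thesis
    by (auto simp: cos_multiplier_def mult.assoc)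
qed

lemma cos_multiplier_add:
  assumes "cos_multiplier m" "cos_multiplier m'"
  shows "cos_multiplier (\<lambda>\<xi>. m \<xi> + m' \<xi>)"
proof -
  obtain B B' where B: "\<And>\<xi>. \<bar>m \<xi>\<bar> \<le> B" "\<And>\<xi>. \<bar>m' \<xi>\<bar> \<le> B'"
    using assms by (auto simp: cos_multiplier_def)
  have [measurable]: "m \<in> borel_measurable borel" "m' \<in> borel_measurable borel"
    using assms by (auto simp: cos_multiplier_def)
  have "\<bar>m \<xi> + m' \<xi>\<bar> \<le> B + B'" for \<xi>
    using B[of \<xi>] by linarith
  moreover have "cos_positive (\<lambda>\<xi>. (m \<xi> + m' \<xi>) * g \<xi>)" if "cos_positive g" for g
  proof -
    have "cos_positive (\<lambda>\<xi>. m \<xi> * g \<xi>)" "cos_positive (\<lambda>\<xi>. m' \<xi> * g \<xi>)"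
      using assms that by (auto simp: cos_multiplier_def)
    then have *: "integrable lborel (\<lambda>\<xi>. m \<xi> * g \<xi>)" "integrable lborel (\<lambda>\<xi>. m' \<xi> * g \<xi>)"
      "\<And>x. 0 \<le> (LBINT \<xi>. cos (\<xi> \<bullet> x) * (m \<xi> * g \<xi>))"
      "\<And>x. 0 \<le> (LBINT \<xi>. cos (\<xi> \<bullet> x) * (m' \<xi> * g \<xi>))"
      by (auto simp: cos_positive_def)
    have "integrable lborel (\<lambda>\<xi>. cos (\<xi> \<bullet> x) * (m \<xi> * g \<xi>))" "integrable lborel (\<lambda>\<xi>. cos (\<xi> \<bullet> x) * (m' \<xi> * g \<xi>))" for x
      using *(1,2) by (auto intro!: integrable_bounded_mult[where B = 1])
    with * show ?thesis
      by (auto simp: cos_positive_def distrib_right distrib_left)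
  qed
  ultimately show ?thesis
    by (auto simp: cos_multiplier_def)
qed

lemma cos_multiplier_power: "cos_multiplier m \<Longrightarrow> cos_multiplier (\<lambda>\<xi>. m \<xi> ^ n)"
  by (induction n) (auto intro: cos_multiplier_const cos_multiplier_mult)

lemma cos_multiplier_sum:
  "(\<And>i. i \<in> I \<Longrightarrow> cos_multiplier (m i)) \<Longrightarrow> cos_multiplier (\<lambda>\<xi>. \<Sum>i\<in>I. m i \<xi>)"
  by (induction I rule: infinite_finite_induct) (auto intro: cos_multiplier_const cos_multiplier_add)

lemma cos_positive_limit:
  fixes h :: "nat \<Rightarrow> 'a::euclidean_space \<Rightarrow> real"
  assumes h: "\<And>n. cos_positive (h n)" and lim: "\<And>\<xi>. (\<lambda>n. h n \<xi>) \<longlonglongrightarrow> h' \<xi>"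
    and w: "integrable lborel w" and dom: "\<And>n \<xi>. \<bar>h n \<xi>\<bar> \<le> w \<xi>"
  shows "cos_positive h'"
proof -
  have [measurable]: "h n \<in> borel_measurable borel" for n
    using h[of n] by (auto simp: cos_positive_def)
  have [measurable]: "h' \<in> borel_measurable borel"
    using lim by (rule borel_measurable_LIMSEQ_metric[rotated]) auto
  have dom': "\<bar>cos (\<xi> \<bullet> x) * h n \<xi>\<bar> \<le> w \<xi>" for n \<xi> x
  proof -
    have "\<bar>cos (\<xi> \<bullet> x)\<bar> * \<bar>h n \<xi>\<bar> \<le> 1 * w \<xi>"
      using dom by (intro mult_mono) auto
    then show ?thesis by (simp add: abs_mult)
  qed
  have "integrable lborel h'"
    by (rule integrable_dominated_convergence[where s = h and w = w]) (use w lim dom in auto)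
  moreover have "(\<lambda>n. LBINT \<xi>. cos (\<xi> \<bullet> x) * h n \<xi>) \<longlonglongrightarrow> (LBINT \<xi>. cos (\<xi> \<bullet> x) * h' \<xi>)" for x
    by (rule integral_dominated_convergence[where w = w]) (use w lim dom' in \<open>auto intro!: tendsto_mult\<close>)
  then have "0 \<le> (LBINT \<xi>. cos (\<xi> \<bullet> x) * h' \<xi>)" for x
    by (rule LIMSEQ_le_const) (use h in \<open>auto simp: cos_positive_def\<close>)
  ultimately show ?thesis
    by (simp add: cos_positive_def)
qed

text \<open>Multipliers act on integrable functions, so the uniform bound \<open>B\<close> alone
  yields a dominating function, \<open>B * \<bar>g \<xi>\<bar>\<close>.\<close>

lemma cos_multiplier_limit:
  fixes m :: "nat \<Rightarrow> 'a::euclidean_space \<Rightarrow> real"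
  assumes m: "\<And>n. cos_multiplier (m n)" and lim: "\<And>\<xi>. (\<lambda>n. m n \<xi>) \<longlonglongrightarrow> m' \<xi>"
    and B: "\<And>n \<xi>. \<bar>m n \<xi>\<bar> \<le> B"
  shows "cos_multiplier m'"
  unfolding cos_multiplier_def
proof safe
  have [measurable]: "m n \<in> borel_measurable borel" for n
    using m by (auto simp: cos_multiplier_def)
  show "m' \<in> borel_measurable borel"
    using lim by (rule borel_measurable_LIMSEQ_metric[rotated]) auto
  have "\<bar>m' \<xi>\<bar> \<le> B" for \<xi>
    using tendsto_rabs[OF lim[of \<xi>]] by (rule LIMSEQ_le_const2) (use B in auto)
  then show "\<exists>B. \<forall>\<xi>. \<bar>m' \<xi>\<bar> \<le> B" by auto
  fix g :: "'a \<Rightarrow> real" assume g: "cos_positive g"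
  then have "integrable lborel g" by (simp add: cos_positive_def)
  then have "integrable lborel (\<lambda>\<xi>. B * \<bar>g \<xi>\<bar>)" by auto
  then show "cos_positive (\<lambda>\<xi>. m' \<xi> * g \<xi>)"
    by (rule cos_positive_limit[where h = "\<lambda>n \<xi>. m n \<xi> * g \<xi>", rotated 2])
       (use m g lim B in \<open>auto simp: cos_multiplier_def abs_mult intro!: tendsto_mult mult_right_mono\<close>)
qed

text \<open>The Taylor polynomials of \<open>exp\<close> have nonnegative coefficients, hence
  preserve multipliers, and where \<open>\<bar>m \<xi>\<bar> \<le> B\<close> they are all bounded by
  \<open>exp B\<close>.\<close>

lemma cos_multiplier_exp:
  assumes m: "cos_multiplier m"
  shows "cos_multiplier (\<lambda>\<xi>. exp (m \<xi>))"
proof -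
  obtain B where B: "\<And>\<xi>. \<bar>m \<xi>\<bar> \<le> B"
    using m by (auto simp: cos_multiplier_def)
  show ?thesis
  proof (rule cos_multiplier_limit)
    show "cos_multiplier (\<lambda>\<xi>. \<Sum>k<n. (1 / fact k) * m \<xi> ^ k)" for n
      using m by (intro cos_multiplier_sum cos_multiplier_mult cos_multiplier_const cos_multiplier_power) auto
    show "(\<lambda>n. \<Sum>k<n. (1 / fact k) * m \<xi> ^ k) \<longlonglongrightarrow> exp (m \<xi>)" for \<xi>
      using exp_converges[of "m \<xi>"] by (simp add: sums_def divide_inverse)
    show "\<bar>\<Sum>k<n. (1 / fact k) * m \<xi> ^ k\<bar> \<le> exp B" for n \<xi>
    proof -
      have "\<bar>\<Sum>k<n. (1 / fact k) * m \<xi> ^ k\<bar> \<le> (\<Sum>k<n. \<bar>(1 / fact k) * m \<xi> ^ k\<bar>)"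
        by (rule sum_abs)
      also have "\<dots> = (\<Sum>k<n. inverse (fact k) * \<bar>m \<xi>\<bar> ^ k)"
        by (simp add: abs_mult power_abs divide_inverse)
      also have "\<dots> \<le> exp \<bar>m \<xi>\<bar>"
        using sum_le_suminf[of "\<lambda>k. inverse (fact k) * \<bar>m \<xi>\<bar> ^ k" "{..<n}"] exp_converges[of "\<bar>m \<xi>\<bar>"]
        by (auto simp: sums_iff)
      also have "\<dots> \<le> exp B" using B by simp
      finally show ?thesis .
    qed
  qed
qed

text \<open>Fubini exchanges the mixture with the cosine integral and leaves a nonnegative average
  of nonnegative numbers. The conditions on \<open>k u\<close> are restricted to
  \<open>0 < w u\<close> because the family used for subordination,
  \<open>exp (- (u * (norm x)\<^sup>2))\<close>, is unbounded for negative \<open>u\<close>.\<close>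

lemma cos_multiplier_integral:
  fixes w :: "'b::euclidean_space \<Rightarrow> real" and k :: "'b \<Rightarrow> 'a::euclidean_space \<Rightarrow> real"
  assumes w: "integrable lborel w" "\<And>u. 0 \<le> w u"
    and k [measurable]: "case_prod k \<in> borel_measurable (borel \<Otimes>\<^sub>M borel)"
    and k1: "\<And>u \<xi>. 0 < w u \<Longrightarrow> \<bar>k u \<xi>\<bar> \<le> 1" and m: "\<And>u. 0 < w u \<Longrightarrow> cos_multiplier (k u)"
  shows "cos_multiplier (\<lambda>\<xi>. LBINT u. w u * k u \<xi>)"
  unfolding cos_multiplier_def
proof safe
  have [measurable]: "w \<in> borel_measurable borel" using w by auto
  have wk: "\<bar>w u * k u \<xi>\<bar> \<le> w u" for u \<xi>
    using k1[of u \<xi>] w(2)[of u] by (cases "w u = 0") (auto simp: abs_mult mult_left_le)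
  show "(\<lambda>\<xi>. LBINT u. w u * k u \<xi>) \<in> borel_measurable borel"
    by measurable
  have iwk: "integrable lborel (\<lambda>u. w u * k u \<xi>)" for \<xi>
    by (rule Bochner_Integration.integrable_bound[OF w(1)]) (use wk w in auto)
  have "\<bar>\<integral>u. w u * k u \<xi> \<partial>lborel\<bar> \<le> (LBINT u. w u)" for \<xi>
    using w wk by (intro integral_abs_bound[THEN order.trans] integral_mono integrable_abs iwk) auto
  then show "\<exists>B. \<forall>\<xi>. \<bar>\<integral>u. w u * k u \<xi> \<partial>lborel\<bar> \<le> B" by blast
  fix g :: "'a \<Rightarrow> real" assume g: "cos_positive g"
  then have ig: "integrable lborel g" by (simp add: cos_positive_def)
  then have [measurable]: "g \<in> borel_measurable borel" by auto
  have I: "integrable (lborel \<Otimes>\<^sub>M lborel) (\<lambda>(u, \<xi>). w u * k u \<xi> * (c \<xi> * g \<xi>))"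
    if [measurable]: "c \<in> borel_measurable borel" and c: "\<And>\<xi>. \<bar>c \<xi>\<bar> \<le> 1" for c
  proof (rule Bochner_Integration.integrable_bound)
    show "integrable (lborel \<Otimes>\<^sub>M lborel) (\<lambda>(u, \<xi>). w u * g \<xi>)"
      by (rule lborel_pair.Fubini_integrable) (use w ig in \<open>auto simp: abs_mult\<close>)
    have "\<bar>w u * k u \<xi> * (c \<xi> * g \<xi>)\<bar> \<le> w u * (1 * \<bar>g \<xi>\<bar>)" for u \<xi>
      unfolding abs_mult[of "w u * k u \<xi>"] abs_mult[of "c \<xi>"]
      using wk c w by (intro mult_mono) auto
    then show "AE x in lborel \<Otimes>\<^sub>M lborel.
        norm (case x of (u, \<xi>) \<Rightarrow> w u * k u \<xi> * (c \<xi> * g \<xi>)) \<le> norm (case x of (u, \<xi>) \<Rightarrow> w u * g \<xi>)"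
      using w by (auto simp: abs_mult)
  qed measurable
  show "cos_positive (\<lambda>\<xi>. (LBINT u. w u * k u \<xi>) * g \<xi>)"
    unfolding cos_positive_def
  proof safe
    show "integrable lborel (\<lambda>\<xi>. (LBINT u. w u * k u \<xi>) * g \<xi>)"
      using lborel_pair.integrable_snd[OF I[of "\<lambda>_. 1"]] by simp
    fix x
    have "(LBINT \<xi>. cos (\<xi> \<bullet> x) * ((LBINT u. w u * k u \<xi>) * g \<xi>))
        = (LBINT \<xi>. (LBINT u. w u * k u \<xi> * (cos (\<xi> \<bullet> x) * g \<xi>)))"
      by (simp add: mult.left_commute)
    also have "\<dots> = (LBINT u. (LBINT \<xi>. w u * k u \<xi> * (cos (\<xi> \<bullet> x) * g \<xi>)))"
      by (rule lborel_pair.Fubini_integral) (rule I, auto)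
    also have "\<dots> = (LBINT u. w u * (LBINT \<xi>. cos (\<xi> \<bullet> x) * (k u \<xi> * g \<xi>)))"
      by (simp add: mult.left_commute mult.assoc)
    also have "\<dots> \<ge> 0"
    proof (rule Bochner_Integration.integral_nonneg)
      fix u
      show "0 \<le> w u * (LBINT \<xi>. cos (\<xi> \<bullet> x) * (k u \<xi> * g \<xi>))"
        using cos_multiplierD(2)[OF m g, of u] w(2)[of u]
        by (cases "w u = 0") (auto simp: cos_positive_def)
    qed
    finally show "0 \<le> (LBINT \<xi>. cos (\<xi> \<bullet> x) * ((LBINT u. w u * k u \<xi>) * g \<xi>))" .
  qed
qed

text \<open>A Gaussian is the cosine transform of another Gaussian, hence a mixture of cosines with
  positive weights.\<close>

lemma cos_multiplier_gaussian:
  assumes s: "0 < s"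
  shows "cos_multiplier (\<lambda>x::'a::euclidean_space. exp (- ((s * norm x)\<^sup>2 / 2)))"
proof -
  let ?c = "(sqrt (2 * pi) * s) ^ DIM('a)"
  let ?w = "\<lambda>y::'a. exp (- ((1 / s * norm y)\<^sup>2 / 2))"
  have "cos_multiplier (\<lambda>x::'a. (1 / ?c) * (LBINT y. ?w y * cos (x \<bullet> y)))"
    using s by (intro cos_multiplier_mult cos_multiplier_const cos_multiplier_integral cos_multiplier_cos integrable_gaussian)
       (auto intro!: prod_nonneg)
  also have "(\<lambda>x::'a. (1 / ?c) * (LBINT y. ?w y * cos (x \<bullet> y))) = (\<lambda>x::'a. exp (- ((s * norm x)\<^sup>2 / 2)))"
    using s integral_cos_gaussian[of "1 / s" "_ :: 'a"] by (simp add: mult.commute fun_eq_iff)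
  finally show ?thesis .
qed

section \<open>Subordination\<close>

lemma nn_integral_powr_atLeast:
  fixes a \<gamma> :: real
  assumes "0 < a" "0 < \<gamma>"
  shows "(\<integral>\<^sup>+x. ennreal (x powr (- 1 - \<gamma>)) * indicator {a..} x \<partial>lborel) = ennreal (a powr (- \<gamma>) / \<gamma>)"
proof -
  have "(\<integral>\<^sup>+x. ennreal (x powr (- 1 - \<gamma>)) * indicator {a..} x \<partial>lborel) = ennreal (0 - (- (a powr (- \<gamma>) / \<gamma>)))"
  proof (rule nn_integral_FTC_atLeast)
    fix x assume "a \<le> x"
    with assms have "0 < x" by simp
    with assms show "DERIV (\<lambda>x. - (x powr (- \<gamma>) / \<gamma>)) x :> x powr (- 1 - \<gamma>)"
      by (auto intro!: derivative_eq_intros simp: powr_diff powr_minus field_simps)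
  next
    have "((\<lambda>x::real. x powr (- \<gamma>)) \<longlongrightarrow> 0) at_top"
      using assms by (intro tendsto_neg_powr filterlim_ident) auto
    then show "((\<lambda>x. - (x powr (- \<gamma>) / \<gamma>)) \<longlongrightarrow> 0) at_top"
      using tendsto_minus[OF tendsto_divide_zero] by fastforce
  qed auto
  then show ?thesis by simp
qed

lemma integrable_powr_atLeast:
  fixes a \<gamma> :: real
  assumes "0 < a" "0 < \<gamma>"
  shows "integrable lborel (\<lambda>x. indicator {a..} x * x powr (- 1 - \<gamma>))"
proof (rule integrableI_nonneg)
  have "(\<integral>\<^sup>+x. ennreal (indicator {a..} x * x powr (- 1 - \<gamma>)) \<partial>lborel)
      = (\<integral>\<^sup>+x. ennreal (x powr (- 1 - \<gamma>)) * indicator {a..} x \<partial>lborel)"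
    by (intro nn_integral_cong) (auto split: split_indicator)
  then show "(\<integral>\<^sup>+x. ennreal (indicator {a..} x * x powr (- 1 - \<gamma>)) \<partial>lborel) < \<infinity>"
    using nn_integral_powr_atLeast[OF assms] by simp
qed auto

text \<open>For \<open>0 < \<beta>\<close> and \<open>\<beta> < 1\<close> the value is Gamma(1 -
  \<beta>) / \<beta>; the argument relies on its being finite and positive.\<close>

definition subordinator_const :: "real \<Rightarrow> real" where
  "subordinator_const \<beta> = (LBINT u. indicator {0<..} u * ((1 - exp (- u)) * u powr (- 1 - \<beta>)))"

context
  fixes \<beta> :: real
  assumes \<beta>: "0 < \<beta>" "\<beta> < 1"
begin

text \<open>The factor \<open>1 - exp (- u)\<close> is at most \<open>u\<close>, which tames the
  singularity at 0 because \<open>\<beta> < 1\<close>, and at most 1, which leaves an integrable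
  decay at infinity because \<open>\<beta> > 0\<close>.\<close>

lemma integrable_subordinator:
  "integrable lborel (\<lambda>u. indicator {0<..} u * ((1 - exp (- u)) * u powr (- 1 - \<beta>)))"
proof (rule Bochner_Integration.integrable_bound)
  have "(\<lambda>t. t powr (- \<beta>)) absolutely_integrable_on {0..1}"
    using integrable_on_powr_from_0[of "- \<beta>" 1] \<beta> by (subst absolutely_integrable_on_iff_nonneg) auto
  then have "integrable lborel (\<lambda>u. indicator {0..1} u *\<^sub>R u powr (- \<beta>))"
    unfolding set_integrable_def by (subst (asm) integrable_completion) auto
  then show "integrable lborel (\<lambda>u. indicator {0..1} u *\<^sub>R u powr (- \<beta>) + indicator {1..} u * u powr (- 1 - \<beta>))"
    using \<beta> by (intro Bochner_Integration.integrable_add integrable_powr_atLeast) auto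
  have "\<bar>(1 - exp (- u)) * u powr (- 1 - \<beta>)\<bar>
      \<le> indicator {0..1} u * u powr (- \<beta>) + indicator {1..} u * u powr (- 1 - \<beta>)" if "0 < u" for u
  proof -
    have "0 \<le> 1 - exp (- u)" using that by simp
    moreover have "1 - exp (- u) \<le> u" using exp_ge_add_one_self[of "- u"] by simp
    moreover have "u * u powr (- 1 - \<beta>) = u powr (- \<beta>)"
      using that powr_add[of u 1 "- 1 - \<beta>"] by simp
    ultimately have "(1 - exp (- u)) * u powr (- 1 - \<beta>) \<le> u powr (- \<beta>)"
      by (metis mult_right_mono powr_ge_zero)
    moreover have "(1 - exp (- u)) * u powr (- 1 - \<beta>) \<le> 1 * u powr (- 1 - \<beta>)"
      by (intro mult_right_mono) auto
    ultimately show ?thesis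
      using that \<open>0 \<le> 1 - exp (- u)\<close> exp_ge_zero[of "- 1 :: real"]
      by (cases "u = 1") (auto simp: indicator_def simp del: exp_ge_zero)
  qed
  then show "AE u in lborel. norm (indicator {0<..} u * ((1 - exp (- u)) * u powr (- 1 - \<beta>)))
      \<le> norm (indicator {0..1} u *\<^sub>R u powr (- \<beta>) + indicator {1..} u * u powr (- 1 - \<beta>))"
    by (intro always_eventually allI) (auto split: split_indicator intro: order.trans[OF _ abs_ge_self])
qed measurable

lemma subordinator_const_pos: "0 < subordinator_const \<beta>"
proof -
  let ?f = "\<lambda>u. indicator {0<..} u * ((1 - exp (- u)) * u powr (- 1 - \<beta>))"
  have nonneg: "0 \<le> ?f u" for u by (auto split: split_indicator)
  have "subordinator_const \<beta> \<noteq> 0"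
  proof
    assume "subordinator_const \<beta> = 0"
    then have "AE u in lborel. ?f u = 0"
      using integral_nonneg_eq_0_iff_AE[OF integrable_subordinator] nonneg
      by (simp add: subordinator_const_def)
    then have "AE u in lborel. u \<notin> {0<..<1::real}"
      by eventually_elim auto
    then have "emeasure lborel {0<..<1::real} = 0"
      by (subst (asm) AE_iff_measurable[where N = "{0<..<1}"]) auto
    then show False by simp
  qed
  moreover have "0 \<le> subordinator_const \<beta>"
    unfolding subordinator_const_def using nonneg by (intro Bochner_Integration.integral_nonneg) auto
  ultimately show ?thesis by simp
qed

lemma
  assumes "0 \<le> l"
  shows integrable_subordinator_scaled:
      "integrable lborel (\<lambda>u. indicator {0<..} u * ((1 - exp (- (l * u))) * u powr (- 1 - \<beta>)))"
    and integral_subordinator_scaled: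
      "(LBINT u. indicator {0<..} u * ((1 - exp (- (l * u))) * u powr (- 1 - \<beta>))) = l powr \<beta> * subordinator_const \<beta>"
proof -
  let ?f = "\<lambda>u. indicator {0<..} u * ((1 - exp (- u)) * u powr (- 1 - \<beta>)) :: real"
  let ?g = "\<lambda>u. indicator {0<..} u * ((1 - exp (- (l * u))) * u powr (- 1 - \<beta>)) :: real"
  have "integrable lborel ?g \<and> (LBINT u. ?g u) = l powr \<beta> * subordinator_const \<beta>"
  proof (cases "l = 0")
    case False
    with assms have l: "0 < l" by simp
    have eq: "?f (0 + l *\<^sub>R u) = l powr (- 1 - \<beta>) * ?g u" for u
      using l by (auto simp: powr_mult zero_less_mult_iff split: split_indicator)
    have m: "?f \<in> borel_measurable borel" by measurable
    from lborel_integrable_affine_iff[OF False m, of 0] integrable_subordinator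
    have "integrable lborel (\<lambda>u. l powr (- 1 - \<beta>) * ?g u)"
      unfolding eq by blast
    then have "l powr (- 1 - \<beta>) = 0 \<or> integrable lborel ?g"
      by (rule integrable_mult_left_iff[THEN iffD1])
    then have "integrable lborel ?g"
      using l by simp
    moreover from lborel_integral_affine[OF False m, of 0]
    have "subordinator_const \<beta> = l * (l powr (- 1 - \<beta>) * (LBINT u. ?g u))"
      unfolding eq subordinator_const_def using l by simp
    moreover have "l * l powr (- 1 - \<beta>) = l powr (- \<beta>)"
      using l powr_add[of l 1 "- 1 - \<beta>"] by simp
    ultimately show ?thesis
      using l by (simp add: powr_minus field_simps)
  qed simp
  then show "integrable lborel ?g" "(LBINT u. ?g u) = l powr \<beta> * subordinator_const \<beta>"
    by auto
qed

end

lemma cos_multiplier_exp_norm_square: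
  assumes "0 < u"
  shows "cos_multiplier (\<lambda>x::'a::euclidean_space. exp (- (u * (norm x)\<^sup>2)))"
  using cos_multiplier_gaussian[of "sqrt (2 * u)", where 'a = 'a] assms
  by (simp add: power_mult_distrib)

text \<open>Subordination: \<open>\<bar>x\<bar>\<^sup>\<alpha>\<close> is a multiple of \<open>\<integral> (1 - exp (- u \<bar>x\<bar>\<^sup>2)) u\<^bsup>-1-\<alpha>/2\<^esup> du\<close>. Truncating the integral near 0
leaves, in the exponent, a constant minus a finite mixture of Gaussians.\<close>

lemma cos_multiplier_exp_norm_powr:
  assumes t: "0 < t" and \<alpha>: "0 < \<alpha>" "\<alpha> \<le> 2"
  shows "cos_multiplier (\<lambda>x::'a::euclidean_space. exp (- (t * norm x powr \<alpha>)))"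
proof (cases "\<alpha> = 2")
  \<comment> \<open>At \<open>\<alpha> = 2\<close> the subordination integral diverges at 0, but the
    symbol is itself a Gaussian.\<close>
  case True
  have "norm x powr 2 = (norm x)\<^sup>2" for x :: 'a
    by (cases "x = 0") (auto simp: powr_numeral)
  with True cos_multiplier_exp_norm_square[OF t] show ?thesis
    by simp
next
  case False
  define \<beta> where "\<beta> = \<alpha> / 2"
  have \<beta>: "0 < \<beta>" "\<beta> < 1" using False \<alpha> by (auto simp: \<beta>_def)
  define \<kappa> where "\<kappa> = subordinator_const \<beta>"
  have \<kappa>: "0 < \<kappa>" using subordinator_const_pos[OF \<beta>] by (simp add: \<kappa>_def)
  define w :: "nat \<Rightarrow> real \<Rightarrow> real" where "w n u = indicator {1 / Suc n..} u * u powr (- 1 - \<beta>)" for n u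
  have [measurable]: "w n \<in> borel_measurable borel" for n
    unfolding w_def by measurable
  have w0: "0 \<le> w n u" for n u by (simp add: w_def)
  have w_pos: "0 < u" if "0 < w n u" for n u
  proof -
    have "1 / real (Suc n) \<le> u" using that by (cases "1 / real (Suc n) \<le> u") (auto simp: w_def)
    then show ?thesis by (rule less_le_trans[rotated]) simp
  qed
  have iw: "integrable lborel (w n)" for n
    unfolding w_def[abs_def] by (rule integrable_powr_atLeast) (use \<beta> in auto)
  have iwe: "integrable lborel (\<lambda>u. w n u * exp (- (u * l)))" if "0 \<le> l" for n l
  proof (rule Bochner_Integration.integrable_bound[OF iw[of n]])
    have "norm (w n u * exp (- (u * l))) \<le> norm (w n u)" for u
      using that w_pos[of n u] w0[of n u] by (cases "w n u = 0") (auto simp: abs_mult mult_left_le)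
    then show "AE u in lborel. norm (w n u * exp (- (u * l))) \<le> norm (w n u)"
      by simp
  qed measurable
  define h where "h n l = (LBINT u. w n u * (1 - exp (- (l * u))))" for n l
  have h_eq: "h n l = (LBINT u. w n u) - (LBINT u. w n u * exp (- (u * l)))" if "0 \<le> l" for n l
    unfolding h_def using iw[of n] iwe[OF that, of n] by (simp add: right_diff_distrib mult.commute)
  have h0: "0 \<le> h n l" if "0 \<le> l" for n l
    unfolding h_def
  proof (rule Bochner_Integration.integral_nonneg)
    show "0 \<le> w n u * (1 - exp (- (l * u)))" for u
      using that w_pos[of n u] w0[of n u] by (cases "w n u = 0") auto
  qed
  have h_lim: "(\<lambda>n. h n l) \<longlonglongrightarrow> l powr \<beta> * \<kappa>" if l: "0 \<le> l" for l
    unfolding h_def \<kappa>_def integral_subordinator_scaled[OF \<beta> l, symmetric]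
  proof (rule integral_dominated_convergence)
    show "integrable lborel (\<lambda>u. indicator {0<..} u * ((1 - exp (- (l * u))) * u powr (- 1 - \<beta>)))"
      using \<beta> l by (rule integrable_subordinator_scaled)
    show "AE u in lborel. (\<lambda>n. w n u * (1 - exp (- (l * u))))
        \<longlonglongrightarrow> indicator {0<..} u * ((1 - exp (- (l * u))) * u powr (- 1 - \<beta>))"
    proof (rule AE_I2)
      fix u :: real
      show "(\<lambda>n. w n u * (1 - exp (- (l * u))))
        \<longlonglongrightarrow> indicator {0<..} u * ((1 - exp (- (l * u))) * u powr (- 1 - \<beta>))"
      proof (cases "0 < u")
        case True
        from LIMSEQ_one_over_Suc have "eventually (\<lambda>n. 1 / real (Suc n) < u) sequentially"
          using True by (rule order_tendstoD)
        then have "eventually (\<lambda>n. w n u * (1 - exp (- (l * u)))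
            = indicator {0<..} u * ((1 - exp (- (l * u))) * u powr (- 1 - \<beta>))) sequentially"
          by eventually_elim (use True in \<open>auto simp: w_def\<close>)
        then show ?thesis by (rule tendsto_eventually)
      next
        case False
        then have "w n u = 0" for n using w_pos[of n u] w0[of n u] by force
        with False show ?thesis by simp
      qed
    qed
    show "AE u in lborel. norm (w n u * (1 - exp (- (l * u))))
        \<le> indicator {0<..} u * ((1 - exp (- (l * u))) * u powr (- 1 - \<beta>))" for n
    proof (rule AE_I2)
      fix u :: real
      show "norm (w n u * (1 - exp (- (l * u)))) \<le> indicator {0<..} u * ((1 - exp (- (l * u))) * u powr (- 1 - \<beta>))"
      proof (cases "w n u = 0")
        case False
        then have "0 < u" using w_pos[of n u] w0[of n u] by force
        then show ?thesis using l by (auto simp: w_def split: split_indicator)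
      qed (use l in \<open>auto split: split_indicator\<close>)
    qed
  qed measurable
  show ?thesis
  proof (rule cos_multiplier_limit)
    fix n
    have "cos_multiplier (\<lambda>x::'a. LBINT u. w n u * exp (- (u * (norm x)\<^sup>2)))"
    proof (rule cos_multiplier_integral[OF iw w0])
      show "\<bar>exp (- (u * (norm x)\<^sup>2))\<bar> \<le> 1" if "0 < w n u" for u and x :: 'a
        using w_pos[OF that] by simp
    qed (use w_pos cos_multiplier_exp_norm_square in auto)
    moreover have "cos_multiplier (\<lambda>_::'a. t / \<kappa>)"
      using t \<kappa> by (intro cos_multiplier_const) auto
    ultimately have "cos_multiplier (\<lambda>x::'a. exp (t / \<kappa> * (LBINT u. w n u * exp (- (u * (norm x)\<^sup>2)))))"
      by (intro cos_multiplier_exp cos_multiplier_mult)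
    then have "cos_multiplier (\<lambda>x::'a. exp (- (t / \<kappa> * (LBINT u. w n u))) *
        exp (t / \<kappa> * (LBINT u. w n u * exp (- (u * (norm x)\<^sup>2)))))"
      by (intro cos_multiplier_mult[OF cos_multiplier_const]) auto
    then show "cos_multiplier (\<lambda>x::'a. exp (- (t / \<kappa> * h n ((norm x)\<^sup>2))))"
      by (simp add: h_eq right_diff_distrib flip: exp_add)
  next
    fix x :: 'a
    have "((norm x)\<^sup>2) powr \<beta> = norm x powr \<alpha>"
      by (cases "x = 0") (auto simp: \<beta>_def powr_powr simp flip: powr_numeral)
    then have "(\<lambda>n. - (t / \<kappa> * h n ((norm x)\<^sup>2))) \<longlonglongrightarrow> - (t / \<kappa> * (norm x powr \<alpha> * \<kappa>))"
      using h_lim[of "(norm x)\<^sup>2"] by (intro tendsto_intros) auto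
    then show "(\<lambda>n. exp (- (t / \<kappa> * h n ((norm x)\<^sup>2)))) \<longlonglongrightarrow> exp (- (t * norm x powr \<alpha>))"
      using \<kappa> by (intro tendsto_exp) simp
  next
    show "\<bar>exp (- (t / \<kappa> * h n ((norm x)\<^sup>2)))\<bar> \<le> 1" for n and x :: 'a
      using h0[of "(norm x)\<^sup>2" n] t \<kappa> by simp
  qed
qed

section \<open>Integrability and positivity of the symbol\<close>

lemma integrable_exp_minus_abs:
  fixes c :: real
  assumes c: "0 < c"
  shows "integrable lborel (\<lambda>x. exp (- (c * \<bar>x\<bar>)))"
proof (rule Bochner_Integration.integrable_bound)
  show "integrable lborel (\<lambda>x::real. (1 + 2 / c\<^sup>2) * inverse (1 + x\<^sup>2))"
    using integrable_inverse_1_plus_square by (auto simp: set_integrable_def)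
  have "exp (- (c * \<bar>x\<bar>)) \<le> (1 + 2 / c\<^sup>2) * inverse (1 + x\<^sup>2)" for x
  proof -
    \<comment> \<open>The constant \<open>1 + 2 / c\<^sup>2\<close> is chosen so that its second
      summand times the quadratic Taylor term gives exactly \<open>x\<^sup>2\<close>.\<close>
    have "1 + x\<^sup>2 \<le> (1 + 2 / c\<^sup>2) * (1 + c * \<bar>x\<bar> + (c * \<bar>x\<bar>)\<^sup>2 / 2)"
      using c by (simp add: field_simps power_mult_distrib)
    also have "\<dots> \<le> (1 + 2 / c\<^sup>2) * exp (c * \<bar>x\<bar>)"
      using c by (intro mult_left_mono exp_lower_Taylor_quadratic) auto
    finally show ?thesis
      by (simp add: exp_minus field_simps add_pos_nonneg)
  qed
  then show "AE x in lborel. norm (exp (- (c * \<bar>x\<bar>))) \<le> norm ((1 + 2 / c\<^sup>2) * inverse (1 + x\<^sup>2))"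
    by (intro AE_I2) (auto intro: order.trans[OF _ abs_ge_self])
qed measurable

text \<open>Since \<open>1 \<le> \<alpha>\<close>,
  \<open>norm x \<le> 1 + norm x powr \<alpha>\<close>, and \<open>norm x\<close> is at least the
  mean of the absolute values of the coordinates. This dominates the symbol by a product of
  one-dimensional exponentials and explains the rate \<open>t / DIM('a)\<close> and the factor
  \<open>exp t\<close>.\<close>

lemma integrable_exp_norm_powr:
  assumes t: "0 < t" and \<alpha>: "1 \<le> \<alpha>"
  shows "integrable lborel (\<lambda>x::'a::euclidean_space. exp (- (t * norm x powr \<alpha>)))"
proof (rule Bochner_Integration.integrable_bound)
  let ?c = "t / DIM('a)"
  show "integrable lborel (\<lambda>x::'a. exp t * (\<Prod>b\<in>Basis. exp (- (?c * \<bar>x \<bullet> b\<bar>))))"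
    using t by (intro integrable_mult_right integrable_lborel_prod_Basis integrable_exp_minus_abs) auto
  have "exp (- (t * norm x powr \<alpha>)) \<le> exp t * (\<Prod>b\<in>Basis. exp (- (?c * \<bar>x \<bullet> b\<bar>)))" for x :: 'a
  proof -
    have "(\<Sum>b\<in>Basis. \<bar>x \<bullet> b\<bar>) \<le> of_nat (card (Basis :: 'a set)) * norm x"
      by (intro sum_bounded_above) (simp add: Basis_le_norm)
    then have "?c * (\<Sum>b\<in>Basis. \<bar>x \<bullet> b\<bar>) \<le> t * norm x"
      using t by (simp add: field_simps)
    also have "norm x \<le> 1 + norm x powr \<alpha>"
      using powr_mono[of 1 \<alpha> "norm x"] \<alpha> by (cases "1 \<le> norm x") (auto intro: add_increasing2)
    then have "t * norm x \<le> t + t * norm x powr \<alpha>"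
      using t by (metis distrib_left mult.right_neutral mult_left_mono less_imp_le)
    finally have "- (t * norm x powr \<alpha>) \<le> t + (\<Sum>b\<in>Basis. - (?c * \<bar>x \<bullet> b\<bar>))"
      by (simp add: sum_negf sum_distrib_left)
    then have "exp (- (t * norm x powr \<alpha>)) \<le> exp (t + (\<Sum>b\<in>Basis. - (?c * \<bar>x \<bullet> b\<bar>)))"
      by simp
    then show ?thesis by (simp only: exp_add exp_sum[OF finite_Basis])
  qed
  then show "AE x::'a in lborel. norm (exp (- (t * norm x powr \<alpha>)))
      \<le> norm (exp t * (\<Prod>b\<in>Basis. exp (- (?c * \<bar>x \<bullet> b\<bar>))) :: real)"
    by (intro AE_I2) (simp add: abs_mult abs_prod)
qed measurable

text \<open>A multiplier is only known to map cosine-positive functions to cosine-positive ones, so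
  a seed is needed. A Gaussian serves as the seed and is flattened to 1 in the limit, with the
  integrable symbol as dominating function.\<close>

lemma cos_positive_exp_norm_powr:
  assumes t: "0 < t" and \<alpha>: "1 \<le> \<alpha>" "\<alpha> \<le> 2"
  shows "cos_positive (\<lambda>x::'a::euclidean_space. exp (- (t * norm x powr \<alpha>)))"
proof (rule cos_positive_limit)
  show "cos_positive (\<lambda>x::'a. exp (- (t * norm x powr \<alpha>)) * exp (- ((1 / Suc n * norm x)\<^sup>2 / 2)))" for n
    using t \<alpha> by (intro cos_multiplierD(2)[OF cos_multiplier_exp_norm_powr] cos_positive_gaussian) auto
  show "integrable lborel (\<lambda>x::'a. exp (- (t * norm x powr \<alpha>)))"
    using t \<alpha>(1) by (rule integrable_exp_norm_powr)
  from LIMSEQ_one_over_Suc have "(\<lambda>n. exp (- (t * norm x powr \<alpha>)) * exp (- ((1 / Suc n * norm x)\<^sup>2 / 2)))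
      \<longlonglongrightarrow> exp (- (t * norm x powr \<alpha>)) * exp (- ((0 * norm x)\<^sup>2 / 2))" for x :: 'a
    by (intro tendsto_intros) auto
  then show "(\<lambda>n. exp (- (t * norm x powr \<alpha>)) * exp (- ((1 / Suc n * norm x)\<^sup>2 / 2)))
      \<longlonglongrightarrow> exp (- (t * norm x powr \<alpha>))" for x :: 'a
    by simp
  show "\<bar>exp (- (t * norm x powr \<alpha>)) * exp (- ((1 / Suc n * norm x)\<^sup>2 / 2))\<bar> \<le> exp (- (t * norm x powr \<alpha>))"
    for n and x :: 'a
    by (simp add: abs_mult mult_left_le)
qed

section \<open>The stable heat kernel\<close>

definition stable_density :: "real \<Rightarrow> real \<Rightarrow> 'a::euclidean_space \<Rightarrow> real" where
  "stable_density \<alpha> t x =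
     1 / (2 * pi) ^ DIM('a) * (LBINT \<xi>. cos (\<xi> \<bullet> x) * exp (- (t * norm \<xi> powr \<alpha>)))"

lemma measurable_stable_density [measurable]:
  "(\<lambda>(t, x). stable_density \<alpha> t (x :: 'a::euclidean_space)) \<in> borel_measurable (borel \<Otimes>\<^sub>M borel)"
  unfolding stable_density_def by measurable

lemma measurable_stable_density' [measurable (raw)]:
  "f \<in> borel_measurable M \<Longrightarrow> g \<in> borel_measurable M \<Longrightarrow>
    (\<lambda>z. stable_density \<alpha> (f z) (g z :: 'a::euclidean_space)) \<in> borel_measurable M"
  using measurable_compose[OF _ measurable_stable_density, of "\<lambda>z. (f z, g z)" M] by simp

lemma stable_density_minus [simp]: "stable_density \<alpha> t (- x) = stable_density \<alpha> t x"
  by (simp add: stable_density_def)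

text \<open>The lower bound on \<open>\<alpha>\<close> serves the integrability of the symbol by
  comparison with exponentials, the upper bound its positivity by subordination.\<close>

locale stable_exponent =
  fixes \<alpha> :: real
  assumes \<alpha>: "1 \<le> \<alpha>" "\<alpha> \<le> 2"
begin

abbreviation p :: "real \<Rightarrow> 'a::euclidean_space \<Rightarrow> real" where
  "p \<equiv> stable_density \<alpha>"

lemma integrable_cos_exp:
  assumes "0 < t"
  shows "integrable lborel (\<lambda>\<xi>::'a::euclidean_space. cos (\<xi> \<bullet> x) * exp (- (t * norm \<xi> powr \<alpha>)))"
  by (rule integrable_bounded_mult[where B = 1]) (use integrable_exp_norm_powr[OF assms \<alpha>(1)] in auto)

lemma p_nonneg: "0 < t \<Longrightarrow> 0 \<le> p t (x::'a::euclidean_space)"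
  unfolding stable_density_def
  using cos_positive_exp_norm_powr[OF _ \<alpha>, of t, where 'a = 'a]
  by (intro mult_nonneg_nonneg) (auto simp: cos_positive_def)

lemma p_le_p_0: "0 < t \<Longrightarrow> p t (x::'a::euclidean_space) \<le> p t (0::'a)"
  unfolding stable_density_def
  by (intro mult_left_mono integral_mono integrable_cos_exp) auto

lemma p_scale:
  fixes x :: "'a::euclidean_space"
  assumes t: "0 < t"
  shows "p t x = t powr (- (DIM('a) / \<alpha>)) * p 1 (t powr (- (1 / \<alpha>)) *\<^sub>R x)"
proof -
  let ?c = "t powr (- (1 / \<alpha>))"
  have c: "0 < ?c" using t by simp
  have "?c powr \<alpha> = 1 / t"
    using t \<alpha> by (subst powr_powr) (simp add: powr_minus_divide)
  then have "t * (?c * n) powr \<alpha> = n powr \<alpha>" if "0 \<le> n" for n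
    using t that by (simp add: powr_mult)
  then have "(LBINT \<xi>. cos (\<xi> \<bullet> x) * exp (- (t * norm \<xi> powr \<alpha>)))
    = ?c ^ DIM('a) * (LBINT \<xi>. cos (\<xi> \<bullet> (?c *\<^sub>R x)) * exp (- (norm \<xi> powr \<alpha>)))"
    using c by (subst lborel_integral_affine[of ?c _ 0]) auto
  moreover have "?c ^ DIM('a) = t powr (- (DIM('a) / \<alpha>))"
    using t by (simp add: powr_powr flip: powr_realpow)
  ultimately show ?thesis
    by (simp add: stable_density_def)
qed

lemma p_1_0_pos: "0 < p 1 (0::'a::euclidean_space)"
proof -
  let ?f = "\<lambda>\<xi>::'a. exp (- (norm \<xi> powr \<alpha>))"
  have i: "integrable lborel ?f"
    using integrable_exp_norm_powr[of 1 \<alpha>] \<alpha> by simp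
  have "(LBINT \<xi>. ?f \<xi>) \<noteq> 0"
  proof
    assume "(LBINT \<xi>. ?f \<xi>) = 0"
    then have "AE \<xi> in lborel. ?f \<xi> = 0"
      using integral_nonneg_eq_0_iff_AE[OF i] by simp
    then have "AE \<xi>::'a in lborel. False" by simp
    then have "emeasure lborel (UNIV :: 'a set) = 0"
      by (subst (asm) AE_iff_measurable[where N = UNIV]) auto
    then show False by simp
  qed
  then show ?thesis
    by (simp add: stable_density_def less_le)
qed

lemma p_1_continuous: "isCont (p 1) (x::'a::euclidean_space)"
  unfolding continuous_at_sequentially comp_def
proof safe
  fix X :: "nat \<Rightarrow> 'a" assume X: "X \<longlonglongrightarrow> x"
  have "(\<lambda>n. LBINT \<xi>. cos (\<xi> \<bullet> X n) * exp (- (1 * norm \<xi> powr \<alpha>)))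
      \<longlonglongrightarrow> (LBINT \<xi>. cos (\<xi> \<bullet> x) * exp (- (1 * norm \<xi> powr \<alpha>)))"
    by (rule integral_dominated_convergence[OF _ _ integrable_exp_norm_powr[OF zero_less_one \<alpha>(1)]])
       (auto simp: abs_mult mult_left_le_one_le intro!: tendsto_intros X)
  then show "(\<lambda>n. p 1 (X n)) \<longlonglongrightarrow> p 1 x"
    unfolding stable_density_def by (intro tendsto_intros)
qed

section \<open>Fourier inversion by Gaussian regularisation\<close>

text \<open>Up to the factor \<open>sqrt (2 * pi) ^ DIM('a)\<close>, the integral over
  \<open>\<eta>\<close> is the symbol averaged around \<open>\<zeta>\<close> by a Gaussian of width
  \<open>s\<close>.\<close>

abbreviation smoothed :: "real \<Rightarrow> real \<Rightarrow> 'a::euclidean_space \<Rightarrow> 'a \<Rightarrow> real" where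
  "smoothed t s \<zeta> \<eta> \<equiv> exp (- (t * norm (\<zeta> + s *\<^sub>R \<eta>) powr \<alpha>)) * exp (- ((norm \<eta>)\<^sup>2 / 2))"

lemma gaussian_average_tendsto:
  fixes \<zeta> :: "'a::euclidean_space"
  assumes t: "0 < t"
  shows "(\<lambda>n. LBINT \<eta>. smoothed t (1 / Suc n) \<zeta> \<eta>)
    \<longlonglongrightarrow> sqrt (2 * pi) ^ DIM('a) * exp (- (t * norm \<zeta> powr \<alpha>))"
proof -
  have "(\<lambda>n. LBINT \<eta>. smoothed t (1 / Suc n) \<zeta> \<eta>)
    \<longlonglongrightarrow> (LBINT \<eta>. exp (- (t * norm \<zeta> powr \<alpha>)) * exp (- ((norm (\<eta>::'a))\<^sup>2 / 2)))"
  proof (rule integral_dominated_convergence)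
    show "integrable lborel (\<lambda>x::'a. exp (- ((norm x)\<^sup>2 / 2)))"
      using integrable_gaussian[of 1, where 'a = 'a] by simp
    show "AE \<eta> in lborel. (\<lambda>n. smoothed t (1 / Suc n) \<zeta> \<eta>)
      \<longlonglongrightarrow> exp (- (t * norm \<zeta> powr \<alpha>)) * exp (- ((norm \<eta>)\<^sup>2 / 2))"
    proof (rule AE_I2)
      fix \<eta> :: 'a
      from LIMSEQ_one_over_Suc have *: "(\<lambda>n. \<zeta> + (1 / Suc n) *\<^sub>R \<eta>) \<longlonglongrightarrow> \<zeta> + 0 *\<^sub>R \<eta>"
        by (intro tendsto_intros)
      have **: "(\<lambda>n. norm (\<zeta> + (1 / Suc n) *\<^sub>R \<eta>) powr \<alpha>) \<longlonglongrightarrow> norm (\<zeta> + 0 *\<^sub>R \<eta>) powr \<alpha>"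
        using \<alpha> by (intro tendsto_powr' tendsto_norm[OF *] tendsto_const) auto
      have "(\<lambda>n. smoothed t (1 / Suc n) \<zeta> \<eta>)
        \<longlonglongrightarrow> exp (- (t * norm (\<zeta> + 0 *\<^sub>R \<eta>) powr \<alpha>)) * exp (- ((norm \<eta>)\<^sup>2 / 2))"
        by (intro tendsto_mult tendsto_exp tendsto_minus tendsto_const **)
      then show "(\<lambda>n. smoothed t (1 / Suc n) \<zeta> \<eta>)
        \<longlonglongrightarrow> exp (- (t * norm \<zeta> powr \<alpha>)) * exp (- ((norm \<eta>)\<^sup>2 / 2))"
        by (simp only: scaleR_zero_left add_0_right)
    qed
    show "AE \<eta> in lborel. norm (smoothed t (1 / Suc n) \<zeta> \<eta>)
        \<le> exp (- ((norm \<eta>)\<^sup>2 / 2))" for n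
      using t by (intro AE_I2) (simp add: abs_mult mult_left_le_one_le)
  qed measurable
  also have "(LBINT \<eta>. exp (- (t * norm \<zeta> powr \<alpha>)) * exp (- ((norm (\<eta>::'a))\<^sup>2 / 2)))
      = sqrt (2 * pi) ^ DIM('a) * exp (- (t * norm \<zeta> powr \<alpha>))"
    using integral_cos_gaussian[of 1 "0::'a"] by simp
  finally show ?thesis .
qed

text \<open>Integrability of \<open>p t\<close> is not yet known, so Fubini needs the Gaussian
  weight. The formula \<open>2 cos a cos b = cos (a - b) + cos (a + b)\<close> then splits the left
  side into two Gaussian transforms, one around \<open>\<zeta>\<close> and one around
  \<open>- \<zeta>\<close>.\<close>

lemma integral_p_gaussian:
  fixes \<zeta> :: "'a::euclidean_space"
  assumes t: "0 < t" and s: "0 < s"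
  shows "(LBINT x. p t x * (cos (\<zeta> \<bullet> x) * exp (- ((s * norm x)\<^sup>2 / 2))))
    = ((LBINT \<eta>. smoothed t s \<zeta> \<eta>)
       + (LBINT \<eta>. smoothed t s (- \<zeta>) \<eta>))
      / (2 * sqrt (2 * pi) ^ DIM('a))"
proof -
  let ?e = "\<lambda>\<eta>::'a. exp (- (t * norm \<eta> powr \<alpha>))"
  let ?g = "\<lambda>x::'a. exp (- ((s * norm x)\<^sup>2 / 2))"
  let ?G = "\<lambda>\<eta>::'a. exp (- ((norm \<eta> / s)\<^sup>2 / 2))"
  have ie: "integrable lborel ?e" using t \<alpha>(1) by (rule integrable_exp_norm_powr)
  have ig: "integrable lborel ?g" using s by (rule integrable_gaussian)
  have icg: "integrable lborel (\<lambda>x. cos (\<eta> \<bullet> x) * ?g x)" for \<eta>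
    by (rule integrable_bounded_mult[OF ig, where B = 1]) auto
  have ieG: "integrable lborel (\<lambda>\<eta>. ?e \<eta> * ?G (\<eta> + z))" for z
    by (subst mult.commute, rule integrable_bounded_mult[OF ie, where B = 1]) auto
  have "integrable (lborel \<Otimes>\<^sub>M lborel) (\<lambda>(x, \<eta>). ?g x * ?e \<eta>)"
    by (rule lborel_pair.Fubini_integrable) (use ie ig in \<open>auto simp: abs_mult\<close>)
  then have "integrable (lborel \<Otimes>\<^sub>M lborel) (\<lambda>z. (cos (snd z \<bullet> fst z) * cos (\<zeta> \<bullet> fst z)) * (case z of (x, \<eta>) \<Rightarrow> ?g x * ?e \<eta>))"
    by (rule integrable_bounded_mult[where B = 1]) (auto simp: abs_mult intro: mult_le_one)
  then have I: "integrable (lborel \<Otimes>\<^sub>M lborel) (\<lambda>(x, \<eta>). (cos (\<eta> \<bullet> x) * ?e \<eta>) * (cos (\<zeta> \<bullet> x) * ?g x))"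
    by (simp add: case_prod_unfold mult_ac)
  have sub: "(LBINT \<eta>. ?e \<eta> * ?G (\<eta> - z))
      = s ^ DIM('a) * (LBINT \<eta>. smoothed t s z \<eta>)" for z
    using s by (subst lborel_integral_affine[of s _ z]) auto
  have "(2 * pi) ^ DIM('a) * p t x = (LBINT \<eta>. cos (\<eta> \<bullet> x) * ?e \<eta>)" for x :: 'a
    by (simp add: stable_density_def)
  then have "(2 * pi) ^ DIM('a) * (LBINT x. p t x * (cos (\<zeta> \<bullet> x) * ?g x))
      = (LBINT x. (LBINT \<eta>. (cos (\<eta> \<bullet> x) * ?e \<eta>) * (cos (\<zeta> \<bullet> x) * ?g x)))"
    by (simp only: integral_mult_right_zero[symmetric] mult.assoc[symmetric] integral_mult_left_zero)
  also have "\<dots> = (LBINT \<eta>. (LBINT x. (cos (\<eta> \<bullet> x) * ?e \<eta>) * (cos (\<zeta> \<bullet> x) * ?g x)))"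
    using I by (rule lborel_pair.Fubini_integral[symmetric])
  also have "\<dots> = (LBINT \<eta>. ?e \<eta> * ((LBINT x. cos ((\<eta> - \<zeta>) \<bullet> x) * ?g x) + (LBINT x. cos ((\<eta> + \<zeta>) \<bullet> x) * ?g x)) / 2)"
  proof (rule Bochner_Integration.integral_cong[OF refl])
    fix \<eta> :: 'a
    have "(cos (\<eta> \<bullet> x) * ?e \<eta>) * (cos (\<zeta> \<bullet> x) * ?g x)
        = ?e \<eta> / 2 * (cos ((\<eta> - \<zeta>) \<bullet> x) * ?g x + cos ((\<eta> + \<zeta>) \<bullet> x) * ?g x)" for x
      by (simp add: inner_diff_left inner_add_left cos_add cos_diff algebra_simps)
    then show "(LBINT x. (cos (\<eta> \<bullet> x) * ?e \<eta>) * (cos (\<zeta> \<bullet> x) * ?g x))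
      = ?e \<eta> * ((LBINT x. cos ((\<eta> - \<zeta>) \<bullet> x) * ?g x) + (LBINT x. cos ((\<eta> + \<zeta>) \<bullet> x) * ?g x)) / 2"
      using icg by (simp only: integral_mult_right_zero Bochner_Integration.integral_add)
  qed
  also have "\<dots> = (LBINT \<eta>. (sqrt (2 * pi) / s) ^ DIM('a) / 2 * (?e \<eta> * ?G (\<eta> - \<zeta>) + ?e \<eta> * ?G (\<eta> + \<zeta>)))"
  proof -
    have "e * (k * a + k * b) / 2 = k / 2 * (e * a + e * b)" for e k a b :: real
      by (simp add: field_simps)
    then show ?thesis
      unfolding integral_cos_gaussian[OF s] by (intro Bochner_Integration.integral_cong refl)
  qed
  also have "\<dots> = (sqrt (2 * pi) / s) ^ DIM('a) / 2 * ((LBINT \<eta>. ?e \<eta> * ?G (\<eta> - \<zeta>)) + (LBINT \<eta>. ?e \<eta> * ?G (\<eta> - (- \<zeta>))))"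
    using ieG[of \<zeta>] ieG[of "- \<zeta>"] by simp
  also have "\<dots> = sqrt (2 * pi) ^ DIM('a) / 2 *
      ((LBINT \<eta>. smoothed t s \<zeta> \<eta>)
       + (LBINT \<eta>. smoothed t s (- \<zeta>) \<eta>))"
    unfolding sub using s by (simp add: power_divide field_simps)
  also have "(2 * pi) ^ DIM('a) = sqrt (2 * pi) ^ DIM('a) * sqrt (2 * pi) ^ DIM('a)"
    by (subst power_mult_distrib[symmetric]) simp
  finally have *: "sqrt (2 * pi) ^ DIM('a) * sqrt (2 * pi) ^ DIM('a) * (LBINT x. p t x * (cos (\<zeta> \<bullet> x) * ?g x))
    = sqrt (2 * pi) ^ DIM('a) / 2 *
      ((LBINT \<eta>. smoothed t s \<zeta> \<eta>)
       + (LBINT \<eta>. smoothed t s (- \<zeta>) \<eta>))" .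
  have cancel: "J = A / (2 * k)" if "k * k * J = k / 2 * A" "k \<noteq> 0" for k J A :: real
  proof -
    have "k * (2 * k * J) = k * A" using that(1) by (simp add: mult_ac)
    with that(2) show ?thesis by (simp add: field_simps)
  qed
  show ?thesis
    by (rule cancel[OF *]) simp
qed

lemma integral_p_gaussian_tendsto:
  fixes \<zeta> :: "'a::euclidean_space"
  assumes t: "0 < t"
  shows "(\<lambda>n. LBINT x. p t x * (cos (\<zeta> \<bullet> x) * exp (- ((1 / Suc n * norm x)\<^sup>2 / 2))))
      \<longlonglongrightarrow> exp (- (t * norm \<zeta> powr \<alpha>))"
proof -
  have "(\<lambda>n. LBINT x. p t x * (cos (\<zeta> \<bullet> x) * exp (- ((1 / Suc n * norm x)\<^sup>2 / 2))))
     \<longlonglongrightarrow> (sqrt (2 * pi) ^ DIM('a) * exp (- (t * norm \<zeta> powr \<alpha>)) + sqrt (2 * pi) ^ DIM('a) * exp (- (t * norm (- \<zeta>) powr \<alpha>)))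
      / (2 * sqrt (2 * pi) ^ DIM('a))"
    using integral_p_gaussian[OF t, of "1 / Suc _" \<zeta>]
    by (simp only: zero_less_divide_1_iff of_nat_0_less_iff zero_less_Suc simp_thms)
       (intro tendsto_divide tendsto_add tendsto_const gaussian_average_tendsto[OF t], simp)
  then show ?thesis by (simp add: field_simps)
qed

text \<open>Positivity of the kernel makes the weighted integrals at \<open>\<zeta> = 0\<close>
  monotone, and their limit 1 is finite, which gives integrability. Then \<open>p t\<close> itself
  dominates the weighted integrands at any \<open>\<zeta>\<close>, so the weight can be removed
  there too.\<close>

lemma
  assumes t: "0 < t"
  shows integrable_p: "integrable lborel (p t :: 'a::euclidean_space \<Rightarrow> real)"
    and integral_cos_p: "(LBINT x. p t x * cos (\<zeta> \<bullet> x)) = exp (- (t * norm (\<zeta>::'a) powr \<alpha>))"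
proof -
  have lim: "(\<lambda>n. exp (- ((1 / Suc n * norm x)\<^sup>2 / 2))) \<longlonglongrightarrow> 1" for x :: 'a
  proof -
    from LIMSEQ_one_over_Suc have "(\<lambda>n. exp (- ((1 / Suc n * norm x)\<^sup>2 / 2))) \<longlonglongrightarrow> exp (- ((0 * norm x)\<^sup>2 / 2))"
      by (intro tendsto_intros) auto
    then show ?thesis by simp
  qed
  show ip: "integrable lborel (p t :: 'a \<Rightarrow> real)"
  proof (rule integrable_monotone_convergence)
    show "integrable lborel (\<lambda>x::'a. p t x * exp (- ((1 / Suc n * norm x)\<^sup>2 / 2)))" for n
      by (rule integrable_bounded_mult[where B = "p t 0"])
         (use p_nonneg[OF t, where 'a = 'a] p_le_p_0[OF t, where 'a = 'a] integrable_gaussian[of "1 / Suc n", where 'a = 'a] in auto)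
    show "AE x in lborel. mono (\<lambda>n. p t (x::'a) * exp (- ((1 / Suc n * norm x)\<^sup>2 / 2)))"
      using p_nonneg[OF t]
      by (intro AE_I2 monoI) (auto intro!: mult_left_mono divide_right_mono power_mono frac_le)
    show "AE x in lborel. (\<lambda>n. p t (x::'a) * exp (- ((1 / Suc n * norm x)\<^sup>2 / 2))) \<longlonglongrightarrow> p t x"
      using tendsto_mult[OF tendsto_const lim] by auto
    show "(\<lambda>n. LBINT x. p t (x::'a) * exp (- ((1 / Suc n * norm x)\<^sup>2 / 2))) \<longlonglongrightarrow> 1"
      using integral_p_gaussian_tendsto[OF t, of "0::'a"] by simp
  qed measurable
  have "(\<lambda>n. LBINT x. p t x * (cos (\<zeta> \<bullet> x) * exp (- ((1 / Suc n * norm x)\<^sup>2 / 2))))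
      \<longlonglongrightarrow> (LBINT x. p t x * cos (\<zeta> \<bullet> x))"
  proof (rule integral_dominated_convergence[OF _ _ ip])
    show "AE x in lborel. (\<lambda>n. p t x * (cos (\<zeta> \<bullet> x) * exp (- ((1 / Suc n * norm x)\<^sup>2 / 2)))) \<longlonglongrightarrow> p t x * cos (\<zeta> \<bullet> x)"
      using tendsto_mult[OF tendsto_const tendsto_mult[OF tendsto_const lim]] by auto
    show "AE x in lborel. norm (p t x * (cos (\<zeta> \<bullet> x) * exp (- ((1 / Suc n * norm x)\<^sup>2 / 2)))) \<le> p t x" for n
      using p_nonneg[OF t, where 'a = 'a] by (intro AE_I2) (auto simp: abs_mult intro!: mult_left_le mult_le_one)
  qed measurable
  then show "(LBINT x. p t x * cos (\<zeta> \<bullet> x)) = exp (- (t * norm \<zeta> powr \<alpha>))"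
    using integral_p_gaussian_tendsto[OF t] by (rule LIMSEQ_unique)
qed

lemma integral_sin_p: "(LBINT x. p t x * sin (\<zeta> \<bullet> x)) = 0" for \<zeta> :: "'a::euclidean_space"
proof -
  have "(LBINT x. p t x * sin (\<zeta> \<bullet> x)) = (LBINT x. - (p t x * sin (\<zeta> \<bullet> x)))"
    by (subst lborel_integral_affine[of "- 1" _ 0]) auto
  then show ?thesis by simp
qed

text \<open>Only \<open>p t\<close> is expanded as a Fourier integral. After Fubini the addition
  theorem for \<open>cos (\<eta> \<bullet> (x - y))\<close> leaves the cosine transform of
  \<open>p s\<close>, which multiplies the two symbols, and its sine transform, which vanishes by
  symmetry.\<close>

lemma
  fixes x :: "'a::euclidean_space"
  assumes t: "0 < t" and s: "0 < s"
  shows integrable_p_p: "integrable lborel (\<lambda>y. p t (x - y) * p s y)"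
    and integral_p_p: "(LBINT y. p t (x - y) * p s y) = p (t + s) x"
proof -
  let ?e = "\<lambda>\<eta>::'a. exp (- (t * norm \<eta> powr \<alpha>))"
  have ie: "integrable lborel ?e" using t \<alpha>(1) by (rule integrable_exp_norm_powr)
  have ip: "integrable lborel (p s :: 'a \<Rightarrow> real)" using s by (rule integrable_p)
  show "integrable lborel (\<lambda>y. p t (x - y) * p s y)"
    by (rule integrable_bounded_mult[OF ip, where B = "p t 0"])
       (use p_nonneg[OF t, where 'a = 'a] p_le_p_0[OF t, where 'a = 'a] in auto)
  have ic: "integrable lborel (\<lambda>y::'a. c y * p s y)"
    if "c \<in> borel_measurable borel" "\<And>y. \<bar>c y\<bar> \<le> 1" for c
    by (rule integrable_bounded_mult[OF ip, where B = 1]) (use that in auto)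
  have "integrable (lborel \<Otimes>\<^sub>M lborel) (\<lambda>(y::'a, \<eta>). p s y * ?e \<eta>)"
    by (rule lborel_pair.Fubini_integrable) (use ie ip in \<open>auto simp: abs_mult\<close>)
  then have "integrable (lborel \<Otimes>\<^sub>M lborel) (\<lambda>z. cos (snd z \<bullet> (x - fst z)) * (case z of (y, \<eta>) \<Rightarrow> p s y * ?e \<eta>))"
    by (rule integrable_bounded_mult[where B = 1]) auto
  then have I: "integrable (lborel \<Otimes>\<^sub>M lborel) (\<lambda>(y, \<eta>). (cos (\<eta> \<bullet> (x - y)) * ?e \<eta>) * p s y)"
    by (simp add: case_prod_unfold mult_ac)
  have "(2 * pi) ^ DIM('a) * p t z = (LBINT \<eta>. cos (\<eta> \<bullet> z) * ?e \<eta>)" for z :: 'a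
    by (simp add: stable_density_def)
  then have "(2 * pi) ^ DIM('a) * (LBINT y. p t (x - y) * p s y)
      = (LBINT y. (LBINT \<eta>. (cos (\<eta> \<bullet> (x - y)) * ?e \<eta>) * p s y))"
    by (simp only: integral_mult_right_zero[symmetric] mult.assoc[symmetric] integral_mult_left_zero)
  also have "\<dots> = (LBINT \<eta>. (LBINT y. (cos (\<eta> \<bullet> (x - y)) * ?e \<eta>) * p s y))"
    using I by (rule lborel_pair.Fubini_integral[symmetric])
  also have "\<dots> = (LBINT \<eta>. cos (\<eta> \<bullet> x) * exp (- ((t + s) * norm \<eta> powr \<alpha>)))"
  proof (rule Bochner_Integration.integral_cong[OF refl])
    fix \<eta> :: 'a
    have "(cos (\<eta> \<bullet> (x - y)) * ?e \<eta>) * p s y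
        = ?e \<eta> * (cos (\<eta> \<bullet> x) * (p s y * cos (\<eta> \<bullet> y)) + sin (\<eta> \<bullet> x) * (p s y * sin (\<eta> \<bullet> y)))" for y
      by (simp add: inner_diff_right cos_diff algebra_simps)
    then have "(LBINT y. (cos (\<eta> \<bullet> (x - y)) * ?e \<eta>) * p s y)
        = (LBINT y. ?e \<eta> * (cos (\<eta> \<bullet> x) * (p s y * cos (\<eta> \<bullet> y)) + sin (\<eta> \<bullet> x) * (p s y * sin (\<eta> \<bullet> y))))"
      by (intro Bochner_Integration.integral_cong refl)
    also have "\<dots> = ?e \<eta> * (cos (\<eta> \<bullet> x) * (LBINT y. p s y * cos (\<eta> \<bullet> y)) + sin (\<eta> \<bullet> x) * (LBINT y. p s y * sin (\<eta> \<bullet> y)))"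
      using ic[of "\<lambda>y. cos (\<eta> \<bullet> y)"] ic[of "\<lambda>y. sin (\<eta> \<bullet> y)"] by (simp add: mult.commute[of "p s _"])
    finally show "(LBINT y. (cos (\<eta> \<bullet> (x - y)) * ?e \<eta>) * p s y)
        = cos (\<eta> \<bullet> x) * exp (- ((t + s) * norm \<eta> powr \<alpha>))"
      by (simp add: integral_cos_p[OF s] integral_sin_p distrib_right exp_add[symmetric] mult.left_commute[of "exp _"])
  qed
  also have "\<dots> = (2 * pi) ^ DIM('a) * p (t + s) x"
    by (simp add: stable_density_def)
  finally show "(LBINT y. p t (x - y) * p s y) = p (t + s) x"
    by simp
qed

lemma nn_integral_p:
  fixes x :: "'a::euclidean_space"
  assumes t: "0 < t"
  shows "(\<integral>\<^sup>+y. ennreal (p t (x - y)) \<partial>lborel) = 1"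
proof -
  have "(\<integral>\<^sup>+y. ennreal (p t (x - y)) \<partial>lborel) = (\<integral>\<^sup>+y. ennreal (p t (x - (x + (- 1) *\<^sub>R y))) \<partial>lborel)"
    by (subst nn_integral_lborel_affine[of "- 1" _ x]) auto
  also have "\<dots> = (\<integral>\<^sup>+y. ennreal (p t (y::'a)) \<partial>lborel)"
    by simp
  also have "\<dots> = ennreal (LBINT y. p t (y::'a))"
    using integrable_p[OF t] p_nonneg[OF t] by (intro nn_integral_eq_integral) auto
  also have "\<dots> = 1"
    using integral_cos_p[OF t, of "0::'a"] by simp
  finally show ?thesis .
qed

lemma nn_integral_p_p:
  fixes x :: "'a::euclidean_space"
  assumes "0 < t" "0 < s"
  shows "(\<integral>\<^sup>+y. ennreal (p t (x - y)) * ennreal (p s (y - z)) \<partial>lborel) = ennreal (p (t + s) (x - z))"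
proof -
  have "(\<integral>\<^sup>+y. ennreal (p t (x - y)) * ennreal (p s (y - z)) \<partial>lborel)
      = (\<integral>\<^sup>+y. ennreal (p t ((x - z) - y) * p s y) \<partial>lborel)"
    using p_nonneg[OF assms(1), where 'a = 'a] p_nonneg[OF assms(2), where 'a = 'a]
    by (subst nn_integral_lborel_affine[of 1 _ z]) (auto simp: ennreal_mult algebra_simps)
  also have "\<dots> = ennreal (LBINT y. p t ((x - z) - y) * p s y)"
    using p_nonneg[where 'a = 'a] assms by (intro nn_integral_eq_integral integrable_p_p) auto
  finally show ?thesis
    by (simp add: integral_p_p assms)
qed

text \<open>By self-similarity it suffices to look at time 1, where the kernel is continuous and
  positive at the origin. The clause \<open>\<rho> \<le> 1\<close> lets a ball of radius
  \<open>\<rho> * t powr (1 / \<alpha>)\<close> fit into one of radius \<open>R\<close> whenever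
  \<open>t \<le> R powr \<alpha>\<close>.\<close>

lemma p_lower_bound:
  obtains c \<rho> where "0 < c" "0 < \<rho>" "\<rho> \<le> 1"
    "\<And>t x. 0 < t \<Longrightarrow> norm (x::'a::euclidean_space) \<le> \<rho> * t powr (1 / \<alpha>) \<Longrightarrow> c * t powr (- (DIM('a) / \<alpha>)) \<le> p t x"
proof -
  define c where "c = p 1 (0::'a) / 2"
  have c: "0 < c" using p_1_0_pos[where 'a = 'a] by (simp add: c_def)
  have "p 1 \<midarrow>(0::'a)\<rightarrow> p 1 (0::'a)"
    using p_1_continuous isCont_def by blast
  then have "eventually (\<lambda>x::'a. c < p 1 x) (at 0)"
    by (rule order_tendstoD) (use c in \<open>simp add: c_def\<close>)
  then obtain \<delta> where \<delta>: "0 < \<delta>" "\<And>x::'a. x \<noteq> 0 \<Longrightarrow> norm x < \<delta> \<Longrightarrow> c < p 1 x"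
    by (auto simp: eventually_at dist_norm)
  then have \<delta>': "norm x < \<delta> \<Longrightarrow> c \<le> p 1 x" for x :: 'a
    using c by (cases "x = 0") (auto simp: c_def less_imp_le)
  show ?thesis
  proof
    show "0 < c" "0 < min 1 (\<delta> / 2)" "min 1 (\<delta> / 2) \<le> 1" using c \<delta> by auto
    fix t and x :: 'a assume t: "0 < t" and x: "norm x \<le> min 1 (\<delta> / 2) * t powr (1 / \<alpha>)"
    have "norm (t powr (- (1 / \<alpha>)) *\<^sub>R x) \<le> t powr (- (1 / \<alpha>)) * (min 1 (\<delta> / 2) * t powr (1 / \<alpha>))"
      using x by (auto intro!: mult_left_mono)
    also have "\<dots> = min 1 (\<delta> / 2)" using t by (simp add: powr_minus)
    also have "\<dots> < \<delta>" using \<delta> by auto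
    finally show "c * t powr (- (DIM('a) / \<alpha>)) \<le> p t x"
      unfolding p_scale[OF t, of x] using \<delta>' by (subst mult.commute) (intro mult_left_mono, auto)
  qed
qed

lemma p_upper_bound:
  "0 < t \<Longrightarrow> p t (x::'a::euclidean_space) \<le> p 1 (0::'a) * t powr (- (DIM('a) / \<alpha>))"
  using p_le_p_0[of 1 "t powr (- (1 / \<alpha>)) *\<^sub>R x"] by (subst p_scale) (auto simp: mult.commute)

text \<open>A point close to the sphere has only part of its neighbourhood inside the ball. A ball
  of radius \<open>\<delta> / 2\<close>, shifted from \<open>x\<close> towards the origin, stays
  inside and within reach of the lower bound; its volume is of order
  \<open>t powr (DIM('a) / \<alpha>)\<close> and cancels the height of the kernel.\<close>

lemma nn_integral_p_ball_ge:
  obtains c where "0 < c" "c \<le> 1"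
    "\<And>t R x. 0 < t \<Longrightarrow> t \<le> R powr \<alpha> \<Longrightarrow> 0 < R \<Longrightarrow> norm (x::'a::euclidean_space) < R \<Longrightarrow>
      ennreal c \<le> (\<integral>\<^sup>+y. ennreal (p t (x - y)) * indicator (ball 0 R) y \<partial>lborel)"
proof -
  obtain c \<rho> where c: "0 < c" "0 < \<rho>" "\<rho> \<le> 1"
    "\<And>t x. 0 < t \<Longrightarrow> norm (x::'a) \<le> \<rho> * t powr (1 / \<alpha>) \<Longrightarrow> c * t powr (- (DIM('a) / \<alpha>)) \<le> p t x"
    using p_lower_bound by blast
  define c' where "c' = c * (unit_ball_vol DIM('a) * (\<rho> / 2) ^ DIM('a))"
  have main: "ennreal c' \<le> (\<integral>\<^sup>+y. ennreal (p t (x - y)) * indicator (ball 0 R) y \<partial>lborel)"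
    if t: "0 < t" "t \<le> R powr \<alpha>" and R: "0 < R" and x: "norm x < R" for t R and x :: 'a
  proof -
    define r where "r = t powr (1 / \<alpha>)"
    have r: "0 < r" using t by (simp add: r_def)
    have rR: "r \<le> R"
      using powr_mono2[of "1 / \<alpha>" t "R powr \<alpha>"] t R \<alpha> by (simp add: r_def powr_powr)
    define \<delta> where "\<delta> = \<rho> * r"
    have \<delta>: "0 < \<delta>" "\<delta> \<le> R" using c r rR by (auto simp: \<delta>_def intro: order.trans[OF mult_left_le_one_le])
    \<comment> \<open>\<open>z\<close> is \<open>x\<close> moved inwards by
      \<open>\<delta> / 2\<close>, or the origin when \<open>x\<close> is closer to it than
      that.\<close>
    obtain z where z: "norm (z - x) \<le> \<delta> / 2" "norm z \<le> R - \<delta> / 2"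
    proof (cases "\<delta> / 2 \<le> norm x")
      case True
      then have nx: "0 < norm x" using \<delta> by linarith
      let ?z = "(1 - \<delta> / (2 * norm x)) *\<^sub>R x"
      have "norm (?z - x) = \<delta> / 2" using nx \<delta> by (simp add: algebra_simps)
      moreover have "norm ?z = norm x - \<delta> / 2" using nx True by (simp add: field_simps)
      ultimately show thesis using that[of ?z] x by simp
    next
      case False
      then show thesis using that[of 0] \<delta> by simp
    qed
    have sub: "ball z (\<delta> / 2) \<subseteq> ball 0 R"
    proof
      fix y assume "y \<in> ball z (\<delta> / 2)"
      then show "y \<in> ball 0 R" using z norm_triangle_sub[of y z] by (simp add: dist_norm norm_minus_commute)
    qed
    have low: "c * r powr (- DIM('a)) \<le> p t (x - y)" if "y \<in> ball z (\<delta> / 2)" for y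
    proof -
      have "norm (x - y) \<le> norm (x - z) + norm (z - y)"
        using norm_triangle_ineq[of "x - z" "z - y"] by simp
      also have "\<dots> \<le> \<rho> * t powr (1 / \<alpha>)"
        using z that by (auto simp: dist_norm norm_minus_commute \<delta>_def r_def)
      finally have "c * t powr (- (DIM('a) / \<alpha>)) \<le> p t (x - y)" using t by (intro c)
      then show ?thesis by (simp add: r_def powr_powr)
    qed
    have "r powr (- DIM('a)) * r ^ DIM('a) = 1"
      using r by (simp add: powr_minus powr_realpow)
    then have "c' = c * r powr (- DIM('a)) * (unit_ball_vol DIM('a) * (\<delta> / 2) ^ DIM('a))"
      by (simp add: c'_def \<delta>_def power_divide power_mult_distrib)
    then have "ennreal c' = ennreal (c * r powr (- DIM('a))) * emeasure lborel (ball z (\<delta> / 2))"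
      using \<delta> c r by (simp add: emeasure_ball ennreal_mult)
    also have "\<dots> = (\<integral>\<^sup>+y. ennreal (c * r powr (- DIM('a))) * indicator (ball z (\<delta> / 2)) y \<partial>lborel)"
      by (subst nn_integral_cmult_indicator) auto
    also have "\<dots> \<le> (\<integral>\<^sup>+y. ennreal (p t (x - y)) * indicator (ball 0 R) y \<partial>lborel)"
      using sub low by (intro nn_integral_mono) (auto intro!: ennreal_leI split: split_indicator)
    finally show ?thesis .
  qed
  have "0 < c'" using c by (simp add: c'_def)
  show ?thesis
  proof
    show "0 < min 1 c'" "min 1 c' \<le> 1" using \<open>0 < c'\<close> by auto
    show "ennreal (min 1 c') \<le> (\<integral>\<^sup>+y. ennreal (p t (x - y)) * indicator (ball 0 R) y \<partial>lborel)"
      if "0 < t" "t \<le> R powr \<alpha>" "0 < R" "norm x < R" for t R and x :: 'a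
      using main[OF that] by (rule order.trans[rotated]) (auto intro!: ennreal_leI)
  qed
qed

end

section \<open>The fractional heat semigroup\<close>

context stable_exponent
begin

definition H :: "real \<Rightarrow> ('a::euclidean_space \<Rightarrow> ennreal) \<Rightarrow> 'a \<Rightarrow> ennreal" where
  "H t h x = (\<integral>\<^sup>+y. ennreal (p t (x - y)) * h y \<partial>lborel)"

lemma measurable_H [measurable (raw)]:
  fixes f :: "'b \<Rightarrow> real" and g :: "'b \<Rightarrow> 'a::euclidean_space" and h :: "'b \<Rightarrow> 'a \<Rightarrow> ennreal"
  assumes [measurable]: "f \<in> borel_measurable M" "g \<in> borel_measurable M"
    "(\<lambda>(z, y). h z y) \<in> borel_measurable (M \<Otimes>\<^sub>M borel)"
  shows "(\<lambda>z. H (f z) (h z) (g z)) \<in> borel_measurable M"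
proof -
  have [measurable]: "(\<lambda>(z, y). h z y) \<in> borel_measurable (M \<Otimes>\<^sub>M lborel)"
    using assms(3) by (simp cong: measurable_cong_sets)
  show ?thesis
    unfolding H_def by measurable
qed

lemma H_mono: "(AE y in lborel. h y \<le> h' y) \<Longrightarrow> H t h x \<le> H t h' x"
  unfolding H_def by (intro nn_integral_mono_AE) (auto elim!: eventually_mono intro!: mult_left_mono)

lemma H_const: "0 < t \<Longrightarrow> H t (\<lambda>_. c) x = c"
  unfolding H_def by (subst nn_integral_multc) (auto simp: nn_integral_p)

lemma H_cmult: "h \<in> borel_measurable borel \<Longrightarrow> H t (\<lambda>y. c * h y) x = c * H t h x"
  unfolding H_def by (subst nn_integral_cmult[symmetric]) (auto simp: ac_simps)

lemma H_add:
  "h \<in> borel_measurable borel \<Longrightarrow> h' \<in> borel_measurable borel \<Longrightarrow> H t (\<lambda>y. h y + h' y) x = H t h x + H t h' x"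
  unfolding H_def by (simp add: distrib_left nn_integral_add)

lemma H_H:
  assumes "0 < t" "0 < s" and [measurable]: "h \<in> borel_measurable borel"
  shows "H t (H s h) x = H (t + s) h x"
proof -
  have "H t (H s h) x = (\<integral>\<^sup>+y. (\<integral>\<^sup>+z. ennreal (p t (x - y)) * ennreal (p s (y - z)) * h z \<partial>lborel) \<partial>lborel)"
    unfolding H_def by (simp add: mult.assoc nn_integral_cmult)
  also have "\<dots> = (\<integral>\<^sup>+z. (\<integral>\<^sup>+y. ennreal (p t (x - y)) * ennreal (p s (y - z)) * h z \<partial>lborel) \<partial>lborel)"
    by (rule lborel_pair.Fubini') measurable
  also have "\<dots> = (\<integral>\<^sup>+z. ennreal (p (t + s) (x - z)) * h z \<partial>lborel)"
    by (simp add: nn_integral_multc nn_integral_p_p assms)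
  finally show ?thesis by (simp add: H_def)
qed

lemma nn_integral_H:
  assumes "0 < t" and [measurable]: "h \<in> borel_measurable borel"
  shows "(\<integral>\<^sup>+x. H t h x \<partial>lborel) = (\<integral>\<^sup>+x. h (x::'a::euclidean_space) \<partial>lborel)"
proof -
  have "(\<integral>\<^sup>+x. H t h x \<partial>lborel) = (\<integral>\<^sup>+y. (\<integral>\<^sup>+x. ennreal (p t (x - y)) * h y \<partial>lborel) \<partial>lborel)"
    unfolding H_def by (rule lborel_pair.Fubini'[symmetric]) measurable
  also have "\<dots> = (\<integral>\<^sup>+y. (\<integral>\<^sup>+x. ennreal (p t (y - x)) * h y \<partial>lborel) \<partial>lborel)"
    using stable_density_minus[of \<alpha> t "_ - _ :: 'a"] by simp
  also have "\<dots> = (\<integral>\<^sup>+y. (\<integral>\<^sup>+x. ennreal (p t (y - x)) \<partial>lborel) * h y \<partial>lborel)"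
    by (simp add: nn_integral_multc)
  finally show ?thesis by (simp add: nn_integral_p assms)
qed

lemma H_le_mass:
  fixes x :: "'a::euclidean_space"
  assumes t: "0 < t" and [measurable]: "h \<in> borel_measurable borel"
  shows "H t h x \<le> ennreal (p 1 (0::'a) * t powr (- (DIM('a) / \<alpha>))) * (\<integral>\<^sup>+x. h x \<partial>lborel)"
proof -
  have "H t h x \<le> (\<integral>\<^sup>+y. ennreal (p 1 (0::'a) * t powr (- (DIM('a) / \<alpha>))) * h y \<partial>lborel)"
    unfolding H_def by (intro nn_integral_mono mult_right_mono ennreal_leI p_upper_bound t) simp
  then show ?thesis by (simp add: nn_integral_cmult)
qed

text \<open>\<open>H_le_mass\<close> gives the rate with a constant proportional to the mass.
  Cutting \<open>h\<close> at height \<open>n\<close> leaves an excess of arbitrarily small mass,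
  and the part below \<open>n\<close> contributes at most \<open>n\<close>, which is negligible
  against the rate for small \<open>t\<close>.\<close>

lemma H_le_small:
  fixes h :: "'a::euclidean_space \<Rightarrow> ennreal"
  assumes [measurable]: "h \<in> borel_measurable borel" and fin: "(\<integral>\<^sup>+x. h x \<partial>lborel) < \<infinity>" and \<epsilon>: "0 < \<epsilon>"
  obtains T where "0 < T"
    "\<And>t x. 0 < t \<Longrightarrow> t < T \<Longrightarrow> H t h x \<le> ennreal (\<epsilon> * t powr (- (DIM('a) / \<alpha>)))"
proof -
  define K where "K = p 1 (0::'a)"
  have K: "0 < K" using p_1_0_pos[where 'a = 'a] by (simp add: K_def)
  \<comment> \<open>Subtraction in \<open>ennreal\<close> is truncated at 0, so
    \<open>h x - of_nat n\<close> is the excess of \<open>h\<close> over \<open>n\<close>.\<close>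
  have "(\<lambda>n. \<integral>\<^sup>+x. h x - of_nat n \<partial>lborel) \<longlonglongrightarrow> (\<integral>\<^sup>+x. 0 \<partial>(lborel :: 'a measure))"
  proof (rule nn_integral_dominated_convergence[where w = h])
    show "AE x in lborel. h x - of_nat j \<le> h x" for j
      by (auto intro!: AE_I2 diff_le_self_ennreal)
    have "AE x in lborel. h x \<noteq> \<infinity>"
      using fin by (intro nn_integral_PInf_AE) auto
    then show "AE x in lborel. (\<lambda>i. h x - of_nat i) \<longlonglongrightarrow> 0"
    proof eventually_elim
      fix x assume "h x \<noteq> \<infinity>"
      then obtain n :: nat where n: "h x < of_nat n"
        using ennreal_Ex_less_of_nat[of "h x"] by (auto simp: less_top)
      have "eventually (\<lambda>i. h x - of_nat i = 0) sequentially"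
        using eventually_ge_at_top[of n]
      proof eventually_elim
        fix i assume "n \<le> i"
        then have "h x \<le> of_nat i" using n by (meson less_imp_le of_nat_mono order.trans)
        then show "h x - of_nat i = 0" using \<open>h x \<noteq> \<infinity>\<close> by (intro diff_eq_0_ennreal) (auto simp: less_top)
      qed
      then show "(\<lambda>i. h x - of_nat i) \<longlonglongrightarrow> 0" by (rule tendsto_eventually)
    qed
  qed (use fin in auto)
  then have "eventually (\<lambda>n. (\<integral>\<^sup>+x. h x - of_nat n \<partial>lborel) < ennreal (\<epsilon> / (2 * K))) sequentially"
    by (rule order_tendstoD) (use \<epsilon> K in simp)
  then obtain n where n: "(\<integral>\<^sup>+x. h x - of_nat n \<partial>lborel) < ennreal (\<epsilon> / (2 * K))"
    by (auto simp: eventually_sequentially)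
  \<comment> \<open>Before this time \<open>real n\<close> is at most half of the target; the mass
    of the excess accounts for the other half.\<close>
  define T where "T = (\<epsilon> / (2 * (real n + 1))) powr (\<alpha> / DIM('a))"
  show ?thesis
  proof
    show "0 < T" using \<epsilon> by (simp add: T_def)
    fix t and x :: 'a assume t: "0 < t" "t < T"
    define \<tau> where "\<tau> = t powr (- (DIM('a) / \<alpha>))"
    have \<tau>: "0 < \<tau>" using t by (simp add: \<tau>_def)
    have "t powr (DIM('a) / \<alpha>) \<le> T powr (DIM('a) / \<alpha>)"
      using t \<alpha> by (intro powr_mono2) auto
    also have "\<dots> = \<epsilon> / (2 * (real n + 1))"
      using \<epsilon> \<alpha> by (simp add: T_def powr_powr)
    finally have "1 / \<tau> \<le> \<epsilon> / (2 * (real n + 1))"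
      by (simp add: \<tau>_def powr_minus_divide)
    then have n\<tau>: "real n \<le> \<epsilon> / 2 * \<tau>"
      using \<tau> by (simp add: field_simps)
    have "H t h x \<le> H t (\<lambda>y. of_nat n + (h y - of_nat n)) x"
      by (rule H_mono) (auto intro!: AE_I2 simp: add_diff_self_ennreal less_imp_le not_le ennreal_le_minus_iff split: if_splits)
    also have "\<dots> = of_nat n + H t (\<lambda>y. h y - of_nat n) x"
      using t by (simp add: H_add H_const)
    also have "H t (\<lambda>y. h y - of_nat n) x \<le> ennreal (K * \<tau>) * (\<integral>\<^sup>+x. h x - of_nat n \<partial>lborel)"
      unfolding K_def \<tau>_def using t by (intro H_le_mass) auto
    also have "\<dots> \<le> ennreal (K * \<tau>) * ennreal (\<epsilon> / (2 * K))"
      using n by (intro mult_left_mono) auto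
    also have "\<dots> = ennreal (\<epsilon> / 2 * \<tau>)"
      using K \<tau> \<epsilon> by (simp flip: ennreal_mult)
    also have "of_nat n + ennreal (\<epsilon> / 2 * \<tau>) \<le> ennreal (\<epsilon> / 2 * \<tau>) + ennreal (\<epsilon> / 2 * \<tau>)"
      using n\<tau> by (intro add_right_mono) (simp add: ennreal_of_nat_eq_real_of_nat ennreal_leI)
    also have "\<dots> = ennreal (\<epsilon> * \<tau>)"
      using \<epsilon> \<tau> by (simp flip: ennreal_plus)
    finally show "H t h x \<le> ennreal (\<epsilon> * t powr (- (DIM('a) / \<alpha>)))"
      by (simp add: \<tau>_def add_left_mono)
  qed
qed

text \<open>Integrating this bound against a probability kernel gives Jensen's inequality for \<open>g\<^sup>r\<close> without integrability assumptions.\<close>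

lemma young_tangent:
  fixes g B r :: real
  assumes "0 \<le> g" "0 < B" "1 \<le> r"
  shows "g \<le> (1 / r * B powr (1 - r)) * g powr r + (1 - 1 / r) * B"
proof (cases "g = 0")
  case False
  with assms have g: "0 < g" by simp
  have "(g powr r * B powr (1 - r)) powr (1 / r) * B powr (1 - 1 / r)
      \<le> 1 / r * (g powr r * B powr (1 - r)) + (1 - 1 / r) * B"
    using g assms by (intro Youngs_inequality_0) auto
  also have "(g powr r * B powr (1 - r)) powr (1 / r) * B powr (1 - 1 / r) = g * B powr ((1 - r) / r + (1 - 1 / r))"
    using g assms by (simp add: powr_mult powr_powr powr_add)
  also have "(1 - r) / r + (1 - 1 / r) = 0"
    using assms by (simp add: field_simps)
  finally show ?thesis using assms by (simp add: mult_ac)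
qed (use assms in auto)

text \<open>The tangent bound at height \<open>b\<close> is integrated against a kernel of total
  mass one, and \<open>b powr (1 - r) * b powr r = b\<close> recombines the two terms.\<close>

lemma H_jensen:
  fixes g :: "'a::euclidean_space \<Rightarrow> real"
  assumes t: "0 < t" and [measurable]: "g \<in> borel_measurable borel" and g: "\<And>x. 0 \<le> g x"
    and r: "1 \<le> r" and B: "0 \<le> B" and le: "H t (\<lambda>y. ennreal (g y powr r)) x \<le> ennreal B"
  shows "H t (\<lambda>y. ennreal (g y)) x \<le> ennreal (B powr (1 / r))"
proof -
  have *: "H t (\<lambda>y. ennreal (g y)) x \<le> ennreal b" if b: "0 < b" "B powr (1 / r) \<le> b" for b
  proof -
    have "B = (B powr (1 / r)) powr r"
      using B r by (simp add: powr_powr)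
    also have "\<dots> \<le> b powr r"
      using b B r by (intro powr_mono2) auto
    finally have Bb: "B \<le> b powr r" .
    have "H t (\<lambda>y. ennreal (g y)) x
        \<le> H t (\<lambda>y. ennreal (1 / r * b powr (1 - r)) * ennreal (g y powr r) + ennreal ((1 - 1 / r) * b)) x"
      using r b young_tangent[OF g b(1) r]
      by (intro H_mono AE_I2) (simp flip: ennreal_mult ennreal_plus)
    also have "\<dots> = ennreal (1 / r * b powr (1 - r)) * H t (\<lambda>y. ennreal (g y powr r)) x + ennreal ((1 - 1 / r) * b)"
      using t by (simp add: H_add H_cmult H_const)
    also have "\<dots> \<le> ennreal (1 / r * b powr (1 - r)) * ennreal (b powr r) + ennreal ((1 - 1 / r) * b)"
      using le Bb by (intro add_right_mono mult_left_mono) (auto intro: order.trans ennreal_leI)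
    also have "\<dots> = ennreal (1 / r * b powr (1 - r) * b powr r + (1 - 1 / r) * b)"
      using r b by (simp flip: ennreal_mult ennreal_plus)
    also have "1 / r * b powr (1 - r) * b powr r + (1 - 1 / r) * b = b"
      using r b powr_add[of b "1 - r" r] by (simp add: field_simps)
    finally show ?thesis .
  qed
  show ?thesis
  proof (rule ennreal_le_epsilon)
    fix e :: real assume "0 < e"
    then show "H t (\<lambda>y. ennreal (g y)) x \<le> ennreal (B powr (1 / r)) + ennreal e"
      using *[of "B powr (1 / r) + e"] by (simp add: add_nonneg_pos)
  qed
qed

end

section \<open>Supersolutions\<close>

definition nonneg_Lq :: "real \<Rightarrow> ('a::euclidean_space \<Rightarrow> real) \<Rightarrow> bool" where
  "nonneg_Lq q u0 \<longleftrightarrow> u0 \<in> borel_measurable borel \<and> (\<forall>x. 0 \<le> u0 x) \<and>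
     (\<integral>\<^sup>+x. ennreal (u0 x powr q) \<partial>lborel) < \<infinity>"

locale reaction_diffusion = stable_exponent +
  fixes f :: "real \<Rightarrow> real"
  assumes f_cont: "continuous_on UNIV f" and f_mono: "mono f" and f_nonneg: "\<And>s. 0 \<le> f s"
begin

lemma measurable_f [measurable]: "f \<in> borel_measurable borel"
  using f_cont by (rule borel_measurable_continuous_onI)

definition duhamel :: "('a::euclidean_space \<Rightarrow> real) \<Rightarrow> ('a \<Rightarrow> real \<Rightarrow> real) \<Rightarrow> 'a \<Rightarrow> real \<Rightarrow> ennreal" where
  "duhamel u0 u x t = H t (\<lambda>y. ennreal (u0 y)) x
     + (\<integral>\<^sup>+s\<in>{0<..<t}. H (t - s) (\<lambda>y. ennreal (f (u y s))) x \<partial>lborel)"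

lemma measurable_duhamel:
  assumes [measurable]: "u0 \<in> borel_measurable borel" "case_prod u \<in> borel_measurable (borel \<Otimes>\<^sub>M borel)"
  shows "(\<lambda>(x, t). duhamel u0 u x t) \<in> borel_measurable (borel \<Otimes>\<^sub>M borel)"
proof -
  have [measurable]: "(\<lambda>(z, s). H (snd z - s) (\<lambda>y. ennreal (f (u y s))) (fst z))
      \<in> borel_measurable ((borel \<Otimes>\<^sub>M borel) \<Otimes>\<^sub>M lborel)"
    unfolding case_prod_beta
    by measurable
  have [measurable]: "Measurable.pred ((borel \<Otimes>\<^sub>M borel) \<Otimes>\<^sub>M borel)
      (\<lambda>x :: ('a \<times> real) \<times> real. snd x \<in> {0<..<snd (fst x)})"
    unfolding greaterThanLessThan_iff by measurable
  show ?thesis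
    unfolding duhamel_def case_prod_beta by measurable
qed

lemma duhamel_mono:
  assumes "\<And>y s. 0 < s \<Longrightarrow> s < t \<Longrightarrow> u y s \<le> v y s"
  shows "duhamel u0 u x t \<le> duhamel u0 v x t"
  unfolding duhamel_def
  by (intro add_left_mono nn_integral_mono)
     (use assms in \<open>auto intro!: H_mono AE_I2 ennreal_leI monoD[OF f_mono] split: split_indicator\<close>)

text \<open>Monotone convergence is applied twice, in space and then in time; continuity of
  \<open>f\<close> identifies the limit of the integrand.\<close>

lemma duhamel_tendsto:
  assumes [measurable]: "u0 \<in> borel_measurable borel" "\<And>n. case_prod (U n) \<in> borel_measurable (borel \<Otimes>\<^sub>M borel)"
    and mono: "\<And>n y s. U n y s \<le> U (Suc n) y s" and lim: "\<And>y s. (\<lambda>n. U n y s) \<longlonglongrightarrow> u y s"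
  shows "(\<lambda>n. duhamel u0 (U n) x t) \<longlonglongrightarrow> duhamel u0 u x t"
proof -
  have inc: "incseq (\<lambda>n. ennreal (f (U n y s)))" for y s
    by (intro incseq_SucI ennreal_leI monoD[OF f_mono] mono)
  have "(\<lambda>n. f (U n y s)) \<longlonglongrightarrow> f (u y s)" for y s
    using f_cont lim by (metis UNIV_I continuous_on_eq_continuous_at isCont_tendsto_compose open_UNIV)
  then have flim: "(\<lambda>n. ennreal (f (U n y s))) \<longlonglongrightarrow> ennreal (f (u y s))" for y s
    by (rule tendsto_ennrealI)
  have Hinc: "incseq (\<lambda>n. H r (\<lambda>y. ennreal (f (U n y s))) x)" for r s
    by (intro incseq_SucI H_mono AE_I2 ennreal_leI monoD[OF f_mono] mono)
  have Hlim: "(\<lambda>n. H r (\<lambda>y. ennreal (f (U n y s))) x) \<longlonglongrightarrow> H r (\<lambda>y. ennreal (f (u y s))) x" for r s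
    unfolding H_def
  proof (rule nn_integral_LIMSEQ)
    show "incseq (\<lambda>n y. ennreal (p r (x - y)) * ennreal (f (U n y s)))"
      using inc by (auto intro!: mult_left_mono simp: incseq_def le_fun_def)
    show "(\<lambda>n. ennreal (p r (x - y)) * ennreal (f (U n y s))) \<longlonglongrightarrow> ennreal (p r (x - y)) * ennreal (f (u y s))" for y
      by (intro ennreal_tendsto_cmult flim) simp
  qed measurable
  have [measurable]: "(\<lambda>s. H (t - s) (\<lambda>y. ennreal (f (U n y s))) x) \<in> borel_measurable borel" for n
    by measurable
  show ?thesis
    unfolding duhamel_def
  proof (intro tendsto_add tendsto_const nn_integral_LIMSEQ)
    show "incseq (\<lambda>n s. H (t - s) (\<lambda>y. ennreal (f (U n y s))) x * indicator {0<..<t} s)"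
      using Hinc by (auto intro!: mult_right_mono simp: incseq_def le_fun_def)
    show "(\<lambda>n. H (t - s) (\<lambda>y. ennreal (f (U n y s))) x * indicator {0<..<t} s)
      \<longlonglongrightarrow> H (t - s) (\<lambda>y. ennreal (f (u y s))) x * indicator {0<..<t} s" for s
      using Hlim by (auto split: split_indicator)
  qed measurable
qed

text \<open>Picard iterates starting from 0 increase, by monotonicity of \<open>duhamel\<close>, and
  remain below the supersolution, so they converge to a finite limit. The equation then holds at
  every point of the time interval, not merely almost everywhere.\<close>

lemma solution_below_supersolution:
  fixes u0 :: "'a::euclidean_space \<Rightarrow> real" and w :: "'a \<Rightarrow> real \<Rightarrow> real"
  assumes [measurable]: "u0 \<in> borel_measurable borel"
    and w: "\<And>x t. 0 < t \<Longrightarrow> t < T \<Longrightarrow> 0 \<le> w x t"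
    and super: "\<And>x t. 0 < t \<Longrightarrow> t < T \<Longrightarrow> duhamel u0 w x t \<le> ennreal (w x t)"
  obtains u where "case_prod u \<in> borel_measurable (borel \<Otimes>\<^sub>M borel)" "\<And>x t. 0 \<le> u x t"
    "\<And>x t. 0 < t \<Longrightarrow> t < T \<Longrightarrow> u x t \<le> w x t"
    "\<And>x t. 0 < t \<Longrightarrow> t < T \<Longrightarrow> ennreal (u x t) = duhamel u0 u x t"
proof -
  \<comment> \<open>Outside \<open>0 < t\<close> and \<open>t < T\<close> the iterates are put to 0,
    which keeps them bounded and monotone at every time. \<open>enn2real\<close> would send an
    infinite value to 0; the supersolution excludes this (\<open>D_fin\<close>).\<close>
  define U where "U = rec_nat (\<lambda>x t. 0 :: real)
    (\<lambda>_ v x t. if 0 < t \<and> t < T then enn2real (duhamel u0 v x t) else 0)"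
  have U_0: "U 0 = (\<lambda>x t. 0)"
    and U_Suc: "U (Suc n) = (\<lambda>x t. if 0 < t \<and> t < T then enn2real (duhamel u0 (U n) x t) else 0)" for n
    unfolding U_def by simp_all
  have U_nonneg: "0 \<le> U n x t" for n x t
    by (cases n) (auto simp: U_0 U_Suc)
  have U_outside: "U n x t = 0" if "\<not> (0 < t \<and> t < T)" for n x t
    using that by (cases n) (auto simp: U_0 U_Suc)
  have U_le_w: "U n x t \<le> w x t" if "0 < t" "t < T" for n x t
    using that
  proof (induction n arbitrary: x t)
    case (Suc n)
    have "duhamel u0 (U n) x t \<le> duhamel u0 w x t"
      using Suc by (intro duhamel_mono) auto
    also have "\<dots> \<le> ennreal (w x t)"
      using Suc.prems by (rule super)
    finally show ?case
      using Suc.prems w by (simp add: U_Suc enn2real_leI)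
  qed (simp add: U_0 w)
  have D_fin: "duhamel u0 (U n) x t \<le> ennreal (w x t)" if "0 < t" "t < T" for n x t
    using that U_le_w by (intro order.trans[OF duhamel_mono super]) auto
  have U_eq: "ennreal (U (Suc n) x t) = duhamel u0 (U n) x t" if "0 < t" "t < T" for n x t
    using that D_fin[OF that, of n x] by (simp add: U_Suc top.not_eq_extremum le_less_trans)
  have U_mono: "U n x t \<le> U (Suc n) x t" for n x t
  proof (induction n arbitrary: x t)
    case (Suc n)
    show ?case
    proof (cases "0 < t \<and> t < T")
      case True
      have "duhamel u0 (U n) x t \<le> duhamel u0 (U (Suc n)) x t"
        using Suc by (intro duhamel_mono)
      then have "ennreal (U (Suc n) x t) \<le> ennreal (U (Suc (Suc n)) x t)"
        using True by (simp only: U_eq)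
      then show ?thesis using U_nonneg by (simp add: ennreal_le_iff)
    qed (simp add: U_outside)
  qed (simp add: U_0 U_nonneg)
  have [measurable]: "case_prod (U n) \<in> borel_measurable (borel \<Otimes>\<^sub>M borel)" for n
  proof (induction n)
    case (Suc n)
    then have [measurable]: "(\<lambda>(x, t). duhamel u0 (U n) x t) \<in> borel_measurable (borel \<Otimes>\<^sub>M borel)"
      by (intro measurable_duhamel) auto
    show ?case
      unfolding U_Suc by measurable
  qed (simp add: U_0)
  define u where "u x t = (SUP n. U n x t)" for x t
  have bdd: "bdd_above (range (\<lambda>n. U n x t))" for x t
    by (rule bdd_aboveI[of _ "if 0 < t \<and> t < T then w x t else 0"]) (auto simp: U_le_w U_outside)
  have lim: "(\<lambda>n. U n x t) \<longlonglongrightarrow> u x t" for x t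
    unfolding u_def by (intro LIMSEQ_incseq_SUP bdd incseq_SucI U_mono)
  show thesis
  proof (rule that)
    have "(\<lambda>z. U n (fst z) (snd z)) \<in> borel_measurable (borel \<Otimes>\<^sub>M borel)" for n
      by measurable
    then show "case_prod u \<in> borel_measurable (borel \<Otimes>\<^sub>M borel)"
      unfolding case_prod_unfold
      by (rule borel_measurable_LIMSEQ_metric) (use lim in auto)
    show "0 \<le> u x t" for x t
      by (rule LIMSEQ_le_const[OF lim]) (use U_nonneg in auto)
    fix x t assume t: "0 < t" "t < T"
    show "u x t \<le> w x t"
      by (rule LIMSEQ_le_const2[OF lim]) (use U_le_w t in auto)
    have "(\<lambda>n. ennreal (U (Suc n) x t)) \<longlonglongrightarrow> ennreal (u x t)"
      by (intro tendsto_ennrealI LIMSEQ_Suc lim)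
    moreover have "(\<lambda>n. ennreal (U (Suc n) x t)) \<longlonglongrightarrow> duhamel u0 u x t"
      unfolding U_eq[OF t] by (rule duhamel_tendsto) (use U_mono lim in auto)
    ultimately show "ennreal (u x t) = duhamel u0 u x t"
      by (rule LIMSEQ_unique)
  qed
qed

definition ae_solution :: "('a::euclidean_space \<Rightarrow> real) \<Rightarrow> real \<Rightarrow> ('a \<Rightarrow> real \<Rightarrow> real) \<Rightarrow> bool" where
  "ae_solution u0 T u \<longleftrightarrow> 0 < T \<and> case_prod u \<in> borel_measurable (borel \<Otimes>\<^sub>M borel) \<and> (\<forall>x t. 0 \<le> u x t) \<and>
     (AE z in lborel \<Otimes>\<^sub>M lborel. snd z \<in> {0<..<T} \<longrightarrow>
        ennreal (u (fst z) (snd z)) = duhamel u0 u (fst z) (snd z))"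

definition Lq_solvable :: "real \<Rightarrow> ('a::euclidean_space \<Rightarrow> real) \<Rightarrow> bool" where
  "Lq_solvable q u0 \<longleftrightarrow> (\<exists>T u C. ae_solution u0 T u \<and>
     (AE t in lborel. t \<in> {0<..<T} \<longrightarrow> (\<integral>\<^sup>+x. ennreal (u x t powr q) \<partial>lborel) \<le> ennreal C))"

lemma Lq_solvableI:
  assumes "0 < T" and [measurable]: "u0 \<in> borel_measurable borel" "case_prod u \<in> borel_measurable (borel \<Otimes>\<^sub>M borel)"
    and "\<And>x t. 0 \<le> u x t" "\<And>x t. 0 < t \<Longrightarrow> t < T \<Longrightarrow> ennreal (u x t) = duhamel u0 u x t"
    and "\<And>t. 0 < t \<Longrightarrow> t < T \<Longrightarrow> (\<integral>\<^sup>+x. ennreal (u x t powr q) \<partial>lborel) \<le> ennreal C"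
  shows "Lq_solvable q u0"
  unfolding Lq_solvable_def ae_solution_def using assms by (intro exI[of _ T] exI[of _ u] exI[of _ C]) auto

end

section \<open>Existence\<close>

lemma nn_integral_powr_near_0:
  fixes \<theta> t :: real
  assumes "0 < \<theta>" "0 < t"
  shows "(\<integral>\<^sup>+s\<in>{0<..<t}. ennreal (s powr (\<theta> - 1)) \<partial>lborel) = ennreal (t powr \<theta> / \<theta>)"
proof -
  have "(\<integral>\<^sup>+s\<in>{0<..<t}. ennreal (s powr (\<theta> - 1)) \<partial>lborel)
      = (\<integral>\<^sup>+s. ennreal (indicator {0..t} s * s powr (\<theta> - 1)) \<partial>lborel)"
  proof (rule nn_integral_cong_AE)
    have "AE s in lborel. s \<noteq> 0 \<and> s \<noteq> t"
      using AE_lborel_singleton[of 0] AE_lborel_singleton[of t] by eventually_elim auto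
    then show "AE s in lborel. ennreal (s powr (\<theta> - 1)) * indicator {0<..<t} s
        = ennreal (indicator {0..t} s * s powr (\<theta> - 1))"
      by eventually_elim (auto split: split_indicator)
  qed
  also have "\<dots> = ennreal (t powr \<theta> / \<theta>)"
    using has_integral_powr_from_0[of "\<theta> - 1" t] assms
    by (intro nn_integral_has_integral_lebesgue) auto
  finally show ?thesis .
qed

context reaction_diffusion
begin

text \<open>In \<open>f (w y s)\<close> the critical term is \<open>V s y powr (m / r)\<close>. One
  factor \<open>V s y\<close> is kept, because the semigroup carries it to \<open>V t x\<close>; the
  rest is bounded by the decay of \<open>V\<close>. Finally \<open>V t x\<close> is compared with
  its root \<open>b\<close>, half of the supersolution, at the cost of a negative power of
  \<open>t\<close>.\<close>

lemma solution_Lq: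
  fixes u0 :: "'a::euclidean_space \<Rightarrow> real"
  assumes q: "1 < q" and K: "0 \<le> K"
    and f_le: "\<And>s. 0 \<le> s \<Longrightarrow> f s \<le> K * (s + s powr (1 + \<alpha> * q / DIM('a)))"
    and data: "nonneg_Lq q u0"
  shows "Lq_solvable q u0"
proof -
  have u0 [measurable]: "u0 \<in> borel_measurable borel" and u0_nonneg: "\<And>x. 0 \<le> u0 x"
    and u0_Lq: "(\<integral>\<^sup>+x. ennreal (u0 x powr q) \<partial>lborel) < \<infinity>"
    using data by (auto simp: nonneg_Lq_def)
  define d where "d = real DIM('a)"
  have d: "0 < d" by (simp add: d_def)
  define m where "m = 1 + \<alpha> * q / d"
  have m: "1 < m" using \<alpha> q d by (simp add: m_def)
  define r where "r = min m q"
  have r: "1 < r" "r \<le> m" "r \<le> q" using m q by (auto simp: r_def)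
  \<comment> \<open>\<open>r > 1\<close> makes \<open>\<theta>\<close> positive and
    \<open>s powr (\<theta> - 1)\<close> integrable at 0. Criticality of \<open>m\<close> shows in
    the identity \<open>\<theta>'\<close>: the factors \<open>s powr (\<theta> - 1)\<close> and
    \<open>t powr (- \<theta>)\<close> make the time integral equal to \<open>1 / \<theta>\<close>
    for every \<open>t\<close>, so smallness must come from \<open>\<epsilon>\<close> and not from
    \<open>T\<close>.\<close>
  define \<theta> where "\<theta> = d / \<alpha> * ((r - 1) / q)"
  have \<theta>: "0 < \<theta>" using d \<alpha> r q by (simp add: \<theta>_def)
  have \<theta>': "d / \<alpha> * ((m - r) / q) = 1 - \<theta>"
    using d \<alpha> q by (simp add: \<theta>_def m_def field_simps)
  \<comment> \<open>Chosen so that the superlinear term contributes at most half of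
    \<open>b\<close>; \<open>K + 1\<close> in place of \<open>K\<close> covers
    \<open>K = 0\<close>.\<close>
  define \<epsilon> where "\<epsilon> = (\<theta> / (2 * (K + 1) * 2 powr m)) powr (q / (m - 1))"
  have \<epsilon>: "0 < \<epsilon>" using \<theta> K by (simp add: \<epsilon>_def)
  have "\<epsilon> powr ((m - 1) / q) = \<theta> / (2 * (K + 1) * 2 powr m)"
    using m q \<theta> K by (simp add: \<epsilon>_def powr_powr)
  then have \<epsilon>m: "K * 2 powr m * \<epsilon> powr ((m - 1) / q) / \<theta> \<le> 1 / 2"
  proof -
    have "K * 2 powr m * (\<theta> / (2 * (K + 1) * 2 powr m)) / \<theta> = K / (2 * (K + 1))"
      using \<theta> by simp
    also have "\<dots> \<le> 1 / 2" using K by (simp add: field_simps)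
    finally show ?thesis by (simp only: \<open>\<epsilon> powr ((m - 1) / q) = _\<close>)
  qed
  let ?g = "\<lambda>y. ennreal (u0 y powr r)" and ?h = "\<lambda>y. ennreal (u0 y powr q)"
  obtain T1 where T1: "0 < T1" "\<And>t x. 0 < t \<Longrightarrow> t < T1 \<Longrightarrow> H t ?h x \<le> ennreal (\<epsilon> * t powr (- (d / \<alpha>)))"
    by (rule H_le_small[OF _ u0_Lq \<epsilon>, folded d_def]) (simp, blast)
  define V where "V t x = enn2real (H t ?g x)" for t x
  have V_nonneg: "0 \<le> V t x" for t x by (simp add: V_def)
  have [measurable]: "(\<lambda>y. V t y) \<in> borel_measurable borel" for t
    unfolding V_def by measurable
  have gh: "(u0 y powr r) powr (q / r) = u0 y powr q" for y
    using r by (simp add: powr_powr)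
  have g_le: "H t ?g x \<le> ennreal (B powr (r / q))" if "0 < t" "0 \<le> B" "H t ?h x \<le> ennreal B" for t x B
    using H_jensen[OF that(1), of "\<lambda>y. u0 y powr r" "q / r" B x] that r unfolding gh by simp
  have V_eq: "ennreal (V t x) = H t ?g x"
    and V_le: "V t x \<le> (\<epsilon> * t powr (- (d / \<alpha>))) powr (r / q)" if "0 < t" "t < T1" for t x
  proof -
    have *: "H t ?g x \<le> ennreal ((\<epsilon> * t powr (- (d / \<alpha>))) powr (r / q))"
      using that \<epsilon> T1 by (intro g_le) auto
    then have "H t ?g x < \<infinity>" by (rule le_less_trans) simp
    then show V: "ennreal (V t x) = H t ?g x" by (simp add: V_def)
    show "V t x \<le> (\<epsilon> * t powr (- (d / \<alpha>))) powr (r / q)"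
      using * unfolding V[symmetric] by (subst (asm) ennreal_le_iff) auto
  qed
  have V_powr: "ennreal (V t x powr (q / r)) \<le> H t ?h x" if "0 < t" "t < T1" for t x
  proof -
    have fin: "H t ?h x < \<infinity>" by (rule le_less_trans[OF T1(2)[OF that, of x]]) simp
    then have h: "ennreal (enn2real (H t ?h x)) = H t ?h x" by simp
    have "ennreal (V t x) \<le> ennreal (enn2real (H t ?h x) powr (r / q))"
      unfolding V_eq[OF that] using that(1) by (rule g_le) (use h in auto)
    then have "V t x powr (q / r) \<le> (enn2real (H t ?h x) powr (r / q)) powr (q / r)"
      using V_nonneg r by (intro powr_mono2) auto
    also have "\<dots> = enn2real (H t ?h x)" using r q by (simp add: powr_powr)
    finally show ?thesis using h ennreal_leI by metis
  qed
  define w where "w x t = 2 * V t x powr (1 / r)" for x t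
  \<comment> \<open>The second bound limits the contribution of the linear part of \<open>f\<close>
    to the other half of \<open>b\<close>.\<close>
  define T where "T = min T1 (1 / (4 * (K + 1)))"
  have T: "0 < T" "T \<le> T1" "2 * K * T \<le> 1 / 2"
  proof -
    show "0 < T" "T \<le> T1" using T1 K by (auto simp: T_def)
    have "2 * K * T \<le> 2 * K * (1 / (4 * (K + 1)))"
      using K by (intro mult_left_mono) (auto simp: T_def)
    also have "\<dots> \<le> 1 / 2" using K by (simp add: field_simps)
    finally show "2 * K * T \<le> 1 / 2" .
  qed
  have super: "duhamel u0 w x t \<le> ennreal (w x t)" if t: "0 < t" "t < T" for x t
  proof -
    have t1: "t < T1" using t T by simp
    define b where "b = V t x powr (1 / r)"
    have b: "0 \<le> b" by (simp add: b_def)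
    have Vb: "V t x \<le> b * (\<epsilon> * t powr (- (d / \<alpha>))) powr ((r - 1) / q)"
    proof (cases "V t x = 0")
      case False
      then have "V t x = V t x powr (1 / r) * V t x powr (1 - 1 / r)"
        using V_nonneg[of t x] by (simp flip: powr_add)
      also have "\<dots> \<le> b * ((\<epsilon> * t powr (- (d / \<alpha>))) powr (r / q)) powr (1 - 1 / r)"
        unfolding b_def using r V_nonneg V_le[OF t(1) t1] by (intro mult_left_mono powr_mono2) auto
      also have "r / q * (1 - 1 / r) = (r - 1) / q" using r by (simp add: field_simps)
      then have "((\<epsilon> * t powr (- (d / \<alpha>))) powr (r / q)) powr (1 - 1 / r) = (\<epsilon> * t powr (- (d / \<alpha>))) powr ((r - 1) / q)"
        by (simp only: powr_powr)
      finally show ?thesis .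
    qed (use b in simp)
    have b1: "H t (\<lambda>y. ennreal (u0 y)) x \<le> ennreal b"
      unfolding b_def using t r V_nonneg u0_nonneg V_eq[OF t(1) t1] by (intro H_jensen) auto
    \<comment> \<open>Jensen applies to the \<open>r\<close>-th root of \<open>V s\<close>, and the
      semigroup law carries \<open>V s\<close> to \<open>V t\<close>, so the bound does not depend
      on \<open>s\<close>.\<close>
    have b2: "H (t - s) (\<lambda>y. ennreal (V s y powr (1 / r))) x \<le> ennreal b" if s: "0 < s" "s < t" for s
    proof -
      have "H (t - s) (\<lambda>y. ennreal ((V s y powr (1 / r)) powr r)) x = H (t - s) (H s ?g) x"
        using r s t1 V_nonneg by (simp add: powr_powr V_eq)
      also have "\<dots> = ennreal (V t x)"
        using s t1 t by (subst H_H) (auto simp: V_eq)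
      finally show ?thesis
        unfolding b_def using s r V_nonneg by (intro H_jensen) auto
    qed
    have b3: "H (t - s) (\<lambda>y. ennreal (V s y)) x = ennreal (V t x)" if s: "0 < s" "s < t" for s
    proof -
      have "H (t - s) (\<lambda>y. ennreal (V s y)) x = H (t - s) (H s ?g) x"
        using s t1 by (simp add: V_eq)
      also have "\<dots> = ennreal (V t x)"
        using s t1 t by (subst H_H) (auto simp: V_eq)
      finally show ?thesis .
    qed
    have fw: "f (w y s) \<le> 2 * K * V s y powr (1 / r)
        + K * 2 powr m * (\<epsilon> * s powr (- (d / \<alpha>))) powr ((m - r) / q) * V s y" if s: "0 < s" "s < t" for y s
    proof -
      have 1: "f (w y s) \<le> K * (w y s + w y s powr m)"
        using f_le[of "w y s"] V_nonneg[of s y] by (simp add: w_def m_def d_def)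
      have 2: "w y s powr m = 2 powr m * V s y powr (m / r)"
        using V_nonneg[of s y] by (simp add: w_def powr_mult powr_powr)
      have 3: "V s y powr (m / r) \<le> (\<epsilon> * s powr (- (d / \<alpha>))) powr ((m - r) / q) * V s y"
      proof (cases "V s y = 0")
        case False
        have "V s y powr (m / r) = V s y powr (m / r - 1) * V s y powr 1"
          using False V_nonneg[of s y] by (subst powr_add[symmetric]) simp
        also have "\<dots> \<le> ((\<epsilon> * s powr (- (d / \<alpha>))) powr (r / q)) powr (m / r - 1) * V s y"
          using r V_nonneg V_le[of s y] s t1 by (intro mult_mono powr_mono2) auto
        also have "r / q * (m / r - 1) = (m - r) / q" using r by (simp add: field_simps)
        then have "((\<epsilon> * s powr (- (d / \<alpha>))) powr (r / q)) powr (m / r - 1) = (\<epsilon> * s powr (- (d / \<alpha>))) powr ((m - r) / q)"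
          by (simp only: powr_powr)
        finally show ?thesis .
      qed (use r in simp)
      have "K * (2 powr m * V s y powr (m / r))
          \<le> K * (2 powr m * ((\<epsilon> * s powr (- (d / \<alpha>))) powr ((m - r) / q) * V s y))"
        using K 3 by (intro mult_left_mono) auto
      then show ?thesis
        using 1 unfolding 2 by (simp add: w_def distrib_left mult_ac)
    qed
    have step: "H (t - s) (\<lambda>y. ennreal (f (w y s))) x
        \<le> ennreal (2 * K * b) + ennreal (K * 2 powr m * \<epsilon> powr ((m - 1) / q) * b * t powr (- \<theta>)) * ennreal (s powr (\<theta> - 1))"
      if s: "0 < s" "s < t" for s
    proof -
      let ?a = "K * 2 powr m * (\<epsilon> * s powr (- (d / \<alpha>))) powr ((m - r) / q)"
      have a: "0 \<le> ?a" using K by simp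
      have "H (t - s) (\<lambda>y. ennreal (f (w y s))) x
          \<le> H (t - s) (\<lambda>y. ennreal (2 * K) * ennreal (V s y powr (1 / r)) + ennreal ?a * ennreal (V s y)) x"
      proof (intro H_mono AE_I2)
        fix y
        have "ennreal (f (w y s)) \<le> ennreal (2 * K * V s y powr (1 / r) + ?a * V s y)"
          by (rule ennreal_leI[OF fw[OF s]])
        also have "\<dots> = ennreal (2 * K * V s y powr (1 / r)) + ennreal (?a * V s y)"
          using K a V_nonneg[of s y] by (intro ennreal_plus mult_nonneg_nonneg) auto
        also have "\<dots> = ennreal (2 * K) * ennreal (V s y powr (1 / r)) + ennreal ?a * ennreal (V s y)"
          using K a by (simp only: ennreal_mult' mult_nonneg_nonneg zero_le_numeral)
        finally show "ennreal (f (w y s)) \<le> ennreal (2 * K) * ennreal (V s y powr (1 / r)) + ennreal ?a * ennreal (V s y)" .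
      qed
      also have "\<dots> = ennreal (2 * K) * H (t - s) (\<lambda>y. ennreal (V s y powr (1 / r))) x + ennreal ?a * ennreal (V t x)"
        by (simp add: H_add H_cmult b3[OF s])
      also have "\<dots> \<le> ennreal (2 * K) * ennreal b + ennreal ?a * ennreal (b * (\<epsilon> * t powr (- (d / \<alpha>))) powr ((r - 1) / q))"
        using b2[OF s] Vb by (intro add_mono mult_left_mono ennreal_leI) auto
      also have "\<dots> = ennreal (2 * K * b) + ennreal (?a * (b * (\<epsilon> * t powr (- (d / \<alpha>))) powr ((r - 1) / q)))"
        using K a by (simp only: ennreal_mult' mult_nonneg_nonneg zero_le_numeral)
      also have "?a * (b * (\<epsilon> * t powr (- (d / \<alpha>))) powr ((r - 1) / q))
          = K * 2 powr m * (\<epsilon> powr ((m - r) / q) * \<epsilon> powr ((r - 1) / q)) * b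
            * t powr (- (d / \<alpha> * ((r - 1) / q))) * s powr (- (d / \<alpha> * ((m - r) / q)))"
        using \<epsilon> by (simp add: powr_mult powr_powr)
      also have "\<epsilon> powr ((m - r) / q) * \<epsilon> powr ((r - 1) / q) = \<epsilon> powr ((m - 1) / q)"
        by (simp add: powr_add[symmetric] add_divide_distrib[symmetric])
      also have "- (d / \<alpha> * ((m - r) / q)) = \<theta> - 1" using \<theta>' by simp
      also have "d / \<alpha> * ((r - 1) / q) = \<theta>" by (simp add: \<theta>_def)
      also have "ennreal (K * 2 powr m * \<epsilon> powr ((m - 1) / q) * b * t powr (- \<theta>) * s powr (\<theta> - 1))
          = ennreal (K * 2 powr m * \<epsilon> powr ((m - 1) / q) * b * t powr (- \<theta>)) * ennreal (s powr (\<theta> - 1))"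
        using K b by (intro ennreal_mult) auto
      finally show ?thesis .
    qed
    have "(\<integral>\<^sup>+s\<in>{0<..<t}. H (t - s) (\<lambda>y. ennreal (f (w y s))) x \<partial>lborel)
        \<le> (\<integral>\<^sup>+s. ennreal (2 * K * b) * indicator {0<..<t} s
            + ennreal (K * 2 powr m * \<epsilon> powr ((m - 1) / q) * b * t powr (- \<theta>))
              * (ennreal (s powr (\<theta> - 1)) * indicator {0<..<t} s) \<partial>lborel)"
      using step by (intro nn_integral_mono) (auto split: split_indicator)
    also have "\<dots> = ennreal (2 * K * b) * ennreal t
        + ennreal (K * 2 powr m * \<epsilon> powr ((m - 1) / q) * b * t powr (- \<theta>)) * ennreal (t powr \<theta> / \<theta>)"
      using t \<theta> by (simp add: nn_integral_add nn_integral_cmult nn_integral_cmult_indicator nn_integral_powr_near_0)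
    also have "\<dots> = ennreal (2 * K * b * t + K * 2 powr m * \<epsilon> powr ((m - 1) / q) * b * t powr (- \<theta>) * (t powr \<theta> / \<theta>))"
      using K b t \<theta> by (simp flip: ennreal_mult ennreal_plus)
    also have "2 * K * b * t + K * 2 powr m * \<epsilon> powr ((m - 1) / q) * b * t powr (- \<theta>) * (t powr \<theta> / \<theta>)
        = (2 * K * t + K * 2 powr m * \<epsilon> powr ((m - 1) / q) / \<theta>) * b"
      using t by (simp add: powr_minus field_simps)
    also have "ennreal \<dots> \<le> ennreal (1 * b)"
    proof (intro ennreal_leI mult_right_mono b)
      have "2 * K * t \<le> 2 * K * T" using t K by (intro mult_left_mono) auto
      then show "2 * K * t + K * 2 powr m * \<epsilon> powr ((m - 1) / q) / \<theta> \<le> 1" using T \<epsilon>m by linarith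
    qed
    finally have "duhamel u0 w x t \<le> ennreal b + ennreal b"
      unfolding duhamel_def using b1 by (intro add_mono) auto
    also have "\<dots> = ennreal (w x t)"
      using b by (simp add: w_def b_def flip: ennreal_plus)
    finally show ?thesis .
  qed
  obtain u where u: "case_prod u \<in> borel_measurable (borel \<Otimes>\<^sub>M borel)" "\<And>x t. 0 \<le> u x t"
    "\<And>x t. 0 < t \<Longrightarrow> t < T \<Longrightarrow> u x t \<le> w x t"
    "\<And>x t. 0 < t \<Longrightarrow> t < T \<Longrightarrow> ennreal (u x t) = duhamel u0 u x t"
    by (rule solution_below_supersolution[OF u0 _ super]) (use V_nonneg in \<open>auto simp: w_def\<close>)
  show ?thesis
  proof (rule Lq_solvableI[OF T(1) u0 u(1,2,4)])
    fix t assume t: "0 < t" "t < T"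
    have "(\<integral>\<^sup>+x. ennreal (u x t powr q) \<partial>lborel) \<le> (\<integral>\<^sup>+x. ennreal (2 powr q) * H t ?h x \<partial>lborel)"
    proof (rule nn_integral_mono)
      fix x
      have "u x t powr q \<le> w x t powr q"
        using u(2,3) t q by (intro powr_mono2) auto
      also have "\<dots> = 2 powr q * V t x powr (q / r)"
        using V_nonneg[of t x] by (simp add: w_def powr_mult powr_powr)
      finally have "ennreal (u x t powr q) \<le> ennreal (2 powr q) * ennreal (V t x powr (q / r))"
        by (simp add: ennreal_leI flip: ennreal_mult)
      also have "\<dots> \<le> ennreal (2 powr q) * H t ?h x"
        using t T by (intro mult_left_mono V_powr) auto
      finally show "ennreal (u x t powr q) \<le> ennreal (2 powr q) * H t ?h x" .
    qed
    also have "\<dots> = ennreal (2 powr q) * (\<integral>\<^sup>+x. ?h x \<partial>lborel)"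
      using t by (simp add: nn_integral_cmult nn_integral_H)
    also have "\<dots> = ennreal (enn2real (ennreal (2 powr q) * (\<integral>\<^sup>+x. ?h x \<partial>lborel)))"
      using u0_Lq by (simp add: ennreal_mult_less_top)
    finally show "(\<integral>\<^sup>+x. ennreal (u x t powr q) \<partial>lborel)
        \<le> ennreal (enn2real (ennreal (2 powr q) * (\<integral>\<^sup>+x. ?h x \<partial>lborel)))" .
  qed auto
qed

text \<open>The hypothesis on \<open>\<phi>\<close> linearises the reaction at
  \<open>A * s powr (- (d / \<alpha>))\<close>, an upper bound for the height of \<open>w\<close> at
  time \<open>s\<close>. The semigroup then reproduces the free evolution, and only the time
  integral of \<open>\<phi>\<close> along this height remains.\<close>

lemma solution_L1:
  fixes u0 :: "'a::euclidean_space \<Rightarrow> real"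
  assumes \<phi> [measurable]: "\<phi> \<in> borel_measurable borel" and \<phi>_nonneg: "\<And>s. 0 \<le> \<phi> s"
    and f_le: "\<And>s s'. 0 \<le> s \<Longrightarrow> s \<le> s' \<Longrightarrow> 1 \<le> s' \<Longrightarrow> f s \<le> \<phi> s' * s"
    and small: "\<And>A. 0 < A \<Longrightarrow> \<exists>T>0. (\<integral>\<^sup>+s\<in>{0<..<T}. ennreal (\<phi> (A * s powr (- (DIM('a) / \<alpha>)))) \<partial>lborel) \<le> ennreal (1 / 2)"
    and data: "nonneg_Lq 1 u0"
  shows "Lq_solvable 1 u0"
proof -
  have u0 [measurable]: "u0 \<in> borel_measurable borel" and u0_nonneg: "\<And>x. 0 \<le> u0 x"
    and u0_L1: "(\<integral>\<^sup>+x. ennreal (u0 x) \<partial>lborel) < \<infinity>"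
    using data by (auto simp: nonneg_Lq_def)
  define d where "d = real DIM('a)"
  have d: "0 < d" by (simp add: d_def)
  define K where "K = p 1 (0::'a)"
  have K: "0 < K" using p_1_0_pos[where 'a = 'a] by (simp add: K_def)
  define N where "N = enn2real (\<integral>\<^sup>+x. ennreal (u0 x) \<partial>lborel)"
  have N: "0 \<le> N" "(\<integral>\<^sup>+x. ennreal (u0 x) \<partial>lborel) = ennreal N" using u0_L1 by (simp_all add: N_def)
  \<comment> \<open>The factor 2 is that of the supersolution; \<open>N + 1\<close> keeps
    \<open>A\<close> positive for zero data.\<close>
  define A where "A = 2 * (K * (N + 1))"
  have A: "0 < A" using K N by (simp add: A_def)
  obtain T1 where T1: "0 < T1" "(\<integral>\<^sup>+s\<in>{0<..<T1}. ennreal (\<phi> (A * s powr (- (d / \<alpha>)))) \<partial>lborel) \<le> ennreal (1 / 2)"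
    using small[OF A] unfolding d_def by auto
  \<comment> \<open>The second bound ensures \<open>1 \<le> A * s powr (- (d / \<alpha>))\<close>,
    as \<open>f_le\<close> demands.\<close>
  define T where "T = min T1 (A powr (\<alpha> / d))"
  have T: "0 < T" using T1 A by (simp add: T_def)
  let ?g = "\<lambda>y. ennreal (u0 y)"
  define V where "V t x = enn2real (H t ?g x)" for t x
  have V_nonneg: "0 \<le> V t x" for t x by (simp add: V_def)
  have [measurable]: "(\<lambda>y. V t y) \<in> borel_measurable borel" for t
    unfolding V_def by measurable
  have V_eq: "ennreal (V t x) = H t ?g x"
    and V_le: "V t x \<le> K * (N + 1) * t powr (- (d / \<alpha>))" if "0 < t" for t x
  proof -
    have "H t ?g x \<le> ennreal (K * t powr (- (d / \<alpha>))) * ennreal N"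
      unfolding K_def d_def N(2)[symmetric] using that by (intro H_le_mass) auto
    also have "\<dots> = ennreal (K * t powr (- (d / \<alpha>)) * N)"
      using K N by (simp flip: ennreal_mult)
    also have "\<dots> \<le> ennreal (K * (N + 1) * t powr (- (d / \<alpha>)))"
      using K by (intro ennreal_leI) (simp add: algebra_simps)
    finally have *: "H t ?g x \<le> ennreal (K * (N + 1) * t powr (- (d / \<alpha>)))" .
    then have "H t ?g x < \<infinity>" by (rule le_less_trans) simp
    then show V: "ennreal (V t x) = H t ?g x" by (simp add: V_def)
    show "V t x \<le> K * (N + 1) * t powr (- (d / \<alpha>))"
      using * K N unfolding V[symmetric] by (subst (asm) ennreal_le_iff) auto
  qed
  define w where "w x t = 2 * V t x" for x t
  have super: "duhamel u0 w x t \<le> ennreal (w x t)" if t: "0 < t" "t < T" for x t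
  proof -
    have step: "H (t - s) (\<lambda>y. ennreal (f (w y s))) x
        \<le> ennreal (2 * V t x) * ennreal (\<phi> (A * s powr (- (d / \<alpha>))))" if s: "0 < s" "s < t" for s
    proof -
      let ?a = "\<phi> (A * s powr (- (d / \<alpha>)))"
      have "s powr (d / \<alpha>) \<le> (A powr (\<alpha> / d)) powr (d / \<alpha>)"
        using s t d \<alpha> by (intro powr_mono2) (auto simp: T_def)
      also have "\<dots> = A" using A \<alpha> d by (simp add: powr_powr)
      finally have 1: "1 \<le> A * s powr (- (d / \<alpha>))"
        using s by (simp add: powr_minus field_simps)
      have "f (w y s) \<le> ?a * w y s" for y
        using V_nonneg V_le[of s y] s 1 by (intro f_le) (auto simp: w_def A_def)
      then have "H (t - s) (\<lambda>y. ennreal (f (w y s))) x \<le> H (t - s) (\<lambda>y. ennreal (2 * ?a) * ennreal (V s y)) x"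
        using \<phi>_nonneg V_nonneg
        by (intro H_mono AE_I2) (simp add: w_def ennreal_leI mult_ac flip: ennreal_mult)
      also have "\<dots> = ennreal (2 * ?a) * H (t - s) (H s ?g) x"
        using s by (simp add: H_cmult V_eq)
      also have "\<dots> = ennreal (2 * ?a) * ennreal (V t x)"
        using s t by (subst H_H) (auto simp: V_eq)
      also have "\<dots> = ennreal (2 * V t x) * ennreal ?a"
        using \<phi>_nonneg V_nonneg by (simp add: mult_ac flip: ennreal_mult)
      finally show ?thesis .
    qed
    have "(\<integral>\<^sup>+s\<in>{0<..<t}. H (t - s) (\<lambda>y. ennreal (f (w y s))) x \<partial>lborel)
        \<le> (\<integral>\<^sup>+s. ennreal (2 * V t x) * (ennreal (\<phi> (A * s powr (- (d / \<alpha>)))) * indicator {0<..<T1} s) \<partial>lborel)"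
      using step t by (intro nn_integral_mono) (auto simp: T_def split: split_indicator)
    also have "\<dots> = ennreal (2 * V t x) * (\<integral>\<^sup>+s\<in>{0<..<T1}. ennreal (\<phi> (A * s powr (- (d / \<alpha>)))) \<partial>lborel)"
      by (simp add: nn_integral_cmult)
    also have "\<dots> \<le> ennreal (2 * V t x) * ennreal (1 / 2)"
      using T1 by (intro mult_left_mono) auto
    also have "\<dots> = ennreal (V t x)"
      using V_nonneg by (subst ennreal_mult[symmetric]) auto
    finally have "duhamel u0 w x t \<le> ennreal (V t x) + ennreal (V t x)"
      unfolding duhamel_def using V_eq[OF t(1)] by (intro add_mono) auto
    also have "\<dots> = ennreal (w x t)"
      using V_nonneg by (simp add: w_def flip: ennreal_plus)
    finally show ?thesis .
  qed
  obtain u where u: "case_prod u \<in> borel_measurable (borel \<Otimes>\<^sub>M borel)" "\<And>x t. 0 \<le> u x t"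
    "\<And>x t. 0 < t \<Longrightarrow> t < T \<Longrightarrow> u x t \<le> w x t"
    "\<And>x t. 0 < t \<Longrightarrow> t < T \<Longrightarrow> ennreal (u x t) = duhamel u0 u x t"
    by (rule solution_below_supersolution[OF u0 _ super]) (use V_nonneg in \<open>auto simp: w_def\<close>)
  show ?thesis
  proof (rule Lq_solvableI[OF T u0 u(1,2,4)])
    fix t assume t: "0 < t" "t < T"
    have "(\<integral>\<^sup>+x. ennreal (u x t) \<partial>lborel) \<le> (\<integral>\<^sup>+x. ennreal 2 * H t ?g x \<partial>lborel)"
    proof (rule nn_integral_mono)
      fix x
      have "ennreal (u x t) \<le> ennreal (2 * V t x)"
        using u(3)[OF t, of x] by (intro ennreal_leI) (simp add: w_def)
      also have "\<dots> = ennreal 2 * H t ?g x"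
        unfolding V_eq[OF t(1), symmetric] using V_nonneg by (intro ennreal_mult) auto
      finally show "ennreal (u x t) \<le> ennreal 2 * H t ?g x" .
    qed
    also have "\<dots> = ennreal 2 * ennreal N"
      using t by (simp add: nn_integral_cmult nn_integral_H N)
    also have "\<dots> = ennreal (2 * N)"
      using N by (intro ennreal_mult[symmetric]) auto
    finally show "(\<integral>\<^sup>+x. ennreal (u x t powr 1) \<partial>lborel) \<le> ennreal (2 * N)"
      using u(2) by simp
  qed auto
qed

end

section \<open>The integral condition on the growth of the nonlinearity\<close>

text \<open>The substitution is \<open>\<sigma> = A * t powr (- (1 / \<gamma>))\<close>. With
  \<open>\<gamma> = \<alpha> / d\<close> it turns time integrals along the height of the heat kernel
  into growth integrals of the nonlinearity.\<close>

lemma nn_integral_powr_substitution: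
  fixes \<phi> :: "real \<Rightarrow> ennreal"
  assumes [measurable]: "\<phi> \<in> borel_measurable borel" and A: "0 < A" and \<gamma>: "0 < \<gamma>" and b: "0 < b"
  shows "(\<integral>\<^sup>+t\<in>{0<..<b}. \<phi> (A * t powr (- (1 / \<gamma>))) \<partial>lborel)
    = ennreal (\<gamma> * A powr \<gamma>) * (\<integral>\<^sup>+\<sigma>\<in>{A * b powr (- (1 / \<gamma>))..}. \<phi> \<sigma> * ennreal (\<sigma> powr (- 1 - \<gamma>)) \<partial>lborel)"
proof -
  define \<sigma>1 where "\<sigma>1 = A * b powr (- (1 / \<gamma>))"
  have \<sigma>1: "0 < \<sigma>1" using A b by (simp add: \<sigma>1_def)
  define \<sigma>2 where "\<sigma>2 n = \<sigma>1 + real n + 1" for n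
  have \<sigma>2: "\<sigma>1 < \<sigma>2 n" "0 < \<sigma>2 n" for n using \<sigma>1 by (auto simp: \<sigma>2_def)
  \<comment> \<open>The substitution rule wants an increasing map on a compact interval. Hence the
    variable is \<open>v = - \<sigma>\<close>, and the half-line is exhausted by the intervals from
    \<open>\<sigma>1\<close> to \<open>\<sigma>2 n\<close>.\<close>
  define g where "g v = (- v / A) powr (- \<gamma>)" for v
  define g' where "g' v = \<gamma> * A powr \<gamma> * (- v) powr (- 1 - \<gamma>)" for v
  have g_inv: "A * g v powr (- (1 / \<gamma>)) = - v" if "v < 0" for v
    using that A \<gamma> by (simp add: g_def powr_powr)
  have g1: "g (- \<sigma>1) = b"
    using A b \<gamma> by (simp add: g_def \<sigma>1_def powr_powr)
  let ?\<phi> = "\<lambda>t. \<phi> (A * t powr (- (1 / \<gamma>)))"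
  let ?w = "\<lambda>\<sigma>. \<phi> \<sigma> * ennreal (\<gamma> * A powr \<gamma> * \<sigma> powr (- 1 - \<gamma>))"
  have eq: "(\<integral>\<^sup>+t. ?\<phi> t * indicator {g (- \<sigma>2 n)..b} t \<partial>lborel)
      = (\<integral>\<^sup>+\<sigma>. ?w \<sigma> * indicator {\<sigma>1..\<sigma>2 n} \<sigma> \<partial>lborel)" for n
  proof -
    have "(\<integral>\<^sup>+t. ?\<phi> t * indicator {g (- \<sigma>2 n)..g (- \<sigma>1)} t \<partial>lborel)
        = (\<integral>\<^sup>+v. \<phi> (A * g v powr (- (1 / \<gamma>))) * ennreal (g' v) * indicator {- \<sigma>2 n..- \<sigma>1} v \<partial>lborel)"
    proof (rule nn_integral_substitution_aux)
      show "(g has_real_derivative g' v) (at v)" if "v \<in> {- \<sigma>2 n..- \<sigma>1}" for v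
      proof -
        have v: "v < 0" using that \<sigma>1 by auto
        have "(g has_real_derivative - \<gamma> * (- v / A) powr (- \<gamma> - 1) * (- 1 / A)) (at v)"
          unfolding g_def[abs_def] using v A by (auto intro!: derivative_eq_intros simp: divide_neg_pos)
        moreover have "- \<gamma> * (- v / A) powr (- \<gamma> - 1) * (- 1 / A) = g' v"
        proof -
          have "(- v / A) powr (- \<gamma> - 1) / A = A powr \<gamma> * (- v) powr (- 1 - \<gamma>)"
          proof -
            have 1: "(- v / A) powr (- 1 - \<gamma>) = (- v) powr (- 1 - \<gamma>) / A powr (- 1 - \<gamma>)"
              by (rule powr_divide)
            have 2: "A powr (- 1 - \<gamma>) = 1 / (A * A powr \<gamma>)"
              using A powr_add[of A 1 \<gamma>] powr_minus_divide[of A "1 + \<gamma>"] by simp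
            have 3: "- \<gamma> - 1 = - 1 - \<gamma>" by simp
            show ?thesis
              unfolding 3 1 2 using A by simp
          qed
          then have "\<gamma> * ((- v / A) powr (- \<gamma> - 1) / A) = g' v"
            by (simp only: g'_def mult.assoc)
          then show ?thesis by simp
        qed
        ultimately show ?thesis by simp
      qed
      show "continuous_on {- \<sigma>2 n..- \<sigma>1} g'"
        unfolding g'_def[abs_def] using \<sigma>1 by (intro continuous_intros) auto
    qed (use \<sigma>2 \<gamma> in \<open>auto simp: g'_def\<close>)
    also have "\<dots> = (\<integral>\<^sup>+v. \<phi> (- v) * ennreal (\<gamma> * A powr \<gamma> * (- v) powr (- 1 - \<gamma>)) * indicator {- \<sigma>2 n..- \<sigma>1} v \<partial>lborel)"
      using g_inv \<sigma>1 by (intro nn_integral_cong) (auto simp: g'_def split: split_indicator)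
    also have "\<dots> = (\<integral>\<^sup>+\<sigma>. ?w \<sigma> * indicator {\<sigma>1..\<sigma>2 n} \<sigma> \<partial>lborel)"
      by (subst nn_integral_real_affine[where c = "- 1" and t = 0])
         (auto intro!: nn_integral_cong split: split_indicator)
    finally show ?thesis by (simp add: g1)
  qed
  have g_dec: "g (- \<sigma>2 (Suc n)) \<le> g (- \<sigma>2 n)" and g_pos: "0 < g (- \<sigma>2 n)" for n
    using \<sigma>2[of n] \<sigma>2[of "Suc n"] A \<gamma>
    by (auto simp: g_def \<sigma>2_def intro!: powr_mono2' divide_right_mono)
  have g_lim: "(\<lambda>n. g (- \<sigma>2 n)) \<longlonglongrightarrow> 0"
  proof -
    have "filterlim (\<lambda>n. \<sigma>2 n / A) at_top sequentially"
      unfolding filterlim_at_top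
    proof
      fix Z :: real
      obtain N :: nat where "Z * A \<le> real N" using real_arch_simple by blast
      then have "Z \<le> \<sigma>2 n / A" if "N \<le> n" for n
        using A \<sigma>1 that by (simp add: \<sigma>2_def pos_le_divide_eq)
      then show "eventually (\<lambda>n. Z \<le> \<sigma>2 n / A) sequentially"
        unfolding eventually_sequentially by blast
    qed
    then show ?thesis
      unfolding g_def using \<gamma> by (simp add: tendsto_neg_powr)
  qed
  have "(\<lambda>n. \<integral>\<^sup>+t. ?\<phi> t * indicator {g (- \<sigma>2 n)..b} t \<partial>lborel)
      \<longlonglongrightarrow> (\<integral>\<^sup>+t. ?\<phi> t * indicator {0<..b} t \<partial>lborel)"
  proof (rule nn_integral_LIMSEQ)
    show "incseq (\<lambda>n t. ?\<phi> t * indicator {g (- \<sigma>2 n)..b} t)"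
      using g_dec by (intro incseq_SucI le_funI mult_left_mono) (auto split: split_indicator intro: order.trans)
    show "(\<lambda>n. ?\<phi> t * indicator {g (- \<sigma>2 n)..b} t)
        \<longlonglongrightarrow> ?\<phi> t * indicator {0<..b} t" for t
    proof (cases "0 < t")
      case True
      have "eventually (\<lambda>n. g (- \<sigma>2 n) < t) sequentially"
        using g_lim True by (rule order_tendstoD)
      then have "eventually (\<lambda>n. ?\<phi> t * indicator {g (- \<sigma>2 n)..b} t
          = ?\<phi> t * indicator {0<..b} t) sequentially"
        by eventually_elim (use True in \<open>auto split: split_indicator\<close>)
      then show ?thesis by (rule tendsto_eventually)
    next
      case False
      then have "\<not> g (- \<sigma>2 n) \<le> t" for n using g_pos[of n] by linarith
      with False show ?thesis by simp
    qed
  qed measurable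
  moreover have "(\<lambda>n. \<integral>\<^sup>+t. ?\<phi> t * indicator {g (- \<sigma>2 n)..b} t \<partial>lborel)
      \<longlonglongrightarrow> (\<integral>\<^sup>+\<sigma>. ?w \<sigma> * indicator {\<sigma>1..} \<sigma> \<partial>lborel)"
    unfolding eq
  proof (rule nn_integral_LIMSEQ)
    show "incseq (\<lambda>n \<sigma>. ?w \<sigma> * indicator {\<sigma>1..\<sigma>2 n} \<sigma>)"
      by (intro incseq_SucI le_funI mult_left_mono) (auto simp: \<sigma>2_def split: split_indicator)
    show "(\<lambda>n. ?w \<sigma> * indicator {\<sigma>1..\<sigma>2 n} \<sigma>)
        \<longlonglongrightarrow> ?w \<sigma> * indicator {\<sigma>1..} \<sigma>" for \<sigma>
    proof -
      obtain N :: nat where N: "\<sigma> \<le> real N" using real_arch_simple by blast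
      have "eventually (\<lambda>n. \<sigma> \<le> \<sigma>2 n) sequentially"
        using eventually_ge_at_top[of N] by eventually_elim (use N \<sigma>1 in \<open>auto simp: \<sigma>2_def\<close>)
      then have "eventually (\<lambda>n. ?w \<sigma> * indicator {\<sigma>1..\<sigma>2 n} \<sigma>
          = ?w \<sigma> * indicator {\<sigma>1..} \<sigma>) sequentially"
        by eventually_elim (auto split: split_indicator)
      then show ?thesis by (rule tendsto_eventually)
    qed
  qed measurable
  ultimately have "(\<integral>\<^sup>+t. ?\<phi> t * indicator {0<..b} t \<partial>lborel)
      = (\<integral>\<^sup>+\<sigma>. ?w \<sigma> * indicator {\<sigma>1..} \<sigma> \<partial>lborel)"
    by (rule LIMSEQ_unique)
  also have "\<dots> = (\<integral>\<^sup>+\<sigma>. ennreal (\<gamma> * A powr \<gamma>) * (\<phi> \<sigma> * ennreal (\<sigma> powr (- 1 - \<gamma>)) * indicator {\<sigma>1..} \<sigma>) \<partial>lborel)"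
    using \<gamma> by (intro nn_integral_cong) (simp add: ennreal_mult mult_ac)
  also have "\<dots> = ennreal (\<gamma> * A powr \<gamma>) * (\<integral>\<^sup>+\<sigma>\<in>{\<sigma>1..}. \<phi> \<sigma> * ennreal (\<sigma> powr (- 1 - \<gamma>)) \<partial>lborel)"
    by (rule nn_integral_cmult) measurable
  also have "(\<integral>\<^sup>+t. ?\<phi> t * indicator {0<..b} t \<partial>lborel)
      = (\<integral>\<^sup>+t\<in>{0<..<b}. ?\<phi> t \<partial>lborel)"
  proof (rule nn_integral_cong_AE)
    show "AE t in lborel. ?\<phi> t * indicator {0<..b} t = ?\<phi> t * indicator {0<..<b} t"
      using AE_lborel_singleton[of b] by eventually_elim (auto split: split_indicator)
  qed
  finally show ?thesis by (simp add: \<sigma>1_def)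
qed

lemma nn_integral_tail_small:
  fixes h :: "real \<Rightarrow> ennreal"
  assumes [measurable]: "h \<in> borel_measurable borel" and fin: "(\<integral>\<^sup>+s\<in>{1..}. h s \<partial>lborel) < \<infinity>" and \<delta>: "0 < \<delta>"
  obtains n :: nat where "(\<integral>\<^sup>+s\<in>{1 + real n..}. h s \<partial>lborel) < \<delta>"
proof -
  have "(\<lambda>n. \<integral>\<^sup>+s. h s * indicator {1 + real n..} s \<partial>lborel) \<longlonglongrightarrow> (\<integral>\<^sup>+s. 0 \<partial>(lborel :: real measure))"
  proof (rule nn_integral_dominated_convergence[where w = "\<lambda>s. h s * indicator {1..} s"])
    show "AE s in lborel. h s * indicator {1 + real n..} s \<le> h s * indicator {1..} s" for n
      by (intro AE_I2 mult_left_mono) (auto split: split_indicator)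
    show "AE s in lborel. (\<lambda>n. h s * indicator {1 + real n..} s) \<longlonglongrightarrow> 0"
    proof (rule AE_I2)
      fix s
      obtain N :: nat where N: "s \<le> real N" using real_arch_simple by blast
      have "eventually (\<lambda>n. h s * indicator {1 + real n..} s = 0) sequentially"
        using eventually_ge_at_top[of N] by eventually_elim (use N in \<open>auto split: split_indicator\<close>)
      then show "(\<lambda>n. h s * indicator {1 + real n..} s) \<longlonglongrightarrow> 0" by (rule tendsto_eventually)
    qed
  qed (use fin in auto)
  then have "eventually (\<lambda>n. (\<integral>\<^sup>+s. h s * indicator {1 + real n..} s \<partial>lborel) < \<delta>) sequentially"
    by (rule order_tendstoD) (use \<delta> in simp)
  then show thesis using that by (auto simp: eventually_sequentially)
qed

lemma integral_time_small:
  fixes \<phi> :: "real \<Rightarrow> real"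
  assumes [measurable]: "\<phi> \<in> borel_measurable borel" and \<phi>: "\<And>s. 0 \<le> \<phi> s" and \<gamma>: "0 < \<gamma>" and A: "0 < A"
    and fin: "(\<integral>\<^sup>+s\<in>{1..}. ennreal (\<phi> s * s powr (- 1 - \<gamma>)) \<partial>lborel) < \<infinity>"
  shows "\<exists>T>0. (\<integral>\<^sup>+s\<in>{0<..<T}. ennreal (\<phi> (A * s powr (- (1 / \<gamma>)))) \<partial>lborel) \<le> ennreal (1 / 2)"
proof -
  have c: "0 < \<gamma> * A powr \<gamma>" using \<gamma> A by simp
  obtain n where n: "(\<integral>\<^sup>+s\<in>{1 + real n..}. ennreal (\<phi> s * s powr (- 1 - \<gamma>)) \<partial>lborel) < ennreal (1 / 2 / (\<gamma> * A powr \<gamma>))"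
    using c by (rule_tac nn_integral_tail_small[OF _ fin, of "ennreal (1 / 2 / (\<gamma> * A powr \<gamma>))"]) auto
  \<comment> \<open>The time at which the height has come down to \<open>1 + real n\<close>, the
    start of the small tail.\<close>
  define T where "T = ((1 + real n) / A) powr (- \<gamma>)"
  have T: "0 < T" using A by (simp add: T_def)
  have AT: "A * T powr (- (1 / \<gamma>)) = 1 + real n"
    using A \<gamma> by (simp add: T_def powr_powr)
  have "(\<integral>\<^sup>+s\<in>{0<..<T}. ennreal (\<phi> (A * s powr (- (1 / \<gamma>)))) \<partial>lborel)
      = ennreal (\<gamma> * A powr \<gamma>) * (\<integral>\<^sup>+s\<in>{1 + real n..}. ennreal (\<phi> s * s powr (- 1 - \<gamma>)) \<partial>lborel)"
    using \<phi> by (subst nn_integral_powr_substitution[OF _ A \<gamma> T]) (simp_all add: AT ennreal_mult)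
  also have "\<dots> \<le> ennreal (\<gamma> * A powr \<gamma>) * ennreal (1 / 2 / (\<gamma> * A powr \<gamma>))"
    using n by (intro mult_left_mono) auto
  also have "\<dots> = ennreal (1 / 2)"
    using c by (subst ennreal_mult[symmetric]) auto
  finally show ?thesis using T by blast
qed

section \<open>The running supremum of the ratio against its integral\<close>

locale nondecreasing_nonneg =
  fixes f :: "real \<Rightarrow> real"
  assumes f_mono: "mono f" and f_nonneg: "\<And>s. 0 \<le> f s"
begin

lemma f_borel [measurable]: "f \<in> borel_measurable borel"
  using f_mono by (rule borel_measurable_mono)

lemma sup_ratio_bdd: "bdd_above ((\<lambda>t. f t / t) ` {1..s})"
proof (rule bdd_aboveI2)
  fix t assume t: "t \<in> {1..s}"
  have "f t / t \<le> f t / 1" using t f_nonneg[of t] by (intro divide_left_mono) auto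
  also have "\<dots> \<le> f s" using t f_mono by (simp add: monoD)
  finally show "f t / t \<le> f s" .
qed

lemma ratio_le_sup_ratio: "1 \<le> t \<Longrightarrow> t \<le> s \<Longrightarrow> f t / t \<le> sup_ratio f s"
  unfolding sup_ratio_def by (intro cSUP_upper sup_ratio_bdd) auto

lemma sup_ratio_nonneg: "1 \<le> s \<Longrightarrow> 0 \<le> sup_ratio f s"
  using ratio_le_sup_ratio[of 1 s] f_nonneg[of 1] by auto

text \<open>For \<open>s < 1\<close> the supremum in \<^term>\<open>sup_ratio f s\<close> is over the empty set, hence the \<^term>\<open>max 1 s\<close>.\<close>

lemma mono_sup_ratio: "mono (\<lambda>s. sup_ratio f (max 1 s))"
  by (rule monoI) (auto simp: sup_ratio_def intro!: cSUP_subset_mono sup_ratio_bdd)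

lemma measurable_sup_ratio [measurable]: "(\<lambda>s. sup_ratio f (max 1 s)) \<in> borel_measurable borel"
  using mono_sup_ratio by (rule borel_measurable_mono)

text \<open>By monotonicity \<open>f t / t \<le> 4 \<integral> f r / r\<^sup>2 dr\<close> over \<open>[t, 2 t]\<close>; this turns the running supremum into an integral.\<close>

lemma sup_ratio_le_integral:
  assumes s: "1 \<le> s"
  shows "ennreal (sup_ratio f s) \<le> 4 * (\<integral>\<^sup>+r\<in>{1..2 * s}. ennreal (f r / r\<^sup>2) \<partial>lborel)" (is "_ \<le> 4 * ?I")
proof -
  have ratio: "ennreal (f t / t) \<le> 4 * ?I" if t: "1 \<le> t" "t \<le> s" for t
  proof -
    have "ennreal (f t / t) = 4 * (ennreal (f t / (4 * t\<^sup>2)) * ennreal (2 * t - t))"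
      using t f_nonneg[of t] by (simp add: power2_eq_square flip: ennreal_mult ennreal_numeral)
    also have "ennreal (f t / (4 * t\<^sup>2)) * ennreal (2 * t - t)
        = (\<integral>\<^sup>+r. ennreal (f t / (4 * t\<^sup>2)) * indicator {t..2 * t} r \<partial>lborel)"
      using t by (subst nn_integral_cmult_indicator) auto
    also have "\<dots> \<le> ?I"
    proof (rule nn_integral_mono)
      fix r
      have "f t / (4 * t\<^sup>2) \<le> f r / r\<^sup>2" if r: "t \<le> r" "r \<le> 2 * t"
      proof (rule frac_le)
        show "f t \<le> f r" using r f_mono by (simp add: monoD)
        show "r\<^sup>2 \<le> 4 * t\<^sup>2" using power_mono[of r "2 * t" 2] r t by (simp add: power_mult_distrib)
      qed (use f_nonneg t r in auto)
      then show "ennreal (f t / (4 * t\<^sup>2)) * indicator {t..2 * t} r \<le> ennreal (f r / r\<^sup>2) * indicator {1..2 * s} r"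
        using t by (auto intro!: ennreal_leI split: split_indicator)
    qed
    finally show ?thesis by (simp add: mult_left_mono)
  qed
  show ?thesis
  proof (cases "?I = \<infinity>")
    case False
    then obtain I where I: "0 \<le> I" "?I = ennreal I" by (cases ?I) auto
    have "4 * ?I = ennreal (4 * I)"
      using I by (simp add: ennreal_mult)
    then have "f t / t \<le> 4 * I" if "1 \<le> t" "t \<le> s" for t
      using ratio[OF that] I by simp
    then have "sup_ratio f s \<le> 4 * I"
      unfolding sup_ratio_def using s by (intro cSUP_least) auto
    then show ?thesis using \<open>4 * ?I = ennreal (4 * I)\<close> by (simp add: ennreal_leI)
  qed (simp add: ennreal_mult_top)
qed

text \<open>Tonelli exchanges the average over \<open>{1..2 * s}\<close> with the weight in
  \<open>s\<close>. Integrating the weight over \<open>s \<ge> r / 2\<close> returns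
  \<open>(r / 2) powr (- \<gamma>) / \<gamma>\<close>, so the same weight reappears against
  \<open>f r / r\<close>, and the supremum costs only the factor
  \<open>4 * 2 powr \<gamma> / \<gamma>\<close>.\<close>

lemma sup_ratio_integral_finite:
  assumes \<gamma>: "0 < \<gamma>" and fin: "(\<integral>\<^sup>+r\<in>{1..}. ennreal (f r / r * r powr (- 1 - \<gamma>)) \<partial>lborel) < \<infinity>"
  shows "(\<integral>\<^sup>+s\<in>{1..}. ennreal (s powr (- (1 + \<gamma>)) * sup_ratio f s) \<partial>lborel) < \<infinity>"
proof -
  have [measurable]: "Measurable.pred (borel \<Otimes>\<^sub>M borel) (\<lambda>x :: real \<times> real. snd x \<in> {1..2 * fst x})"
    unfolding atLeastAtMost_iff by measurable
  have "(\<integral>\<^sup>+s\<in>{1..}. ennreal (s powr (- (1 + \<gamma>)) * sup_ratio f s) \<partial>lborel)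
      \<le> (\<integral>\<^sup>+s. (\<integral>\<^sup>+r. 4 * (ennreal (f r / r\<^sup>2) * indicator {1..} r) * (ennreal (s powr (- 1 - \<gamma>)) * indicator {r / 2..} s) \<partial>lborel) \<partial>lborel)"
  proof (rule nn_integral_mono)
    fix s
    show "ennreal (s powr (- (1 + \<gamma>)) * sup_ratio f s) * indicator {1..} s
       \<le> (\<integral>\<^sup>+r. 4 * (ennreal (f r / r\<^sup>2) * indicator {1..} r) * (ennreal (s powr (- 1 - \<gamma>)) * indicator {r / 2..} s) \<partial>lborel)"
    proof (cases "1 \<le> s")
      case True
      have "ennreal (s powr (- (1 + \<gamma>)) * sup_ratio f s) = ennreal (s powr (- 1 - \<gamma>)) * ennreal (sup_ratio f s)"
        using sup_ratio_nonneg[OF True] by (simp add: ennreal_mult)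
      also have "\<dots> \<le> ennreal (s powr (- 1 - \<gamma>)) * (4 * (\<integral>\<^sup>+r\<in>{1..2 * s}. ennreal (f r / r\<^sup>2) \<partial>lborel))"
        by (intro mult_left_mono sup_ratio_le_integral True) auto
      also have "\<dots> = (\<integral>\<^sup>+r. ennreal (s powr (- 1 - \<gamma>)) * 4 * (ennreal (f r / r\<^sup>2) * indicator {1..2 * s} r) \<partial>lborel)"
        by (subst nn_integral_cmult) (auto simp: mult.assoc)
      also have "\<dots> = (\<integral>\<^sup>+r. 4 * (ennreal (f r / r\<^sup>2) * indicator {1..} r) * (ennreal (s powr (- 1 - \<gamma>)) * indicator {r / 2..} s) \<partial>lborel)"
        by (intro nn_integral_cong) (auto simp: mult_ac split: split_indicator)
      finally show ?thesis using True by simp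
    qed simp
  qed
  also have "\<dots> = (\<integral>\<^sup>+r. (\<integral>\<^sup>+s. 4 * (ennreal (f r / r\<^sup>2) * indicator {1..} r) * (ennreal (s powr (- 1 - \<gamma>)) * indicator {r / 2..} s) \<partial>lborel) \<partial>lborel)"
    by (rule lborel_pair.Fubini') (simp add: indicator_def case_prod_beta)
  also have "\<dots> = (\<integral>\<^sup>+r. ennreal (4 * 2 powr \<gamma> / \<gamma>) * (ennreal (f r / r * r powr (- 1 - \<gamma>)) * indicator {1..} r) \<partial>lborel)"
  proof (rule nn_integral_cong)
    fix r :: real
    show "(\<integral>\<^sup>+s. 4 * (ennreal (f r / r\<^sup>2) * indicator {1..} r) * (ennreal (s powr (- 1 - \<gamma>)) * indicator {r / 2..} s) \<partial>lborel)
      = ennreal (4 * 2 powr \<gamma> / \<gamma>) * (ennreal (f r / r * r powr (- 1 - \<gamma>)) * indicator {1..} r)"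
    proof (cases "1 \<le> r")
      case True
      then have "(\<integral>\<^sup>+s. 4 * (ennreal (f r / r\<^sup>2) * indicator {1..} r) * (ennreal (s powr (- 1 - \<gamma>)) * indicator {r / 2..} s) \<partial>lborel)
        = 4 * ennreal (f r / r\<^sup>2) * ennreal ((r / 2) powr (- \<gamma>) / \<gamma>)"
        using \<gamma> by (subst nn_integral_cmult) (auto simp: nn_integral_powr_atLeast)
      also have "\<dots> = ennreal (4 * (f r / r\<^sup>2) * ((r / 2) powr (- \<gamma>) / \<gamma>))"
      proof -
        have "ennreal (4 * (f r / r\<^sup>2) * ((r / 2) powr (- \<gamma>) / \<gamma>))
            = ennreal (4 * (f r / r\<^sup>2)) * ennreal ((r / 2) powr (- \<gamma>) / \<gamma>)"
          using \<gamma> by (intro ennreal_mult'') simp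
        also have "ennreal (4 * (f r / r\<^sup>2)) = ennreal 4 * ennreal (f r / r\<^sup>2)"
          by (intro ennreal_mult') simp
        finally show ?thesis by simp
      qed
      also have "4 * (f r / r\<^sup>2) * ((r / 2) powr (- \<gamma>) / \<gamma>) = 4 * 2 powr \<gamma> / \<gamma> * (f r / r * r powr (- 1 - \<gamma>))"
      proof -
        have "(r / 2) powr (- \<gamma>) = 2 powr \<gamma> * r powr (- \<gamma>)"
          using True by (simp add: powr_divide powr_minus field_simps)
        moreover have "r powr (- 1 - \<gamma>) = r powr (- \<gamma>) / r"
          using True powr_diff[of r "- \<gamma>" 1] by (simp add: minus_diff_commute)
        ultimately show ?thesis by (simp add: power2_eq_square mult_ac)
      qed
      finally show ?thesis
        using True f_nonneg[of r] \<gamma> by (simp flip: ennreal_mult)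
    qed simp
  qed
  also have "\<dots> = ennreal (4 * 2 powr \<gamma> / \<gamma>) * (\<integral>\<^sup>+r\<in>{1..}. ennreal (f r / r * r powr (- 1 - \<gamma>)) \<partial>lborel)"
    by (rule nn_integral_cmult) measurable
  also have "\<dots> < \<infinity>"
    using fin by (simp add: ennreal_mult_less_top)
  finally show ?thesis .
qed

text \<open>For \<open>\<gamma> = \<alpha> / d\<close> the integrand is, up to constants, the volume
  over which a point mass has spread at time \<open>t\<close> times the reaction at its height
  there. If the integral converged, substitution would make
  \<open>f r / r * r powr (- 1 - \<gamma>)\<close> integrable beyond \<open>\<sigma>0\<close>;
  between 1 and \<open>\<sigma>0\<close> this function is at most \<open>f \<sigma>0\<close>, and
  \<open>sup_ratio_integral_finite\<close> gives a contradiction.\<close>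

lemma integral_time_infinite:
  assumes \<gamma>: "0 < \<gamma>" and c: "0 < c" and \<tau>: "0 < \<tau>"
    and inf: "\<not> (\<integral>\<^sup>+s\<in>{1..}. ennreal (s powr (- (1 + \<gamma>)) * sup_ratio f s) \<partial>lborel) < \<infinity>"
  shows "(\<integral>\<^sup>+t\<in>{0<..<\<tau>}. ennreal (t powr (1 / \<gamma>) * f (c * t powr (- (1 / \<gamma>)))) \<partial>lborel) = \<infinity>"
proof (rule ccontr)
  define \<sigma>0 where "\<sigma>0 = c * \<tau> powr (- (1 / \<gamma>))"
  let ?\<phi> = "\<lambda>\<sigma>. ennreal (c * (f \<sigma> / \<sigma>))"
  let ?h = "\<lambda>r. ennreal (f r / r * r powr (- 1 - \<gamma>))"
  assume ninf: "(\<integral>\<^sup>+t\<in>{0<..<\<tau>}. ennreal (t powr (1 / \<gamma>) * f (c * t powr (- (1 / \<gamma>)))) \<partial>lborel) \<noteq> \<infinity>"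
  have "(\<integral>\<^sup>+t\<in>{0<..<\<tau>}. ennreal (t powr (1 / \<gamma>) * f (c * t powr (- (1 / \<gamma>)))) \<partial>lborel)
      = (\<integral>\<^sup>+t\<in>{0<..<\<tau>}. ?\<phi> (c * t powr (- (1 / \<gamma>))) \<partial>lborel)"
    using c by (intro nn_integral_cong) (auto simp: powr_minus field_simps split: split_indicator)
  also have "\<dots> = ennreal (\<gamma> * c powr \<gamma>) * (\<integral>\<^sup>+\<sigma>\<in>{\<sigma>0..}. ?\<phi> \<sigma> * ennreal (\<sigma> powr (- 1 - \<gamma>)) \<partial>lborel)"
    unfolding \<sigma>0_def by (intro nn_integral_powr_substitution c \<gamma> \<tau>) measurable
  also have "(\<integral>\<^sup>+\<sigma>\<in>{\<sigma>0..}. ?\<phi> \<sigma> * ennreal (\<sigma> powr (- 1 - \<gamma>)) \<partial>lborel)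
      = (\<integral>\<^sup>+\<sigma>. ennreal c * (?h \<sigma> * indicator {\<sigma>0..} \<sigma>) \<partial>lborel)"
  proof (rule nn_integral_cong)
    fix \<sigma> :: real
    have "?\<phi> \<sigma> * ennreal (\<sigma> powr (- 1 - \<gamma>)) = ennreal (c * (f \<sigma> / \<sigma>) * \<sigma> powr (- 1 - \<gamma>))"
      by (intro ennreal_mult''[symmetric]) simp
    also have "\<dots> = ennreal c * ?h \<sigma>"
      unfolding mult.assoc using c by (intro ennreal_mult') simp
    finally show "?\<phi> \<sigma> * ennreal (\<sigma> powr (- 1 - \<gamma>)) * indicator {\<sigma>0..} \<sigma> = ennreal c * (?h \<sigma> * indicator {\<sigma>0..} \<sigma>)"
      by (simp add: mult.assoc)
  qed
  also have "\<dots> = ennreal c * (\<integral>\<^sup>+\<sigma>\<in>{\<sigma>0..}. ?h \<sigma> \<partial>lborel)"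
    by (rule nn_integral_cmult) measurable
  finally have "(\<integral>\<^sup>+\<sigma>\<in>{\<sigma>0..}. ?h \<sigma> \<partial>lborel) \<noteq> \<infinity>"
    using ninf c \<gamma> by (auto simp: ennreal_mult_eq_top_iff)
  then have tail: "(\<integral>\<^sup>+\<sigma>\<in>{\<sigma>0..}. ?h \<sigma> \<partial>lborel) < \<infinity>"
    by (simp add: top.not_eq_extremum)
  have "(\<integral>\<^sup>+r\<in>{1..}. ?h r \<partial>lborel)
      \<le> (\<integral>\<^sup>+r. ennreal (f \<sigma>0) * indicator {1..max 1 \<sigma>0} r + ?h r * indicator {\<sigma>0..} r \<partial>lborel)"
  proof (rule nn_integral_mono)
    fix r :: real
    have "f r / r * r powr (- 1 - \<gamma>) \<le> f \<sigma>0" if r: "1 \<le> r" "r < \<sigma>0"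
    proof -
      have "f r / r * r powr (- 1 - \<gamma>) \<le> f r * 1"
        using r \<gamma> f_nonneg[of r] powr_mono[of "- 1 - \<gamma>" 0 r]
        by (intro mult_mono) (auto simp: divide_le_eq mult_le_cancel_left1)
      also have "\<dots> \<le> f \<sigma>0" using r f_mono by (simp add: monoD)
      finally show ?thesis .
    qed
    then show "?h r * indicator {1..} r \<le> ennreal (f \<sigma>0) * indicator {1..max 1 \<sigma>0} r + ?h r * indicator {\<sigma>0..} r"
      by (cases "r < \<sigma>0") (auto intro!: ennreal_leI split: split_indicator)
  qed
  also have "\<dots> = ennreal (f \<sigma>0) * ennreal (max 1 \<sigma>0 - 1) + (\<integral>\<^sup>+\<sigma>\<in>{\<sigma>0..}. ?h \<sigma> \<partial>lborel)"
    by (simp add: nn_integral_add nn_integral_cmult_indicator)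
  also have "\<dots> < \<infinity>"
    using tail by (simp add: ennreal_mult_less_top)
  finally show False
    using sup_ratio_integral_finite[OF \<gamma>] inf by simp
qed

end

section \<open>Plateau data and non-existence\<close>

lemma AE_lborel_pair_swap:
  fixes P :: "'a::euclidean_space \<times> 'b::euclidean_space \<Rightarrow> bool"
  assumes "AE z in lborel \<Otimes>\<^sub>M lborel. P z"
  shows "AE t in lborel. AE x in lborel. P (x, t)"
proof -
  have "AE z in distr (lborel \<Otimes>\<^sub>M lborel) (lborel \<Otimes>\<^sub>M lborel) (\<lambda>(t :: 'b, x :: 'a). (x, t)). P z"
    using assms by (subst lborel_pair.distr_pair_swap[symmetric])
  then have "AE z in lborel \<Otimes>\<^sub>M lborel. P (case z of (t, x) \<Rightarrow> (x, t))"
    by (rule AE_distrD[rotated]) (rule measurable_pair_swap')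
  from lborel_pair.AE_pair[OF this] show ?thesis by simp
qed

lemma AE_interval_contradiction:
  fixes a b :: real
  assumes "a < b" "AE t in lborel. t \<in> {a<..<b} \<longrightarrow> False"
  shows False
proof -
  have "AE t in lborel. t \<notin> {a<..<b}" using assms(2) by simp
  then have "emeasure lborel {a<..<b} = 0"
    by (subst (asm) AE_iff_measurable[where N = "{a<..<b}"]) auto
  with assms(1) show False by simp
qed

lemma summable_inverse_square: "summable (\<lambda>k. 1 / (real k + 1)\<^sup>2)"
  using inverse_power_summable[of 2, where 'a = real]
    summable_Suc_iff[of "\<lambda>n. inverse ((real n)\<^sup>2)"]
  by (simp add: divide_inverse add.commute)

lemma ball_in_borel [measurable]: "ball c r \<in> sets borel"
  by simp

lemma ennreal_le_suminf: "g k \<le> (\<Sum>k. g k)" for g :: "nat \<Rightarrow> ennreal"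
  using sum_le_suminf[of g "{k}"] by simp

text \<open>The \<open>q\<close>-th powers are added rather than the heights, so the norm is
  controlled by the given series while the sum still dominates each term. The sum may be infinite on
  a null set, where \<open>enn2real\<close> yields 0; hence the lower bound holds almost
  everywhere.\<close>

lemma Lq_function_above_plateaus:
  fixes b R :: "nat \<Rightarrow> real"
  assumes q: "1 \<le> q" and b: "\<And>k. 0 \<le> b k" and R: "\<And>k. 0 \<le> R k"
    and sum: "summable (\<lambda>k. b k powr q * R k ^ DIM('a))"
  obtains u0 :: "'a::euclidean_space \<Rightarrow> real" where "nonneg_Lq q u0" "\<And>k. AE x in lborel. norm x < R k \<longrightarrow> b k \<le> u0 x"
proof -
  define S :: "'a \<Rightarrow> ennreal" where "S x = (\<Sum>k. ennreal (b k powr q) * indicator (ball 0 (R k)) x)" for x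
  have [measurable]: "S \<in> borel_measurable borel"
    unfolding S_def[abs_def] by measurable
  have "(\<integral>\<^sup>+x. S x \<partial>lborel) = (\<Sum>k. ennreal (b k powr q) * emeasure lborel (ball 0 (R k) :: 'a set))"
    unfolding S_def by (subst nn_integral_suminf) (auto simp: nn_integral_cmult_indicator)
  also have "\<dots> = (\<Sum>k. ennreal (unit_ball_vol DIM('a)) * ennreal (b k powr q * R k ^ DIM('a)))"
    using b R by (intro suminf_cong) (simp add: emeasure_ball mult_ac flip: ennreal_mult)
  also have "\<dots> = ennreal (unit_ball_vol DIM('a)) * ennreal (\<Sum>k. b k powr q * R k ^ DIM('a))"
    using sum R by (subst ennreal_suminf_cmult) (simp add: suminf_ennreal2)
  also have "\<dots> < \<infinity>" by (simp add: ennreal_mult_less_top)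
  finally have S_fin: "(\<integral>\<^sup>+x. S x \<partial>lborel) < \<infinity>" .
  define u0 where "u0 x = enn2real (S x) powr (1 / q)" for x
  show thesis
  proof
    have [measurable]: "u0 \<in> borel_measurable borel" unfolding u0_def[abs_def] by measurable
    have "ennreal (u0 x powr q) \<le> S x" for x
      using q by (cases "S x") (auto simp: u0_def powr_powr)
    then have "(\<integral>\<^sup>+x. ennreal (u0 x powr q) \<partial>lborel) \<le> (\<integral>\<^sup>+x. S x \<partial>lborel)"
      by (rule nn_integral_mono)
    with S_fin show "nonneg_Lq q u0" by (simp add: nonneg_Lq_def) (simp add: u0_def)
    fix k
    have "AE x in lborel. S x \<noteq> \<infinity>"
      using S_fin by (intro nn_integral_PInf_AE) auto
    then show "AE x in lborel. norm x < R k \<longrightarrow> b k \<le> u0 x"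
    proof eventually_elim
      fix x assume fin: "S x \<noteq> \<infinity>"
      show "norm x < R k \<longrightarrow> b k \<le> u0 x"
      proof
        assume "norm x < R k"
        then have "ennreal (b k powr q) = ennreal (b k powr q) * indicator (ball 0 (R k)) x" by simp
        also have "\<dots> \<le> S x"
          unfolding S_def by (rule ennreal_le_suminf)
        finally have "b k powr q \<le> enn2real (S x)"
          using fin by (cases "S x") auto
        then have "(b k powr q) powr (1 / q) \<le> u0 x"
          unfolding u0_def using q by (intro powr_mono2) auto
        then show "b k \<le> u0 x" using q b[of k] by (simp add: powr_powr)
      qed
    qed
  qed
qed

context reaction_diffusion
begin

lemma ae_solutionD:
  assumes "ae_solution u0 T u"
  shows "0 < T" "case_prod u \<in> borel_measurable (borel \<Otimes>\<^sub>M borel)" "0 \<le> u x t"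
    "AE t in lborel. t \<in> {0<..<T} \<longrightarrow> (AE x in lborel. ennreal (u x t) = duhamel u0 u x t)"
  using assms AE_lborel_pair_swap[of "\<lambda>z. snd z \<in> {0<..<T} \<longrightarrow> ennreal (u (fst z) (snd z)) = duhamel u0 u (fst z) (snd z)"]
  by (auto simp: ae_solution_def)

text \<open>The type argument fixes the dimension, on which the constant depends.\<close>

definition plateau_const :: "'a::euclidean_space itself \<Rightarrow> real \<Rightarrow> bool" where
  "plateau_const _ c \<longleftrightarrow> 0 < c \<and> (\<forall>t R (x::'a). 0 < t \<longrightarrow> t \<le> R powr \<alpha> \<longrightarrow> 0 < R \<longrightarrow> norm x < R \<longrightarrow>
     ennreal c \<le> (\<integral>\<^sup>+y. ennreal (p t (x - y)) * indicator (ball 0 R) y \<partial>lborel))"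

lemma plateau_constD:
  assumes "plateau_const TYPE('a::euclidean_space) c"
  shows "0 < c" "0 < t \<Longrightarrow> t \<le> R powr \<alpha> \<Longrightarrow> 0 < R \<Longrightarrow> norm (x::'a) < R \<Longrightarrow>
    ennreal c \<le> (\<integral>\<^sup>+y. ennreal (p t (x - y)) * indicator (ball 0 R) y \<partial>lborel)"
  using assms by (simp_all add: plateau_const_def)

lemma ex_plateau_const:
  obtains c where "c \<le> 1" "plateau_const TYPE('a::euclidean_space) c"
  by (rule nn_integral_p_ball_ge[where 'a = 'a]) (simp add: plateau_const_def)

lemma H_plateau_ge:
  fixes x :: "'a::euclidean_space"
  assumes [measurable]: "h \<in> borel_measurable borel"
    and h: "AE y in lborel. norm y < R \<longrightarrow> ennreal b \<le> h y"
    and c: "ennreal c \<le> (\<integral>\<^sup>+y. ennreal (p t (x - y)) * indicator (ball 0 R) y \<partial>lborel)"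
  shows "ennreal b * ennreal c \<le> H t h x"
proof -
  have "ennreal b * ennreal c \<le> ennreal b * (\<integral>\<^sup>+y. ennreal (p t (x - y)) * indicator (ball 0 R) y \<partial>lborel)"
    using c by (intro mult_left_mono) auto
  also have "\<dots> = (\<integral>\<^sup>+y. ennreal (p t (x - y)) * (ennreal b * indicator (ball 0 R) y) \<partial>lborel)"
    by (subst nn_integral_cmult[symmetric]) (measurable, intro nn_integral_cong mult.left_commute)
  also have "\<dots> \<le> H t h x"
    unfolding H_def
    by (intro nn_integral_mono_AE, use h in eventually_elim) (auto intro!: mult_left_mono split: split_indicator)
  finally show ?thesis .
qed

text \<open>Duhamel's formula is used twice. Its linear term gives \<open>c * b \<le> u y s\<close>
  on the ball at almost all earlier times; the reaction there is then at least
  \<open>f (c * b)\<close>, of which the semigroup again retains the fraction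
  \<open>c\<close>.\<close>

lemma solution_on_plateau_ge:
  fixes u :: "'a::euclidean_space \<Rightarrow> real \<Rightarrow> real"
  assumes pc: "plateau_const TYPE('a) c" and R: "0 < R" and b: "0 \<le> b"
    and u0 [measurable]: "u0 \<in> borel_measurable borel" and u0_ge: "AE x in lborel. norm x < R \<longrightarrow> b \<le> u0 x"
    and sol: "ae_solution u0 T u"
  shows "AE t in lborel. 0 < t \<and> t < T \<and> t < R powr \<alpha> \<longrightarrow>
    (AE x in lborel. norm x < R \<longrightarrow> c * t * f (c * b) \<le> u x t)"
proof -
  note [measurable] = ae_solutionD(2)[OF sol]
  note c = plateau_constD[OF pc]
  have "AE t in lborel. 0 < t \<and> t < T \<and> t < R powr \<alpha> \<longrightarrow> (AE x in lborel. norm x < R \<longrightarrow> c * b \<le> u x t)"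
    using ae_solutionD(4)[OF sol]
  proof eventually_elim
    fix t assume A: "t \<in> {0<..<T} \<longrightarrow> (AE x in lborel. ennreal (u x t) = duhamel u0 u x t)"
    show "0 < t \<and> t < T \<and> t < R powr \<alpha> \<longrightarrow> (AE x in lborel. norm x < R \<longrightarrow> c * b \<le> u x t)"
    proof
      assume t: "0 < t \<and> t < T \<and> t < R powr \<alpha>"
      with A have "AE x in lborel. ennreal (u x t) = duhamel u0 u x t" by simp
      then show "AE x in lborel. norm x < R \<longrightarrow> c * b \<le> u x t"
      proof eventually_elim
        fix x assume D: "ennreal (u x t) = duhamel u0 u x t"
        show "norm x < R \<longrightarrow> c * b \<le> u x t"
        proof
          assume x: "norm x < R"
          have "ennreal b * ennreal c \<le> H t (\<lambda>y. ennreal (u0 y)) x"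
            by (rule H_plateau_ge[where R = R]) (use u0_ge t R x in \<open>auto intro: c ennreal_leI elim!: eventually_mono\<close>)
          also have "\<dots> \<le> ennreal (u x t)" by (simp add: D duhamel_def)
          finally have "ennreal (b * c) \<le> ennreal (u x t)"
            using b c by (simp add: ennreal_mult)
          then show "c * b \<le> u x t"
            using ae_solutionD(3)[OF sol] by (simp add: ennreal_le_iff mult.commute)
        qed
      qed
    qed
  qed
  then have low: "AE s in lborel. 0 < s \<and> s < T \<and> s < R powr \<alpha> \<longrightarrow>
      (AE y in lborel. norm y < R \<longrightarrow> ennreal (f (c * b)) \<le> ennreal (f (u y s)))"
    by eventually_elim (auto elim!: eventually_mono intro!: ennreal_leI monoD[OF f_mono])
  show ?thesis
    using ae_solutionD(4)[OF sol]
  proof eventually_elim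
    fix t assume A: "t \<in> {0<..<T} \<longrightarrow> (AE x in lborel. ennreal (u x t) = duhamel u0 u x t)"
    show "0 < t \<and> t < T \<and> t < R powr \<alpha> \<longrightarrow> (AE x in lborel. norm x < R \<longrightarrow> c * t * f (c * b) \<le> u x t)"
    proof
      assume t: "0 < t \<and> t < T \<and> t < R powr \<alpha>"
      with A have "AE x in lborel. ennreal (u x t) = duhamel u0 u x t" by simp
      then show "AE x in lborel. norm x < R \<longrightarrow> c * t * f (c * b) \<le> u x t"
      proof eventually_elim
        fix x assume D: "ennreal (u x t) = duhamel u0 u x t"
        show "norm x < R \<longrightarrow> c * t * f (c * b) \<le> u x t"
        proof
          assume x: "norm x < R"
          have "ennreal (c * t * f (c * b)) = ennreal (f (c * b)) * ennreal c * ennreal t"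
            using c t f_nonneg[of "c * b"] by (simp add: mult_ac flip: ennreal_mult)
          also have "\<dots> = (\<integral>\<^sup>+s. (ennreal (f (c * b)) * ennreal c) * indicator {0<..<t} s \<partial>lborel)"
            using t by (subst nn_integral_cmult_indicator) auto
          also have "\<dots> \<le> (\<integral>\<^sup>+s\<in>{0<..<t}. H (t - s) (\<lambda>y. ennreal (f (u y s))) x \<partial>lborel)"
          proof (rule nn_integral_mono_AE, use low in eventually_elim)
            fix s assume B: "0 < s \<and> s < T \<and> s < R powr \<alpha> \<longrightarrow>
              (AE y in lborel. norm y < R \<longrightarrow> ennreal (f (c * b)) \<le> ennreal (f (u y s)))"
            show "(ennreal (f (c * b)) * ennreal c) * indicator {0<..<t} s
              \<le> H (t - s) (\<lambda>y. ennreal (f (u y s))) x * indicator {0<..<t} s"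
            proof (cases "s \<in> {0<..<t}")
              case True
              then have "ennreal (f (c * b)) * ennreal c \<le> H (t - s) (\<lambda>y. ennreal (f (u y s))) x"
                using B t R x by (intro H_plateau_ge[where R = R] c) auto
              with True show ?thesis by simp
            qed simp
          qed
          also have "\<dots> \<le> ennreal (u x t)" by (simp add: D duhamel_def)
          finally show "c * t * f (c * b) \<le> u x t"
            using ae_solutionD(3)[OF sol] by (simp add: ennreal_le_iff)
        qed
      qed
    qed
  qed
qed

text \<open>The plateau of index \<open>k\<close> contributes \<open>1 / (k + 1)\<^sup>2\<close> to the \<open>L\<^sup>q\<close> norm of the data, whereas the Duhamel term
multiplies its height by at least \<open>\<kappa> (k + 1)\<^sup>4\<close>.\<close>

lemma no_solution_plateaus:
  fixes b R :: "nat \<Rightarrow> real"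
  assumes q: "1 \<le> q" and pc: "plateau_const TYPE('a::euclidean_space) c"
    and b: "\<And>k. 0 < b k" and R: "\<And>k. 0 < R k" and bR: "\<And>k. b k powr q * R k ^ DIM('a) = 1 / (real k + 1)\<^sup>2"
    and big: "\<And>T. 0 < T \<Longrightarrow> \<exists>\<kappa>>0. \<exists>k0. \<forall>k\<ge>k0. \<exists>t0 t1. 0 < t0 \<and> t0 < t1 \<and> t1 \<le> T \<and> t1 \<le> R k powr \<alpha> \<and>
       \<kappa> * (real k + 1) ^ 4 * b k \<le> c * t0 * f (c * b k)"
  obtains u0 :: "'a::euclidean_space \<Rightarrow> real" where "nonneg_Lq q u0" "\<not> Lq_solvable q u0"
proof -
  obtain u0 :: "'a \<Rightarrow> real" where data: "nonneg_Lq q u0" and u0_ge: "\<And>k. AE x in lborel. norm x < R k \<longrightarrow> b k \<le> u0 x"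
    by (rule Lq_function_above_plateaus[OF q, of b R])
       (use b R in \<open>auto simp: less_imp_le bR summable_inverse_square\<close>)
  have u0: "u0 \<in> borel_measurable borel" using data by (simp add: nonneg_Lq_def)
  have "\<not> Lq_solvable q u0"
    unfolding Lq_solvable_def
  proof safe
    fix T u C
    assume sol: "ae_solution u0 T u"
      and C: "AE t in lborel. t \<in> {0<..<T} \<longrightarrow> (\<integral>\<^sup>+x. ennreal (u x t powr q) \<partial>lborel) \<le> ennreal C"
    define \<omega> where "\<omega> = unit_ball_vol (real DIM('a))"
    have \<omega>: "0 < \<omega>" by (simp add: \<omega>_def)
    obtain \<kappa> k0 where \<kappa>: "0 < \<kappa>" and k0: "\<And>k. k0 \<le> k \<Longrightarrow> \<exists>t0 t1. 0 < t0 \<and> t0 < t1 \<and> t1 \<le> T \<and> t1 \<le> R k powr \<alpha> \<and>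
       \<kappa> * (real k + 1) ^ 4 * b k \<le> c * t0 * f (c * b k)"
      using big[OF ae_solutionD(1)[OF sol]] by blast
    \<comment> \<open>Large enough for \<open>1 \<le> \<kappa> * n\<close> and
      \<open>\<bar>C\<bar> < \<omega> * \<kappa> * n\<close>, where
      \<open>n = real k + 1\<close>.\<close>
    obtain N :: nat where N: "1 / \<kappa> + \<bar>C\<bar> / (\<omega> * \<kappa>) \<le> real N" using real_arch_simple by blast
    define k where "k = max k0 N"
    define n where "n = real k + 1"
    have n: "1 / \<kappa> + \<bar>C\<bar> / (\<omega> * \<kappa>) < n" "1 \<le> n" using N by (auto simp: n_def k_def)
    obtain t0 t1 where t: "0 < t0" "t0 < t1" "t1 \<le> T" "t1 \<le> R k powr \<alpha>" "\<kappa> * n ^ 4 * b k \<le> c * t0 * f (c * b k)"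
      using k0[of k] unfolding n_def k_def by auto
    have nC: "\<bar>C\<bar> < \<omega> * \<kappa> * n" and n1: "1 \<le> \<kappa> * n"
    proof -
      have "\<bar>C\<bar> / (\<omega> * \<kappa>) < n" "1 / \<kappa> \<le> n" using n \<kappa> \<omega>
        by (smt (verit) divide_nonneg_pos mult_pos_pos zero_less_divide_1_iff)+
      then show "\<bar>C\<bar> < \<omega> * \<kappa> * n" "1 \<le> \<kappa> * n" using \<kappa> \<omega> by (simp_all add: field_simps)
    qed
    have "n ^ 1 \<le> n ^ 2" "n ^ 1 \<le> n ^ 4" using n by (intro power_increasing; simp)+
    \<comment> \<open>Since \<open>1 \<le> \<kappa> * n ^ 4\<close>, its \<open>q\<close>-th power
      is at least itself; \<open>bR\<close> costs a factor \<open>n ^ 2\<close>, and growth of order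
      \<open>n ^ 2\<close> remains.\<close>
    have big': "C < (c * t0 * f (c * b k)) powr q * (\<omega> * R k ^ DIM('a))"
    proof -
      have "C < \<omega> * \<kappa> * n" using nC by simp
      also have "\<dots> \<le> \<omega> * \<kappa> * n ^ 2" using \<kappa> \<omega> \<open>n ^ 1 \<le> n ^ 2\<close> by simp
      also have "\<dots> = (\<kappa> * n ^ 4) powr 1 * \<omega> * (1 / n\<^sup>2)"
        using \<kappa> n by (simp add: power_numeral_reduce)
      also have "\<dots> \<le> (\<kappa> * n ^ 4) powr q * \<omega> * (1 / n\<^sup>2)"
      proof (intro mult_right_mono powr_mono)
        have "1 \<le> \<kappa> * n" by (rule n1)
        also have "\<dots> \<le> \<kappa> * n ^ 4" using \<kappa> \<open>n ^ 1 \<le> n ^ 4\<close> by simp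
        finally show "1 \<le> \<kappa> * n ^ 4" .
      qed (use q \<omega> in auto)
      also have "\<dots> = (\<kappa> * n ^ 4 * b k) powr q * (\<omega> * R k ^ DIM('a))"
        unfolding n_def bR[of k, symmetric] using b[of k] \<kappa> by (simp add: powr_mult)
      also have "\<dots> \<le> (c * t0 * f (c * b k)) powr q * (\<omega> * R k ^ DIM('a))"
        using t(5) \<kappa> n b[of k] q \<omega> R[of k] by (intro mult_right_mono powr_mono2) auto
      finally show ?thesis .
    qed
    have "AE t in lborel. t \<in> {t0<..<t1} \<longrightarrow> False"
      using C solution_on_plateau_ge[OF pc R[of k] less_imp_le[OF b[of k]] u0 u0_ge[of k] sol]
    proof eventually_elim
      fix s
      assume 1: "s \<in> {0<..<T} \<longrightarrow> (\<integral>\<^sup>+x. ennreal (u x s powr q) \<partial>lborel) \<le> ennreal C"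
        and 2: "0 < s \<and> s < T \<and> s < R k powr \<alpha> \<longrightarrow> (AE x in lborel. norm x < R k \<longrightarrow> c * s * f (c * b k) \<le> u x s)"
      show "s \<in> {t0<..<t1} \<longrightarrow> False"
      proof
        assume s: "s \<in> {t0<..<t1}"
        let ?m = "c * t0 * f (c * b k)"
        have m: "0 \<le> ?m" "?m \<le> c * s * f (c * b k)"
          using plateau_constD(1)[OF pc] t s f_nonneg by (auto intro!: mult_right_mono)
        have "ennreal (?m powr q * (\<omega> * R k ^ DIM('a))) = (\<integral>\<^sup>+x. ennreal (?m powr q) * indicator (ball 0 (R k) :: 'a set) x \<partial>lborel)"
          using R[of k] \<omega> by (subst nn_integral_cmult_indicator) (auto simp: emeasure_ball \<omega>_def ennreal_mult)
        also have "\<dots> \<le> (\<integral>\<^sup>+x. ennreal (u x s powr q) \<partial>lborel)"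
        proof (rule nn_integral_mono_AE)
          have "AE x in lborel. norm x < R k \<longrightarrow> c * s * f (c * b k) \<le> u x s"
            using 2 s t by auto
          then show "AE x in lborel. ennreal (?m powr q) * indicator (ball 0 (R k) :: 'a set) x \<le> ennreal (u x s powr q)"
            by eventually_elim (use m q in \<open>auto intro!: ennreal_leI powr_mono2 split: split_indicator\<close>)
        qed
        also have "\<dots> \<le> ennreal C" using 1 s t by simp
        finally have le: "ennreal (?m powr q * (\<omega> * R k ^ DIM('a))) \<le> ennreal C" .
        \<comment> \<open>\<open>ennreal C\<close> is 0 for negative \<open>C\<close>, so the
          inequality passes to the reals only once \<open>C\<close> is known to be
          nonnegative.\<close>
        have "0 < \<kappa> * n ^ 4 * b k" using \<kappa> n b[of k] by simp
        then have "0 < ?m" using t(5) by (rule less_le_trans)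
        then have "0 < ?m powr q * (\<omega> * R k ^ DIM('a))"
          using \<omega> R[of k] by (intro mult_pos_pos zero_less_power) auto
        then have "0 < ennreal (?m powr q * (\<omega> * R k ^ DIM('a)))"
          by (simp only: ennreal_less_zero_iff)
        then have "0 < ennreal C" using le by (rule less_le_trans)
        then have "0 \<le> C" by (simp only: ennreal_less_zero_iff less_imp_le)
        with le have "?m powr q * (\<omega> * R k ^ DIM('a)) \<le> C" by (simp only: ennreal_le_iff)
        with big' show False by simp
      qed
    qed
    with t(2) show False by (rule AE_interval_contradiction)
  qed
  with data show thesis by (rule that)
qed

text \<open>The choice \<open>c * b k = s k\<close> makes the reaction on the plateau exceed
  \<open>(k + 1) ^ 4 * s k\<close>. As \<open>b k < 1 / (k + 1) ^ 2\<close> and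
  \<open>1 \<le> q\<close>, prescribing the norm forces \<open>1 \<le> R k\<close>, so the plateaus
  persist on a time interval independent of \<open>k\<close>.\<close>

lemma no_solution_small:
  assumes q: "1 \<le> q" and small: "\<And>M \<delta>. 0 < \<delta> \<Longrightarrow> \<exists>s. 0 < s \<and> s < \<delta> \<and> M * s < f s"
  obtains u0 :: "'a::euclidean_space \<Rightarrow> real" where "nonneg_Lq q u0" "\<not> Lq_solvable q u0"
proof -
  obtain c where "c \<le> 1" and pc: "plateau_const TYPE('a) c"
    by (rule ex_plateau_const)
  then have c: "0 < c" "c \<le> 1" using plateau_constD(1) by auto
  have "\<exists>s. 0 < s \<and> s < c / (real k + 1)\<^sup>2 \<and> (real k + 1) ^ 4 * s < f s" for k
    using c by (intro small) simp
  then obtain s where s: "\<And>k. 0 < s k" "\<And>k. s k < c / (real k + 1)\<^sup>2" "\<And>k. (real k + 1) ^ 4 * s k < f (s k)"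
    by metis
  define b where "b k = s k / c" for k
  have b: "0 < b k" "b k < 1 / (real k + 1)\<^sup>2" for k
    using s[of k] c by (auto simp: b_def field_simps)
  define R where "R k = (1 / (real k + 1)\<^sup>2 * b k powr (- q)) powr (1 / DIM('a))" for k
  have R: "0 < R k" for k using b[of k] by (simp add: R_def)
  have Rd: "R k ^ DIM('a) = 1 / (real k + 1)\<^sup>2 * b k powr (- q)" for k
  proof -
    have "R k ^ DIM('a) = R k powr DIM('a)" using R[of k] by (simp add: powr_realpow)
    also have "\<dots> = (1 / (real k + 1)\<^sup>2 * b k powr (- q)) powr 1" unfolding R_def powr_powr by simp
    finally show ?thesis using b[of k] by simp
  qed
  have R1: "1 \<le> R k" for k
  proof -
    have "b k powr q \<le> b k powr 1"
    proof (rule powr_mono')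
      have "1 / (real k + 1)\<^sup>2 \<le> 1" by simp
      then show "b k \<le> 1" using b[of k] by linarith
    qed (use q b[of k] in auto)
    also have "\<dots> \<le> 1 / (real k + 1)\<^sup>2" using b[of k] by simp
    finally have "1 \<le> 1 / (real k + 1)\<^sup>2 * b k powr (- q)"
      using b[of k] by (simp add: powr_minus field_simps)
    then show ?thesis unfolding R_def by (intro ge_one_powr_ge_zero) auto
  qed
  show thesis
  proof (rule no_solution_plateaus[OF q pc b(1) R _ _ that])
    show "b k powr q * R k ^ DIM('a) = 1 / (real k + 1)\<^sup>2" for k
      using b[of k] by (simp add: Rd powr_minus)
    fix T :: real assume T: "0 < T"
    show "\<exists>\<kappa>>0. \<exists>k0. \<forall>k\<ge>k0. \<exists>t0 t1. 0 < t0 \<and> t0 < t1 \<and> t1 \<le> T \<and> t1 \<le> R k powr \<alpha> \<and>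
       \<kappa> * (real k + 1) ^ 4 * b k \<le> c * t0 * f (c * b k)"
    \<comment> \<open>One factor \<open>c\<close> comes from the plateau estimate, the other from
      \<open>s k = c * b k\<close>, and \<open>min T 1 / 2\<close> is the time
      \<open>t0\<close>.\<close>
    proof (rule exI[of _ "c * (min T 1 / 2) * c"], rule conjI, use T c in simp, rule exI[of _ "0::nat"], intro allI impI)
      fix k :: nat
      show "\<exists>t0 t1. 0 < t0 \<and> t0 < t1 \<and> t1 \<le> T \<and> t1 \<le> R k powr \<alpha> \<and>
         c * (min T 1 / 2) * c * (real k + 1) ^ 4 * b k \<le> c * t0 * f (c * b k)"
      proof (rule exI[of _ "min T 1 / 2"], rule exI[of _ "min T 1"], intro conjI)
        show "min T 1 \<le> R k powr \<alpha>"
          using ge_one_powr_ge_zero[OF R1[of k], of \<alpha>] \<alpha> by simp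
        have "c * (min T 1 / 2) * ((real k + 1) ^ 4 * s k) \<le> c * (min T 1 / 2) * f (s k)"
          using s(3)[of k] c T by (intro mult_left_mono) auto
        then show "c * (min T 1 / 2) * c * (real k + 1) ^ 4 * b k \<le> c * (min T 1 / 2) * f (c * b k)"
          using c by (simp add: b_def mult_ac)
      qed (use T in auto)
    qed
  qed
qed

text \<open>The radii now shrink, and a plateau lasts only for the time
  \<open>R k powr \<alpha>\<close>, which is \<open>b k powr (1 - m)\<close> times a loss
  \<open>(k + 1) powr (- (2 * \<alpha> / d))\<close>. The first factor reduces the reaction, of
  order \<open>b k powr m\<close>, to order \<open>b k\<close>; the exponent
  \<open>4 + 2 * \<alpha> / d\<close> in the choice of \<open>s k\<close> makes up for the
  loss.\<close>

lemma no_solution_large: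
  assumes q: "1 \<le> q" and large: "\<And>M. \<exists>s\<ge>1. M * s powr (1 + \<alpha> * q / DIM('a::euclidean_space)) < f s"
  obtains u0 :: "'a::euclidean_space \<Rightarrow> real" where "nonneg_Lq q u0" "\<not> Lq_solvable q u0"
proof -
  define d where "d = real DIM('a)"
  have d: "0 < d" by (simp add: d_def)
  define m where "m = 1 + \<alpha> * q / d"
  obtain c where "c \<le> 1" and pc: "plateau_const TYPE('a) c"
    by (rule ex_plateau_const)
  then have c: "0 < c" "c \<le> 1" using plateau_constD(1) by auto
  have "\<exists>s. 1 \<le> s \<and> (real k + 1) powr (4 + 2 * \<alpha> / d) * s powr m < f s" for k
    using large unfolding m_def d_def by blast
  then obtain s where s: "\<And>k. 1 \<le> s k" "\<And>k. (real k + 1) powr (4 + 2 * \<alpha> / d) * s k powr m < f (s k)"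
    by metis
  define b where "b k = s k / c" for k
  \<comment> \<open>Here \<open>c \<le> 1\<close> enters. Heights at least 1 bring
    \<open>R k powr \<alpha>\<close> below any given \<open>T\<close> for large
    \<open>k\<close>.\<close>
  have b: "1 \<le> b k" for k
    using s(1)[of k] c by (simp add: b_def field_simps)
  have b0: "0 < b k" for k using b[of k] by linarith
  define R where "R k = (1 / (real k + 1)\<^sup>2 * b k powr (- q)) powr (1 / d)" for k
  have R: "0 < R k" for k using b0[of k] by (simp add: R_def)
  have Rd: "R k ^ DIM('a) = 1 / (real k + 1)\<^sup>2 * b k powr (- q)" for k
  proof -
    have "R k ^ DIM('a) = R k powr d" using R[of k] by (simp add: d_def powr_realpow)
    also have "\<dots> = (1 / (real k + 1)\<^sup>2 * b k powr (- q)) powr 1" unfolding R_def powr_powr using d by simp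
    finally show ?thesis using b0[of k] by simp
  qed
  have R\<alpha>: "R k powr \<alpha> = (real k + 1) powr (- (2 * \<alpha> / d)) * b k powr (1 - m)" for k
  proof -
    have "1 / (real k + 1)\<^sup>2 = (real k + 1) powr (- 2)"
      by (simp add: powr_minus_divide)
    then show ?thesis
      using b0[of k] by (simp add: R_def m_def powr_mult powr_powr mult_ac)
  qed
  show thesis
  proof (rule no_solution_plateaus[OF q pc b0 R _ _ that])
    show "b k powr q * R k ^ DIM('a) = 1 / (real k + 1)\<^sup>2" for k
      using b0[of k] by (simp add: Rd powr_minus)
    fix T :: real assume T: "0 < T"
    have m1: "0 \<le> m - 1" using \<alpha> q d by (simp add: m_def)
    have "(\<lambda>k. (real k + 1) powr (- (2 * \<alpha> / d))) \<longlonglongrightarrow> 0"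
      using \<alpha> d by (intro tendsto_neg_powr filterlim_tendsto_add_at_top[OF _ filterlim_real_sequentially, THEN filterlim_cong[THEN iffD1, OF refl refl, rotated]])
        (auto simp: add.commute)
    then have "eventually (\<lambda>k. (real k + 1) powr (- (2 * \<alpha> / d)) < T) sequentially"
      using T by (rule order_tendstoD)
    then obtain k0 where k0: "\<And>k. k0 \<le> k \<Longrightarrow> (real k + 1) powr (- (2 * \<alpha> / d)) < T"
      by (auto simp: eventually_sequentially)
    show "\<exists>\<kappa>>0. \<exists>k0. \<forall>k\<ge>k0. \<exists>t0 t1. 0 < t0 \<and> t0 < t1 \<and> t1 \<le> T \<and> t1 \<le> R k powr \<alpha> \<and>
       \<kappa> * (real k + 1) ^ 4 * b k \<le> c * t0 * f (c * b k)"
    proof (rule exI[of _ "c * (1 / 2) * c powr m"], rule conjI, use c in simp, rule exI[of _ k0], intro allI impI)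
      fix k :: nat assume k: "k0 \<le> k"
      show "\<exists>t0 t1. 0 < t0 \<and> t0 < t1 \<and> t1 \<le> T \<and> t1 \<le> R k powr \<alpha> \<and>
         c * (1 / 2) * c powr m * (real k + 1) ^ 4 * b k \<le> c * t0 * f (c * b k)"
      proof (rule exI[of _ "R k powr \<alpha> / 2"], rule exI[of _ "R k powr \<alpha>"], intro conjI)
        have "b k powr (1 - m) \<le> b k powr 0" using b m1 by (intro powr_mono) auto
        then have "R k powr \<alpha> \<le> (real k + 1) powr (- (2 * \<alpha> / d)) * 1"
          unfolding R\<alpha> using b0[of k] by (intro mult_left_mono) auto
        then show "R k powr \<alpha> \<le> T" using k0[OF k] by simp
        have "c * (R k powr \<alpha> / 2) * ((real k + 1) powr (4 + 2 * \<alpha> / d) * s k powr m) \<le> c * (R k powr \<alpha> / 2) * f (s k)"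
          using s(2)[of k] c by (intro mult_left_mono) auto
        also have "c * (R k powr \<alpha> / 2) * ((real k + 1) powr (4 + 2 * \<alpha> / d) * s k powr m)
          = c * (1 / 2) * c powr m * ((real k + 1) powr (- (2 * \<alpha> / d)) * (real k + 1) powr (4 + 2 * \<alpha> / d)) * (b k powr (1 - m) * b k powr m)"
          using c b0[of k] by (simp add: R\<alpha> b_def powr_divide mult_ac)
        also have "(real k + 1) powr (- (2 * \<alpha> / d)) * (real k + 1) powr (4 + 2 * \<alpha> / d) = (real k + 1) ^ 4"
          by (subst powr_add[symmetric]) simp
        also have "b k powr (1 - m) * b k powr m = b k"
          using b0[of k] by (simp flip: powr_add)
        finally show "c * (1 / 2) * c powr m * (real k + 1) ^ 4 * b k \<le> c * (R k powr \<alpha> / 2) * f (c * b k)"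
          using c by (simp add: b_def)
      qed (use R[of k] in auto)
    qed
  qed
qed

end

section \<open>Concentrated data in L^1\<close>

context reaction_diffusion
begin

text \<open>The semigroup preserves mass, so a solution carries at least the mass produced by the
  reaction up to that time.\<close>

lemma nn_integral_solution_ge:
  fixes u :: "'a::euclidean_space \<Rightarrow> real \<Rightarrow> real"
  assumes sol: "ae_solution u0 T u"
  shows "AE t in lborel. t \<in> {0<..<T} \<longrightarrow>
    (\<integral>\<^sup>+s\<in>{0<..<t}. (\<integral>\<^sup>+y. ennreal (f (u y s)) \<partial>lborel) \<partial>lborel) \<le> (\<integral>\<^sup>+x. ennreal (u x t) \<partial>lborel)"
  using ae_solutionD(4)[OF sol]
proof eventually_elim
  note [measurable] = ae_solutionD(2)[OF sol]
  fix t assume A: "t \<in> {0<..<T} \<longrightarrow> (AE x in lborel. ennreal (u x t) = duhamel u0 u x t)"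
  show "t \<in> {0<..<T} \<longrightarrow>
    (\<integral>\<^sup>+s\<in>{0<..<t}. (\<integral>\<^sup>+y. ennreal (f (u y s)) \<partial>lborel) \<partial>lborel) \<le> (\<integral>\<^sup>+x. ennreal (u x t) \<partial>lborel)"
  proof
    assume "t \<in> {0<..<T}"
    with A have D: "AE x in lborel. ennreal (u x t) = duhamel u0 u x t" by simp
    have "(\<integral>\<^sup>+s\<in>{0<..<t}. (\<integral>\<^sup>+y. ennreal (f (u y s)) \<partial>lborel) \<partial>lborel)
        = (\<integral>\<^sup>+s. (\<integral>\<^sup>+x. H (t - s) (\<lambda>y. ennreal (f (u y s))) x * indicator {0<..<t} s \<partial>lborel) \<partial>lborel)"
      by (intro nn_integral_cong) (auto simp: nn_integral_H split: split_indicator)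
    also have "\<dots> = (\<integral>\<^sup>+x. (\<integral>\<^sup>+s\<in>{0<..<t}. H (t - s) (\<lambda>y. ennreal (f (u y s))) x \<partial>lborel) \<partial>lborel)"
      by (rule lborel_pair.Fubini') measurable
    also have "\<dots> \<le> (\<integral>\<^sup>+x. ennreal (u x t) \<partial>lborel)"
      by (intro nn_integral_mono_AE, use D in eventually_elim) (simp add: duhamel_def)
    finally show "(\<integral>\<^sup>+s\<in>{0<..<t}. (\<integral>\<^sup>+y. ennreal (f (u y s)) \<partial>lborel) \<partial>lborel) \<le> (\<integral>\<^sup>+x. ennreal (u x t) \<partial>lborel)" .
  qed
qed

text \<open>The \<open>k\<close>-th plateau holds mass \<open>\<omega> * m k\<close> in a ball so
  small that from time \<open>\<delta> k\<close> on it acts like a point mass. The integral diverges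
  on every interval and for every constant, so \<open>\<delta> k\<close> can be fixed beforehand
  such that the reaction between \<open>\<delta> k\<close> and \<open>1 / (k + 1)\<close> already
  produces more than a fixed multiple of \<open>k\<close>.\<close>

lemma no_solution_L1:
  assumes inf: "\<And>c \<tau>. 0 < c \<Longrightarrow> 0 < \<tau> \<Longrightarrow>
     (\<integral>\<^sup>+t\<in>{0<..<\<tau>}. ennreal (t powr (DIM('a::euclidean_space) / \<alpha>) * f (c * t powr (- (DIM('a) / \<alpha>)))) \<partial>lborel) = \<infinity>"
  obtains u0 :: "'a::euclidean_space \<Rightarrow> real" where "nonneg_Lq 1 u0" "\<not> Lq_solvable 1 u0"
proof -
  define d where "d = real DIM('a)"
  have d: "0 < d" by (simp add: d_def)
  define \<omega> where "\<omega> = unit_ball_vol d"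
  have \<omega>: "0 < \<omega>" by (simp add: \<omega>_def d_def)
  obtain c \<rho> where c: "0 < c" "0 < \<rho>" "\<rho> \<le> 1"
    "\<And>t x. 0 < t \<Longrightarrow> norm (x::'a) \<le> \<rho> * t powr (1 / \<alpha>) \<Longrightarrow> c * t powr (- (d / \<alpha>)) \<le> p t x"
    using p_lower_bound[where 'a = 'a] unfolding d_def by blast
  define m where "m k = 1 / (real k + 1)\<^sup>2" for k
  have m: "0 < m k" for k by (simp add: m_def)
  let ?g = "\<lambda>k s. ennreal (s powr (d / \<alpha>) * f (c * \<omega> * m k * s powr (- (d / \<alpha>))))"
  have "\<exists>\<delta>>0. ennreal (real k) < (\<integral>\<^sup>+s\<in>{\<delta>..<1 / (real k + 1)}. ?g k s \<partial>lborel)" for k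
  proof -
    have "(\<lambda>n. \<integral>\<^sup>+s. ?g k s * indicator {1 / real (Suc n)..<1 / (real k + 1)} s \<partial>lborel)
        \<longlonglongrightarrow> (\<integral>\<^sup>+s. ?g k s * indicator {0<..<1 / (real k + 1)} s \<partial>lborel)"
    proof (rule nn_integral_LIMSEQ)
      have "1 / real (Suc (Suc n)) \<le> 1 / real (Suc n)" for n by (intro divide_left_mono) auto
      then show "incseq (\<lambda>n s. ?g k s * indicator {1 / real (Suc n)..<1 / (real k + 1)} s)"
        by (intro incseq_SucI le_funI mult_left_mono) (auto split: split_indicator intro: order.trans)
      show "(\<lambda>n. ?g k s * indicator {1 / real (Suc n)..<1 / (real k + 1)} s)
          \<longlonglongrightarrow> ?g k s * indicator {0<..<1 / (real k + 1)} s" for s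
      proof (cases "0 < s")
        case True
        from LIMSEQ_one_over_Suc have "eventually (\<lambda>n. 1 / real (Suc n) < s) sequentially"
          using True by (rule order_tendstoD)
        then have "eventually (\<lambda>n. ?g k s * indicator {1 / real (Suc n)..<1 / (real k + 1)} s
            = ?g k s * indicator {0<..<1 / (real k + 1)} s) sequentially"
          by eventually_elim (use True in \<open>auto split: split_indicator\<close>)
        then show ?thesis by (rule tendsto_eventually)
      next
        case False
        have "\<not> 1 / real (Suc n) \<le> s" for n
          using False by (smt (verit) of_nat_0_less_iff zero_less_Suc zero_less_divide_1_iff)
        with False show ?thesis by (simp del: of_nat_Suc)
      qed
    qed measurable
    also have "(\<integral>\<^sup>+s. ?g k s * indicator {0<..<1 / (real k + 1)} s \<partial>lborel) = \<infinity>"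
      using inf[of "c * \<omega> * m k" "1 / (real k + 1)"] c \<omega> m by (simp add: d_def)
    finally have "eventually (\<lambda>n. ennreal (real k) < (\<integral>\<^sup>+s. ?g k s * indicator {1 / real (Suc n)..<1 / (real k + 1)} s \<partial>lborel)) sequentially"
      by (rule order_tendstoD) simp
    then obtain n where "ennreal (real k) < (\<integral>\<^sup>+s. ?g k s * indicator {1 / real (Suc n)..<1 / (real k + 1)} s \<partial>lborel)"
      by (auto simp: eventually_sequentially)
    then show ?thesis by (intro exI[of _ "1 / real (Suc n)"]) simp
  qed
  then have "\<exists>\<delta>. \<forall>k. 0 < \<delta> k \<and> ennreal (real k) < (\<integral>\<^sup>+s\<in>{\<delta> k..<1 / (real k + 1)}. ?g k s \<partial>lborel)"
    by (intro choice allI)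
  then obtain \<delta> where "\<forall>k. 0 < \<delta> k \<and> ennreal (real k) < (\<integral>\<^sup>+s\<in>{\<delta> k..<1 / (real k + 1)}. ?g k s \<partial>lborel)" ..
  then have \<delta>: "0 < \<delta> k" "ennreal (real k) < (\<integral>\<^sup>+s\<in>{\<delta> k..<1 / (real k + 1)}. ?g k s \<partial>lborel)" for k
    by blast+
  define R where "R k = \<rho> / 2 * \<delta> k powr (1 / \<alpha>)" for k
  have R: "0 < R k" for k using c \<delta>(1)[of k] by (simp add: R_def)
  define b where "b k = m k / R k ^ DIM('a)" for k
  have b: "0 < b k" for k using m R by (simp add: b_def)
  have bR: "b k * R k ^ DIM('a) = m k" for k using R[of k] by (simp add: b_def)
  have sum: "summable (\<lambda>k. b k powr 1 * R k ^ DIM('a))"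
    using b summable_inverse_square by (simp add: less_imp_le bR m_def)
  obtain u0 :: "'a \<Rightarrow> real" where data: "nonneg_Lq 1 u0" and u0_ge: "\<And>k. AE x in lborel. norm x < R k \<longrightarrow> b k \<le> u0 x"
    using Lq_function_above_plateaus[OF order.refl less_imp_le[OF b] less_imp_le[OF R] sum] by blast
  have [measurable]: "u0 \<in> borel_measurable borel" using data by (simp add: nonneg_Lq_def)
  \<comment> \<open>Both \<open>x\<close> and the plateau lie within half of the kernel's reach
    \<open>\<rho> * t powr (1 / \<alpha>)\<close>; this is the origin of \<open>\<rho> / 2\<close>
    in \<open>R\<close>.\<close>
  have H_ge: "ennreal (c * \<omega> * m k * t powr (- (d / \<alpha>))) \<le> H t (\<lambda>y. ennreal (u0 y)) x"
    if t: "\<delta> k \<le> t" and x: "norm x < \<rho> / 2 * t powr (1 / \<alpha>)" for k t x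
  proof -
    have t0: "0 < t" using t \<delta>(1)[of k] by linarith
    have Rt: "R k \<le> \<rho> / 2 * t powr (1 / \<alpha>)"
      unfolding R_def using t \<delta>(1)[of k] \<alpha> c by (intro mult_left_mono powr_mono2) auto
    have "ennreal (c * t powr (- (d / \<alpha>))) * ennreal (\<omega> * R k ^ DIM('a))
        = (\<integral>\<^sup>+y. ennreal (c * t powr (- (d / \<alpha>))) * indicator (ball 0 (R k) :: 'a set) y \<partial>lborel)"
      using R[of k] by (subst nn_integral_cmult_indicator) (auto simp: emeasure_ball \<omega>_def d_def)
    also have "\<dots> \<le> (\<integral>\<^sup>+y. ennreal (p t (x - y)) * indicator (ball 0 (R k)) y \<partial>lborel)"
    proof (rule nn_integral_mono)
      fix y :: 'a
      have "norm (x - y) \<le> \<rho> * t powr (1 / \<alpha>)" if "norm y < R k"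
        using that x Rt norm_triangle_ineq4[of x y] by linarith
      then show "ennreal (c * t powr (- (d / \<alpha>))) * indicator (ball 0 (R k)) y \<le> ennreal (p t (x - y)) * indicator (ball 0 (R k)) y"
        using c(4)[OF t0] by (auto intro!: ennreal_leI split: split_indicator)
    qed
    finally have "ennreal (b k) * ennreal (c * t powr (- (d / \<alpha>)) * (\<omega> * R k ^ DIM('a))) \<le> H t (\<lambda>y. ennreal (u0 y)) x"
      using u0_ge[of k] c \<omega> R[of k]
      by (intro H_plateau_ge[where R = "R k"]) (auto elim!: eventually_mono intro: ennreal_leI simp: ennreal_mult)
    also have "ennreal (b k) * ennreal (c * t powr (- (d / \<alpha>)) * (\<omega> * R k ^ DIM('a)))
        = ennreal (b k * R k ^ DIM('a) * (c * \<omega> * t powr (- (d / \<alpha>))))"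
      using b[of k] by (subst ennreal_mult'[symmetric]) (auto simp: mult_ac)
    finally show ?thesis unfolding bR by (simp add: mult_ac)
  qed
  have "\<not> Lq_solvable 1 u0"
    unfolding Lq_solvable_def
  proof safe
    fix T u C
    assume sol: "ae_solution u0 T u"
      and C: "AE t in lborel. t \<in> {0<..<T} \<longrightarrow> (\<integral>\<^sup>+x. ennreal (u x t powr 1) \<partial>lborel) \<le> ennreal C"
    note [measurable] = ae_solutionD(2)[OF sol]
    have T: "0 < T" by (rule ae_solutionD(1)[OF sol])
    \<comment> \<open>\<open>\<kappa> * s powr (d / \<alpha>)\<close> is the volume of the ball on
      which the lower bound for \<open>u\<close> is used at time \<open>s\<close>.\<close>
    define \<kappa> where "\<kappa> = \<omega> * (\<rho> / 2) ^ DIM('a)"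
    have \<kappa>: "0 < \<kappa>" using \<omega> c by (simp add: \<kappa>_def)
    obtain k :: nat where k: "1 / T + \<bar>C\<bar> / \<kappa> \<le> real k" using real_arch_simple by blast
    have kT: "1 / (real k + 1) < T" and kC: "C \<le> \<kappa> * real k"
    proof -
      have "0 \<le> \<bar>C\<bar> / \<kappa>" "0 < 1 / T" using \<kappa> T by auto
      then have "1 / T < real k + 1" "\<bar>C\<bar> / \<kappa> \<le> real k" using k by linarith+
      then show "1 / (real k + 1) < T" "C \<le> \<kappa> * real k" using T \<kappa> by (auto simp: field_simps)
    qed
    have low: "AE s in lborel. s \<in> {\<delta> k..<T} \<longrightarrow>
       ennreal \<kappa> * ?g k s \<le> (\<integral>\<^sup>+y. ennreal (f (u y s)) \<partial>lborel)"
      using ae_solutionD(4)[OF sol]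
    proof eventually_elim
      fix s assume A: "s \<in> {0<..<T} \<longrightarrow> (AE x in lborel. ennreal (u x s) = duhamel u0 u x s)"
      show "s \<in> {\<delta> k..<T} \<longrightarrow> ennreal \<kappa> * ?g k s \<le> (\<integral>\<^sup>+y. ennreal (f (u y s)) \<partial>lborel)"
      proof
        assume s: "s \<in> {\<delta> k..<T}"
        then have s0: "0 < s" using \<delta>(1)[of k] by auto
        define r where "r = \<rho> / 2 * s powr (1 / \<alpha>)"
        have r: "0 < r" using s0 c by (simp add: r_def)
        let ?v = "c * \<omega> * m k * s powr (- (d / \<alpha>))"
        have v: "0 \<le> ?v" using c \<omega> m[of k] by simp
        have "r ^ DIM('a) = (\<rho> / 2) ^ DIM('a) * s powr (d / \<alpha>)"
        proof -
          have "(s powr (1 / \<alpha>)) ^ DIM('a) = (s powr (1 / \<alpha>)) powr d"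
            using s0 by (simp add: d_def powr_realpow)
          then show ?thesis unfolding r_def power_mult_distrib by (simp add: powr_powr)
        qed
        then have "ennreal \<kappa> * ?g k s = ennreal (f ?v) * ennreal (\<omega> * r ^ DIM('a))"
          using \<kappa> f_nonneg \<omega> r c by (simp add: \<kappa>_def mult_ac flip: ennreal_mult)
        also have "\<dots> = (\<integral>\<^sup>+y. ennreal (f ?v) * indicator (ball 0 r :: 'a set) y \<partial>lborel)"
          using r by (subst nn_integral_cmult_indicator) (auto simp: emeasure_ball \<omega>_def d_def)
        also have "\<dots> \<le> (\<integral>\<^sup>+y. ennreal (f (u y s)) \<partial>lborel)"
        proof (rule nn_integral_mono_AE)
          have "AE y in lborel. ennreal (u y s) = duhamel u0 u y s" using A s s0 by auto
          then show "AE y in lborel. ennreal (f ?v) * indicator (ball 0 r :: 'a set) y \<le> ennreal (f (u y s))"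
          proof eventually_elim
            fix y assume D: "ennreal (u y s) = duhamel u0 u y s"
            show "ennreal (f ?v) * indicator (ball 0 r) y \<le> ennreal (f (u y s))"
            proof (cases "norm y < r")
              case True
              have "ennreal ?v \<le> H s (\<lambda>y. ennreal (u0 y)) y"
                using s True unfolding r_def by (intro H_ge) auto
              also have "\<dots> \<le> ennreal (u y s)" by (simp add: D duhamel_def)
              finally have "?v \<le> u y s"
                using ae_solutionD(3)[OF sol] by (simp add: ennreal_le_iff)
              with True show ?thesis by (simp add: ennreal_leI monoD[OF f_mono])
            qed simp
          qed
        qed
        finally show "ennreal \<kappa> * ?g k s \<le> (\<integral>\<^sup>+y. ennreal (f (u y s)) \<partial>lborel)" .
      qed
    qed
    have "AE t in lborel. t \<in> {1 / (real k + 1)<..<T} \<longrightarrow> False"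
      using nn_integral_solution_ge[OF sol] C
    proof eventually_elim
      fix t
      assume 1: "t \<in> {0<..<T} \<longrightarrow>
          (\<integral>\<^sup>+s\<in>{0<..<t}. (\<integral>\<^sup>+y. ennreal (f (u y s)) \<partial>lborel) \<partial>lborel) \<le> (\<integral>\<^sup>+x. ennreal (u x t) \<partial>lborel)"
        and 2: "t \<in> {0<..<T} \<longrightarrow> (\<integral>\<^sup>+x. ennreal (u x t powr 1) \<partial>lborel) \<le> ennreal C"
      show "t \<in> {1 / (real k + 1)<..<T} \<longrightarrow> False"
      proof
        assume t: "t \<in> {1 / (real k + 1)<..<T}"
        then have t0: "t \<in> {0<..<T}" by (auto intro: less_trans[rotated])
        have "ennreal C \<le> ennreal \<kappa> * ennreal (real k)"
          using kC \<kappa> by (simp add: ennreal_leI flip: ennreal_mult)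
        also have "\<dots> < ennreal \<kappa> * (\<integral>\<^sup>+s\<in>{\<delta> k..<1 / (real k + 1)}. ?g k s \<partial>lborel)"
          using \<kappa> \<delta>(2)[of k] by (intro ennreal_mult_strict_left_mono) auto
        also have "\<dots> = (\<integral>\<^sup>+s. ennreal \<kappa> * (?g k s * indicator {\<delta> k..<1 / (real k + 1)} s) \<partial>lborel)"
          by (rule nn_integral_cmult[symmetric]) measurable
        also have "\<dots> \<le> (\<integral>\<^sup>+s\<in>{0<..<t}. (\<integral>\<^sup>+y. ennreal (f (u y s)) \<partial>lborel) \<partial>lborel)"
        proof (rule nn_integral_mono_AE, use low in eventually_elim)
          fix s assume B: "s \<in> {\<delta> k..<T} \<longrightarrow> ennreal \<kappa> * ?g k s \<le> (\<integral>\<^sup>+y. ennreal (f (u y s)) \<partial>lborel)"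
          show "ennreal \<kappa> * (?g k s * indicator {\<delta> k..<1 / (real k + 1)} s)
            \<le> (\<integral>\<^sup>+y. ennreal (f (u y s)) \<partial>lborel) * indicator {0<..<t} s"
          proof (cases "s \<in> {\<delta> k..<1 / (real k + 1)}")
            case True
            then have "0 < s" "s < t" "s < T" using \<delta>(1)[of k] t by auto
            with True B show ?thesis by simp
          qed simp
        qed
        also have "\<dots> \<le> (\<integral>\<^sup>+x. ennreal (u x t) \<partial>lborel)" using 1 t0 by simp
        also have "\<dots> \<le> ennreal C"
          using 2 t0 ae_solutionD(3)[OF sol] by simp
        finally show False by simp
      qed
    qed
    with kT show False by (rule AE_interval_contradiction)
  qed
  with data show thesis by (rule that)
qed

end

section \<open>The characterisation\<close>

lemma Limsup_ereal_less_top_iff: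
  "Limsup F (\<lambda>s. ereal (g s)) < \<infinity> \<longleftrightarrow> (\<exists>M. eventually (\<lambda>s. g s \<le> M) F)"
proof
  assume "Limsup F (\<lambda>s. ereal (g s)) < \<infinity>"
  then obtain M where "Limsup F (\<lambda>s. ereal (g s)) < ereal M"
    using less_PInf_Ex_of_nat ereal_dense2 by blast
  then have "eventually (\<lambda>s. ereal (g s) < ereal M) F"
    by (rule Limsup_lessD)
  then show "\<exists>M. eventually (\<lambda>s. g s \<le> M) F"
    by (intro exI[of _ M]) (auto elim!: eventually_mono)
next
  assume "\<exists>M. eventually (\<lambda>s. g s \<le> M) F"
  then obtain M where "eventually (\<lambda>s. ereal (g s) \<le> ereal M) F" by auto
  then have "Limsup F (\<lambda>s. ereal (g s)) \<le> ereal M"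
    by (rule Limsup_bounded)
  then show "Limsup F (\<lambda>s. ereal (g s)) < \<infinity>"
    by (rule le_less_trans) simp
qed

context reaction_diffusion
begin

text \<open>Monotonicity extends the bound from a neighbourhood of 0 to the whole unit interval,
  since for \<open>\<delta> \<le> s\<close> and \<open>s \<le> 1\<close> the ratio is at most
  \<open>f 1 / \<delta>\<close>.\<close>

lemma small_ratio_iff:
  "Limsup (at_right 0) (\<lambda>s. ereal (f s / s)) < \<infinity> \<longleftrightarrow> (\<exists>L\<ge>0. \<forall>s. 0 \<le> s \<and> s \<le> 1 \<longrightarrow> f s \<le> L * s)"
proof
  assume "Limsup (at_right 0) (\<lambda>s. ereal (f s / s)) < \<infinity>"
  then obtain M where "eventually (\<lambda>s. f s / s \<le> M) (at_right 0)"
    unfolding Limsup_ereal_less_top_iff by blast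
  then obtain \<delta> where \<delta>: "0 < \<delta>" "\<And>s. 0 < s \<Longrightarrow> s < \<delta> \<Longrightarrow> f s / s \<le> M"
    unfolding eventually_at_right_field by auto
  define L where "L = max 0 (max M (f 1 / \<delta>))"
  have pos: "f s \<le> L * s" if s: "0 < s" "s \<le> 1" for s
  proof (cases "s < \<delta>")
    case True
    then have "f s \<le> M * s" using \<delta>(2)[of s] s by (simp add: field_simps)
    also have "\<dots> \<le> L * s" using s by (intro mult_right_mono) (auto simp: L_def)
    finally show ?thesis .
  next
    case False
    have "f s \<le> f 1 / \<delta> * \<delta>" using s \<delta>(1) f_mono by (simp add: monoD)
    also have "\<dots> \<le> L * s" using False \<delta>(1) f_nonneg[of 1] by (intro mult_mono) (auto simp: L_def)
    finally show ?thesis .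
  qed
  \<comment> \<open>The one-sided limsup does not see the point 0 itself; there the bound follows
    from monotonicity.\<close>
  have "f 0 \<le> 0"
  proof (rule tendsto_lowerbound)
    have "((\<lambda>s. L * s) \<longlongrightarrow> L * 0) (at_right 0)" by (intro tendsto_intros)
    then show "((\<lambda>s. L * s) \<longlongrightarrow> 0) (at_right 0)" by simp
    have "f 0 \<le> L * s" if "0 < s" "s < 1" for s
      using pos[of s] monoD[OF f_mono, of 0 s] that by simp
    then show "eventually (\<lambda>s. f 0 \<le> L * s) (at_right 0)"
      unfolding eventually_at_right_field by (intro exI[of _ 1]) auto
  qed simp
  with pos have "f s \<le> L * s" if "0 \<le> s" "s \<le> 1" for s
    using that by (cases "s = 0") auto
  then show "\<exists>L\<ge>0. \<forall>s. 0 \<le> s \<and> s \<le> 1 \<longrightarrow> f s \<le> L * s"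
    by (intro exI[of _ L]) (auto simp: L_def)
next
  assume "\<exists>L\<ge>0. \<forall>s. 0 \<le> s \<and> s \<le> 1 \<longrightarrow> f s \<le> L * s"
  then obtain L where L: "\<And>s. 0 \<le> s \<Longrightarrow> s \<le> 1 \<Longrightarrow> f s \<le> L * s" by blast
  then have "f s / s \<le> L" if "0 < s" "s < 1" for s
    using that by (simp add: divide_le_eq)
  then show "Limsup (at_right 0) (\<lambda>s. ereal (f s / s)) < \<infinity>"
    unfolding Limsup_ereal_less_top_iff eventually_at_right_field
    by (intro exI[of _ L] exI[of _ 1]) auto
qed

lemma ex_unsolvable_if_large_small_ratio:
  assumes q: "1 \<le> q" and inf: "\<not> Limsup (at_right 0) (\<lambda>s. ereal (f s / s)) < \<infinity>"
  obtains u0 :: "'a::euclidean_space \<Rightarrow> real" where "nonneg_Lq q u0" "\<not> Lq_solvable q u0"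
proof (rule no_solution_small[OF q _ that])
  fix M \<delta> :: real assume \<delta>: "0 < \<delta>"
  show "\<exists>s. 0 < s \<and> s < \<delta> \<and> M * s < f s"
  proof (rule ccontr)
    assume "\<not> ?thesis"
    then have "f s \<le> M * s" if "0 < s" "s < \<delta>" for s
      using that not_less by blast
    then have "f s / s \<le> M" if "0 < s" "s < \<delta>" for s
      using that by (simp add: divide_le_eq)
    then show False
      using inf \<delta> unfolding Limsup_ereal_less_top_iff eventually_at_right_field by blast
  qed
qed

lemma Lq_solvable_iff:
  assumes q: "1 < q"
  shows "(\<forall>u0 :: 'a::euclidean_space \<Rightarrow> real. nonneg_Lq q u0 \<longrightarrow> Lq_solvable q u0) \<longleftrightarrow>
    Limsup (at_right 0) (\<lambda>s. ereal (f s / s)) < \<infinity> \<and>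
    Limsup at_top (\<lambda>s. ereal (f s / s powr (1 + \<alpha> * q / DIM('a)))) < \<infinity>" (is "?E \<longleftrightarrow> ?S \<and> ?L")
proof safe
  assume E: ?E
  show ?S
  proof (rule ccontr)
    assume "\<not> ?S"
    with ex_unsolvable_if_large_small_ratio[OF less_imp_le[OF q]] E show False by blast
  qed
  show ?L
  proof (rule ccontr)
    assume nL: "\<not> ?L"
    have "\<exists>s\<ge>1. M * s powr (1 + \<alpha> * q / DIM('a)) < f s" for M
    proof (rule ccontr)
      assume "\<not> ?thesis"
      then have "f s / s powr (1 + \<alpha> * q / DIM('a)) \<le> M" if "1 \<le> s" for s
        using that by (simp add: divide_le_eq not_less)
      then have "eventually (\<lambda>s. f s / s powr (1 + \<alpha> * q / DIM('a)) \<le> M) at_top"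
        using eventually_ge_at_top[of 1] by (rule eventually_mono[rotated])
      with nL show False unfolding Limsup_ereal_less_top_iff by blast
    qed
    from no_solution_large[OF less_imp_le[OF q] this] E show False by blast
  qed
next
  fix u0 :: "'a \<Rightarrow> real"
  assume ?S ?L and data: "nonneg_Lq q u0"
  define m where "m = 1 + \<alpha> * q / DIM('a)"
  have m: "1 \<le> m" using \<alpha> q by (simp add: m_def)
  obtain L where L: "0 \<le> L" "\<And>s. 0 \<le> s \<Longrightarrow> s \<le> 1 \<Longrightarrow> f s \<le> L * s"
    using \<open>?S\<close> unfolding small_ratio_iff by blast
  obtain M N where MN: "\<And>s. N \<le> s \<Longrightarrow> f s / s powr m \<le> M"
    using \<open>?L\<close> unfolding Limsup_ereal_less_top_iff eventually_at_top_linorder m_def by blast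
  \<comment> \<open>\<open>L\<close> serves \<open>s \<le> 1\<close>, \<open>M\<close> serves
    \<open>N \<le> s\<close>, and \<open>f (max N 1)\<close> the gap between, where \<open>f\<close>
    is bounded by monotonicity.\<close>
  define K where "K = max L (max M (f (max N 1)))"
  have K: "0 \<le> K" using L by (simp add: K_def)
  have f_le: "f s \<le> K * (s + s powr m)" if s: "0 \<le> s" for s
  proof -
    consider "s \<le> 1" | "1 \<le> s" "s < N" | "1 \<le> s" "N \<le> s" by linarith
    then show ?thesis
    proof cases
      case 1
      have "f s \<le> L * s" using 1 s by (intro L)
      also have "\<dots> \<le> K * (s + s powr m)" using s K by (intro mult_mono) (auto simp: K_def)
      finally show ?thesis .
    next
      case 2
      have "f s \<le> f (max N 1) * 1" using 2 f_mono by (simp add: monoD)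
      also have "\<dots> \<le> K * (s + s powr m)" using 2 K by (intro mult_mono) (auto simp: K_def intro: add_increasing2)
      finally show ?thesis .
    next
      case 3
      have "f s \<le> M * s powr m" using MN[OF 3(2)] 3(1) by (simp add: divide_le_eq)
      also have "\<dots> \<le> K * s powr m" by (intro mult_right_mono) (auto simp: K_def)
      also have "\<dots> \<le> K * (s + s powr m)" using s K by (intro mult_left_mono) auto
      finally show ?thesis .
    qed
  qed
  show "Lq_solvable q u0"
    by (rule solution_Lq[OF q K f_le[unfolded m_def] data])
qed

lemma L1_solvable_iff:
  shows "(\<forall>u0 :: 'a::euclidean_space \<Rightarrow> real. nonneg_Lq 1 u0 \<longrightarrow> Lq_solvable 1 u0) \<longleftrightarrow>
    Limsup (at_right 0) (\<lambda>s. ereal (f s / s)) < \<infinity> \<and>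
    (\<integral>\<^sup>+s\<in>{1..}. ennreal (s powr (- (1 + \<alpha> / DIM('a))) * sup_ratio f s) \<partial>lborel) < \<infinity>" (is "?E \<longleftrightarrow> ?S \<and> ?I")
proof -
  interpret nondecreasing_nonneg f
    using f_mono f_nonneg by unfold_locales
  define \<gamma> where "\<gamma> = \<alpha> / DIM('a)"
  have \<gamma>: "0 < \<gamma>" using \<alpha> by (simp add: \<gamma>_def)
  have \<gamma>': "1 / \<gamma> = DIM('a) / \<alpha>" by (simp add: \<gamma>_def)
  show ?thesis
  proof safe
    assume E: ?E
    show ?S
    proof (rule ccontr)
      assume "\<not> ?S"
      with ex_unsolvable_if_large_small_ratio[OF order.refl] E show False by blast
    qed
    show ?I
    proof (rule ccontr)
      assume "\<not> ?I"
      then have "(\<integral>\<^sup>+t\<in>{0<..<\<tau>}. ennreal (t powr (DIM('a) / \<alpha>) * f (c * t powr (- (DIM('a) / \<alpha>)))) \<partial>lborel) = \<infinity>"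
        if "0 < c" "0 < \<tau>" for c \<tau>
        using integral_time_infinite[OF \<gamma> that] unfolding \<gamma>' unfolding \<gamma>_def by simp
      from no_solution_L1[OF this] E show False by blast
    qed
  next
    fix u0 :: "'a \<Rightarrow> real"
    assume ?S ?I and data: "nonneg_Lq 1 u0"
    obtain L where L: "0 \<le> L" "\<And>s. 0 \<le> s \<Longrightarrow> s \<le> 1 \<Longrightarrow> f s \<le> L * s"
      using \<open>?S\<close> unfolding small_ratio_iff by blast
    \<comment> \<open>\<open>L\<close> covers the values below 1, about which the supremum starting
      at 1 says nothing.\<close>
    define \<phi> where "\<phi> s = L + sup_ratio f (max 1 s)" for s
    have [measurable]: "\<phi> \<in> borel_measurable borel"
      unfolding \<phi>_def[abs_def] by measurable
    have \<phi>: "0 \<le> \<phi> s" for s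
      using L sup_ratio_nonneg[of "max 1 s"] by (simp add: \<phi>_def)
    have f_le: "f s \<le> \<phi> s' * s" if s: "0 \<le> s" "s \<le> s'" "1 \<le> s'" for s s'
    proof (cases "s \<le> 1")
      case True
      have "f s \<le> L * s" using s True by (intro L)
      also have "\<dots> \<le> \<phi> s' * s"
        using s sup_ratio_nonneg[of "max 1 s'"] by (intro mult_right_mono) (auto simp: \<phi>_def)
      finally show ?thesis .
    next
      case False
      have "f s = f s / s * s" using False by simp
      also have "\<dots> \<le> \<phi> s' * s"
        using s False L ratio_le_sup_ratio[of s "max 1 s'"] by (intro mult_right_mono) (auto simp: \<phi>_def)
      finally show ?thesis .
    qed
    have "(\<integral>\<^sup>+s\<in>{1..}. ennreal (\<phi> s * s powr (- 1 - \<gamma>)) \<partial>lborel)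
        = (\<integral>\<^sup>+s. ennreal L * (ennreal (s powr (- 1 - \<gamma>)) * indicator {1..} s)
            + ennreal (s powr (- (1 + \<gamma>)) * sup_ratio f (max 1 s)) * indicator {1..} s \<partial>lborel)"
    proof (rule nn_integral_cong)
      fix s :: real
      show "ennreal (\<phi> s * s powr (- 1 - \<gamma>)) * indicator {1..} s
        = ennreal L * (ennreal (s powr (- 1 - \<gamma>)) * indicator {1..} s)
            + ennreal (s powr (- (1 + \<gamma>)) * sup_ratio f (max 1 s)) * indicator {1..} s"
        using L sup_ratio_nonneg[of "max 1 s"]
        by (cases "1 \<le> s") (simp_all add: \<phi>_def distrib_right mult.commute flip: ennreal_mult ennreal_plus)
    qed
    also have "\<dots> = ennreal L * ennreal (1 powr (- \<gamma>) / \<gamma>)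
        + (\<integral>\<^sup>+s. ennreal (s powr (- (1 + \<gamma>)) * sup_ratio f (max 1 s)) * indicator {1..} s \<partial>lborel)"
      using \<gamma> nn_integral_powr_atLeast[of 1 \<gamma>] by (simp add: nn_integral_add nn_integral_cmult)
    also have "(\<integral>\<^sup>+s. ennreal (s powr (- (1 + \<gamma>)) * sup_ratio f (max 1 s)) * indicator {1..} s \<partial>lborel)
        = (\<integral>\<^sup>+s\<in>{1..}. ennreal (s powr (- (1 + \<gamma>)) * sup_ratio f s) \<partial>lborel)"
      by (intro nn_integral_cong) (auto split: split_indicator)
    also have "ennreal L * ennreal (1 powr (- \<gamma>) / \<gamma>) + \<dots> < \<infinity>"
      using \<open>?I\<close> unfolding \<gamma>_def by (simp add: ennreal_mult_less_top)
    finally have fin: "(\<integral>\<^sup>+s\<in>{1..}. ennreal (\<phi> s * s powr (- 1 - \<gamma>)) \<partial>lborel) < \<infinity>" .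
    have small: "\<exists>T>0. (\<integral>\<^sup>+s\<in>{0<..<T}. ennreal (\<phi> (A * s powr (- (DIM('a) / \<alpha>)))) \<partial>lborel) \<le> ennreal (1 / 2)"
      if "0 < A" for A
      using integral_time_small[OF _ \<phi> \<gamma> that fin] unfolding \<gamma>' by simp
    show "Lq_solvable 1 u0"
      by (rule solution_L1[OF _ \<phi> f_le small data]) measurable
  qed
qed

section \<open>Passage to the given definitions over \<open>real ^ 'n\<close>\<close>

lemma frac_heat_kernel_eq: "frac_heat_kernel \<alpha> t x y = p t (x - y :: real ^ 'n)"
  by (simp add: frac_heat_kernel_def stable_density_def)

text \<open>Positivity of the kernel lets \<open>ennreal\<close> be split across the product, also
  where \<open>g\<close> is negative and both sides are 0.\<close>

lemma frac_semigroup_eq: "0 < t \<Longrightarrow> frac_semigroup \<alpha> t g x = H t (\<lambda>y :: real ^ 'n. ennreal (g y)) x"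
  unfolding frac_semigroup_def H_def frac_heat_kernel_eq
  by (intro nn_integral_cong ennreal_mult' p_nonneg)

lemma duhamel_eq:
  assumes "0 < t" and "\<And>s. 0 \<le> s \<Longrightarrow> F s = f s" and "\<And>y s. 0 \<le> u y s"
  shows "duhamel u0 u x t = frac_semigroup \<alpha> t u0 x
     + (\<integral>\<^sup>+s\<in>{0<..<t}. frac_semigroup \<alpha> (t - s) (\<lambda>y :: real ^ 'n. F (u y s)) x \<partial>lborel)"
  unfolding duhamel_def using assms
  by (intro arg_cong2[where f = "(+)"] nn_integral_cong) (auto simp: frac_semigroup_eq split: split_indicator)

lemma local_integral_solution_iff:
  fixes u :: "real ^ 'n \<Rightarrow> real \<Rightarrow> real"
  assumes F: "\<And>s. 0 \<le> s \<Longrightarrow> F s = f s" and T: "0 < T"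
  shows "local_integral_solution \<alpha> F u0 T u \<longleftrightarrow> ae_solution u0 T u"
proof -
  have "(\<lambda>z. u (fst z) (snd z)) \<in> borel_measurable (lborel \<Otimes>\<^sub>M lborel) \<longleftrightarrow> case_prod u \<in> borel_measurable (borel \<Otimes>\<^sub>M borel)"
    by (simp add: case_prod_unfold cong: measurable_cong_sets sets_pair_measure_cong)
  then show ?thesis
    unfolding local_integral_solution_def ae_solution_def using T
    by (auto simp: duhamel_eq[OF _ F] elim!: eventually_mono)
qed

lemma local_existence_property_iff:
  assumes F: "\<And>s. 0 \<le> s \<Longrightarrow> F s = f s"
  shows "local_existence_property TYPE('n::finite) \<alpha> F q \<longleftrightarrow>
    (\<forall>u0 :: real ^ 'n \<Rightarrow> real. nonneg_Lq q u0 \<longrightarrow> Lq_solvable q u0)"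
proof -
  have sol: "(\<exists>T u. local_Lq_solution \<alpha> F q u0 T u) \<longleftrightarrow> Lq_solvable q u0" for u0 :: "real ^ 'n \<Rightarrow> real"
  proof -
    have "local_Lq_solution \<alpha> F q u0 T u \<longleftrightarrow>
      (\<exists>C. ae_solution u0 T u \<and> (AE t in lborel. t \<in> {0<..<T} \<longrightarrow> (\<integral>\<^sup>+x. ennreal (u x t powr q) \<partial>lborel) \<le> ennreal C))"
      for T u
    \<comment> \<open>If \<open>T\<close> is not positive or \<open>u\<close> takes a negative
      value, both sides are false; otherwise the absolute value in the norm disappears.\<close>
    proof (cases "0 < T \<and> (\<forall>x t. 0 \<le> u x t)")
      case True
      then show ?thesis
        by (simp add: local_Lq_solution_def local_integral_solution_iff[OF F])
    qed (auto simp: local_Lq_solution_def ae_solution_def local_integral_solution_def)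
    then show ?thesis by (simp add: Lq_solvable_def)
  qed
  show ?thesis
    unfolding local_existence_property_def sol in_Lq_def nonneg_Lq_def by (auto simp: abs_of_nonneg)
qed

end

theorem theorem5p1:
  fixes \<alpha> :: real and f :: "real \<Rightarrow> real"
  assumes "1 < \<alpha>" and "\<alpha> \<le> 2"
    and "continuous_on {0..} f" and "mono_on {0..} f" and "\<forall>s\<ge>0. 0 \<le> f s"
  shows "(\<forall>q::real. 1 < q \<longrightarrow>
            (local_existence_property TYPE('n::finite) \<alpha> f q \<longleftrightarrow>
               Limsup (at_right 0) (\<lambda>s. ereal (f s / s)) < \<infinity> \<and>
               Limsup at_top (\<lambda>s. ereal (f s / s powr (1 + \<alpha> * q / real CARD('n)))) < \<infinity>))
       \<and> (local_existence_property TYPE('n) \<alpha> f 1 \<longleftrightarrow>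
               Limsup (at_right 0) (\<lambda>s. ereal (f s / s)) < \<infinity> \<and>
               (\<integral>\<^sup>+ s\<in>{1..}. ennreal (s powr (- (1 + \<alpha> / real CARD('n))) * sup_ratio f s) \<partial>lborel) < \<infinity>)"
proof -
  \<comment> \<open>The hypotheses say nothing about \<open>f\<close> on the negative axis.\<close>
  define g where "g s = f (max 0 s)" for s
  have g: "f s = g s" if "0 \<le> s" for s using that by (simp add: g_def)
  interpret reaction_diffusion \<alpha> g
  proof
    show "continuous_on UNIV g"
      unfolding g_def by (rule continuous_on_compose2[OF assms(3)]) (auto intro!: continuous_intros)
    show "mono g"
      using assms(4) by (auto simp: g_def mono_on_def intro!: monoI)
  qed (use assms in \<open>auto simp: g_def\<close>)
  have small: "Limsup (at_right 0) (\<lambda>s. ereal (f s / s)) = Limsup (at_right 0) (\<lambda>s. ereal (g s / s))"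
    by (intro Limsup_eq eventually_mono[OF eventually_at_right_less]) (simp add: g)
  have large: "Limsup at_top (\<lambda>s. ereal (f s / s powr m)) = Limsup at_top (\<lambda>s. ereal (g s / s powr m))" for m
    by (intro Limsup_eq eventually_mono[OF eventually_ge_at_top[of 0]]) (simp add: g)
  have ratio: "sup_ratio f = sup_ratio g"
    unfolding sup_ratio_def by (intro ext arg_cong[where f = Sup] image_cong) (auto simp: g)
  have E: "local_existence_property TYPE('n) \<alpha> f q \<longleftrightarrow>
      (\<forall>u0 :: real ^ 'n \<Rightarrow> real. nonneg_Lq q u0 \<longrightarrow> Lq_solvable q u0)" for q
    by (rule local_existence_property_iff) (rule g)
  have dim: "DIM(real ^ 'n) = CARD('n)" by simp
  show ?thesis
    unfolding E small large ratio
    using Lq_solvable_iff[where 'a = "real ^ 'n", unfolded dim] L1_solvable_iff[where 'a = "real ^ 'n", unfolded dim]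
    by blast
qed

end
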